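(* Let $k\ge2$ and $\alpha,\beta>0$, and consider the dihedral group $I_{2k}$ with multiplicity $\kappa=(\alpha,\beta)$. For $z=|z|e^{i\phi_1}$, $w=|w|e^{i\phi_2}$, $u,v\in[-1,1]$ put $q=q_{u,v}(k\phi_1,k\phi_2)$ and $$a_j^+=|zw|\cos\Big(\frac{q-2j\pi}{k}\Big),\qquad a_j^-=|zw|\cos\Big(\frac{\pi-q-2j\pi}{k}\Big),\qquad j=0,\dots,k-1.$$ Then $$\mathcal J_\kappa(z,w)=\frac{\Gamma(k(\alpha+\beta))}{2\Gamma(\alpha+\beta)^k}\int_{-1}^1\int_{-1}^1\int_{T^{k-1}}\Big(e^{\sum_{j=0}^{k-1}a_j^+t_j}+e^{\sum_{j=0}^{k-1}a_j^-t_j}\Big)\prod_{j=0}^{k-1}t_j^{\alpha+\beta-1}\,dt_1\cdots dt_{k-1}\,d\nu^\alpha(u)\,d\nu^\beta(v),$$ where $(t_1,\dots,t_{k-1})$ ranges over $T^{k-1}$ and $t_0=1-\sum_{j=1}^{k-1}t_j$.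
   Context: Identify $\mathbb{R}^2$ with $\mathbb{C}$, with inner product $\langle z,w\rangle=\mathrm{Re}(z\bar w)$, and write $z=|z|e^{i\phi_1}$, $w=|w|e^{i\phi_2}$. The dihedral group $I_{2k}$ (order $4k$) contains the reflections $z\mapsto\bar ze^{ij\pi/k}$, $j=0,\dots,2k-1$, which form two conjugacy classes ($j$ even, containing $z\mapsto\bar z$; and $j$ odd); the multiplicity $\kappa=(\alpha,\beta)$ takes the value $\alpha$ on the roots of the class with $j$ even and $\beta$ on the class with $j$ odd. Dunkl operators: $T_jf(x)=\partial_jf(x)+\sum_{\alpha\in R_+}\kappa(\alpha)\alpha_j\frac{f(x)-f(\sigma_\alpha x)}{\langle\alpha,x\rangle}$; the Dunkl kernel $E_\kappa(x,y)$ is the joint eigenfunction $T_j^{(x)}E_\kappa=y_jE_\kappa$, $E_\kappa(0,y)=1$; the generalized Bessel function is $\mathcal J_\kappa(x,y)=\frac1{|G|}\sum_{g\in G}E_\kappa(x,gy)$. Measures on $[-1,1]$: $d\nu^\alpha(u)=\frac{\Gamma(\alpha+1/2)}{\sqrt\pi\,\Gamma(\alpha)}(1-u^2)^{\alpha-1}du$. Notation: $\xi_{u,v}(\theta_1,\theta_2)=v\cos\theta_1\cos\theta_2+u\sin\theta_1\sin\theta_2$ and $q_{u,v}(\theta_1,\theta_2)=\arccos\xi_{u,v}(\theta_1,\theta_2)\in[0,\pi]$. $T^{n}=\{(t_1,\dots,t_n):t_j>0,\ \sum t_j<1\}$ is the open unit simplex in $\mathbb{R}^n$. *)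

theory Defs
  imports "HOL-Analysis.Analysis"
begin

text \<open>R^2 is identified with the type complex; the inner product on complex
  (real_inner instance) is x \<bullet> y = Re x * Re y + Im x * Im y = Re (x * cnj y).\<close>

definition dih_refl :: "nat \<Rightarrow> nat \<Rightarrow> complex \<Rightarrow> complex" where
  "dih_refl k j z = cnj z * cis (real j * pi / real k)"

definition dih_rot :: "nat \<Rightarrow> nat \<Rightarrow> complex \<Rightarrow> complex" where
  "dih_rot k j z = z * cis (real j * pi / real k)"

text \<open>A (unit) root of the reflection dih_refl k j: sigma_alpha x = x - 2 (alpha.x) alpha.\<close>
definition dih_root :: "nat \<Rightarrow> nat \<Rightarrow> complex" where
  "dih_root k j = \<i> * cis (real j * pi / (2 * real k))"

definition dih_mult :: "nat \<Rightarrow> real \<Rightarrow> real \<Rightarrow> nat \<Rightarrow> real" where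
  "dih_mult k a b j = (if even j then a else b)"

definition dunkl_op :: "nat \<Rightarrow> real \<Rightarrow> real \<Rightarrow> complex \<Rightarrow> (complex \<Rightarrow> real) \<Rightarrow> complex \<Rightarrow> real" where
  "dunkl_op k a b e f x = frechet_derivative f (at x) e
     + (\<Sum>j<2*k. dih_mult k a b j * (dih_root k j \<bullet> e)
          * (f x - f (dih_refl k j x)) / (dih_root k j \<bullet> x))"

text \<open>Points off all mirrors (where the difference quotients are literally defined).\<close>
definition dih_regular :: "nat \<Rightarrow> complex \<Rightarrow> bool" where
  "dih_regular k x \<longleftrightarrow> (\<forall>j<2*k. dih_root k j \<bullet> x \<noteq> 0)"

definition dunkl_kernel :: "nat \<Rightarrow> real \<Rightarrow> real \<Rightarrow> complex \<Rightarrow> complex \<Rightarrow> real" where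
  "dunkl_kernel k a b x y =
     (THE f. (\<forall>p. f differentiable (at p)) \<and> f 0 = 1 \<and>
        (\<forall>p. dih_regular k p \<longrightarrow>
           dunkl_op k a b 1 f p = Re y * f p \<and> dunkl_op k a b \<i> f p = Im y * f p)) x"

definition gen_bessel :: "nat \<Rightarrow> real \<Rightarrow> real \<Rightarrow> complex \<Rightarrow> complex \<Rightarrow> real" where
  "gen_bessel k a b x y =
     (\<Sum>j<2*k. dunkl_kernel k a b x (dih_rot k j y) + dunkl_kernel k a b x (dih_refl k j y))
       / (4 * real k)"

definition nu_density :: "real \<Rightarrow> real \<Rightarrow> real" where
  "nu_density a u = Gamma (a + 1/2) / (sqrt pi * Gamma a) * (1 - u\<^sup>2) powr (a - 1)"

definition xi_uv :: "real \<Rightarrow> real \<Rightarrow> real \<Rightarrow> real \<Rightarrow> real" where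
  "xi_uv u v t1 t2 = v * cos t1 * cos t2 + u * sin t1 * sin t2"

definition q_uv :: "real \<Rightarrow> real \<Rightarrow> real \<Rightarrow> real \<Rightarrow> real" where
  "q_uv u v t1 t2 = arccos (xi_uv u v t1 t2)"

text \<open>Open unit simplex T^n, coordinates indexed by {1..n} (extensional functions,
  i.e. points of the space of PiM {1..n} (\<lambda>_. lborel)).\<close>
definition unit_simplex :: "nat \<Rightarrow> (nat \<Rightarrow> real) set" where
  "unit_simplex n = {t \<in> {1..n} \<rightarrow>\<^sub>E UNIV. (\<forall>j\<in>{1..n}. 0 < t j) \<and> (\<Sum>j=1..n. t j) < 1}"

definition simplex_ext :: "nat \<Rightarrow> (nat \<Rightarrow> real) \<Rightarrow> nat \<Rightarrow> real" where
  "simplex_ext n t j = (if j = 0 then 1 - (\<Sum>i=1..n. t i) else t j)"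

end

theory Submission
  imports Defs "HOL-Computational_Algebra.Fundamental_Theorem_Algebra"
    "HOL-Complex_Analysis.Cauchy_Integral_Formula"
begin

text \<open>Write $A = \sum_j \kappa_j (1 - \sigma_j)$ and $\lambda = \alpha + \beta$. The radial part of the Dunkl
  system says $(n + A) E_n = \langle x, y\rangle E_{n-1}$ for the homogeneous components $E_n$ of the Dunkl kernel.
  As $A$ is positive on the functions on an orbit, this determines the kernel (an energy estimate along rays),
  and it also constructs it: the angular equations follow by induction, because every reflection anticommutes
  with the angular operator.

  Put $S(r) = \sum_n (k\lambda + 1)_n E_n r^n$. The radial equation for $S$ is a singular linear equation in $r$, whose
  solution is unique by the same energy estimate. After the substitution $r = 2\rho/(1 + \rho^2)$ a closed form, modelled
  on Dunkl's Poisson kernel for the map $z \mapsto z^k$, satisfies it; the reflections collapse by Poisson kernel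
  sums over roots of unity, and what remains is an integration by parts in $u$ and $v$. Averaging over the group
  leaves one integral of a power of $1 - 2\rho^k \xi_{u,v} + \rho^{2k}$. The same expression is obtained from the right-hand side
  by applying the Feynman (Dirichlet) integral to the simplex, so the Taylor coefficients agree.\<close>

section \<open>The dihedral group acting on functions\<close>

text \<open>The weight k\<lambda>+1 is the sum of the multiplicities over all mirrors plus d/2 for d
  = 2. Dunkl's intertwining operator carries <x,y>^n / n! to E_n, hence (1 - r<x,y>)^(-k\<lambda>-1)
  to S(r), and for r = 2\<rho>/(1+\<rho>^2) this is the Poisson kernel up to factors in \<rho>
  alone. That operator only motivates the closed form; the candidate is verified through its
  differential equation. The kernel is specified by eigenvalue equations off the mirrors for a
  merely differentiable function, so uniqueness can rely neither on smoothness nor on a power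
  series; the sign of A on orbits and the density of the regular points replace them. Both radial
  equations are singular at the origin, and the sign of A makes the singular term harmless in the
  energy estimates. On the simplex side the extra 1 in the exponent raises one Dirichlet parameter
  by one; this produces a sum of reciprocals, which is again a Poisson kernel sum.\<close>

lemma sum_periodic_shift:
  fixes h :: "int \<Rightarrow> real"
  assumes per: "\<And>i. h (i + int N) = h i"
  shows "(\<Sum>i<N. h (int i + m)) = (\<Sum>i<N. h (int i))"
proof -
  have step: "(\<Sum>i<N. h (int i + (l + 1))) = (\<Sum>i<N. h (int i + l))" for l
  proof -
    have "(\<Sum>i<N. h (int i + (l + 1))) + h l = (\<Sum>i<Suc N. h (int i + l))"
      by (subst sum.lessThan_Suc_shift) (simp add: algebra_simps)
    also have "\<dots> = (\<Sum>i<N. h (int i + l)) + h (l + int N)"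
      by (simp add: algebra_simps)
    finally show ?thesis by (simp add: per)
  qed
  show ?thesis
  proof (induction m rule: int_induct[where k = 0])
    case base
    show ?case by simp
  next
    case (step1 i)
    then show ?case using step[of i] by simp
  next
    case (step2 i)
    then show ?case using step[of "i - 1"] by simp
  qed
qed

lemma sum_periodic_reflect:
  fixes h :: "int \<Rightarrow> real"
  assumes per: "\<And>i. h (i + int N) = h i"
  shows "(\<Sum>i<N. h (m - int i)) = (\<Sum>i<N. h (int i))"
proof -
  have "(\<Sum>i<N. h (m - int i)) = (\<Sum>i<N. h (m - int (N - Suc i)))"
    by (subst sum.nat_diff_reindex) simp
  also have "\<dots> = (\<Sum>i<N. h (int i + (m + 1 - int N)))"
    by (intro sum.cong) (auto simp: of_nat_diff algebra_simps)
  also have "\<dots> = (\<Sum>i<N. h (int i))"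
    by (rule sum_periodic_shift) (rule per)
  finally show ?thesis .
qed

text \<open>\<open>V t * exp (- C * t)\<close> is nonincreasing, starts at 0 and is nonnegative. The
  differential inequality is asked for at interior points only, because the equations it serves
  carry a factor 1/t at the origin.\<close>

lemma gronwall_zero:
  fixes V V' :: "real \<Rightarrow> real"
  assumes cont: "continuous_on {0..d} V" and V_0: "V 0 = 0"
    and nonneg: "\<And>t. 0 \<le> t \<Longrightarrow> t \<le> d \<Longrightarrow> 0 \<le> V t"
    and deriv: "\<And>t. 0 < t \<Longrightarrow> t < d \<Longrightarrow> (V has_real_derivative V' t) (at t)"
    and bound: "\<And>t. 0 < t \<Longrightarrow> t < d \<Longrightarrow> V' t \<le> C * V t"
    and t: "0 \<le> t" "t \<le> d"
  shows "V t = 0"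
proof (cases "t = 0")
  case False
  define W where "W s = V s * exp (- C * s)" for s
  have "W t \<le> W 0"
  proof (rule DERIV_nonpos_imp_decreasing_open[where f = W])
    show "0 \<le> t" by fact
    show "\<exists>y. (W has_real_derivative y) (at s) \<and> y \<le> 0" if "0 < s" "s < t" for s
    proof (intro exI conjI)
      show "(W has_real_derivative (V' s - C * V s) * exp (- C * s)) (at s)"
        unfolding W_def using that t
        by (auto intro!: derivative_eq_intros deriv simp: algebra_simps)
      show "(V' s - C * V s) * exp (- C * s) \<le> 0"
        using bound[of s] that t by (intro mult_nonpos_nonneg) auto
    qed
    show "continuous_on {0..t} W"
      unfolding W_def using t
      by (intro continuous_intros continuous_on_subset[OF cont]) auto
  qed
  then have "V t \<le> 0" by (simp add: W_def V_0 mult_le_0_iff)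
  with nonneg t show ?thesis by (simp add: antisym)
qed (simp add: V_0)

locale dihedral =
  fixes k :: nat and a b :: real
  assumes k: "k \<ge> 1" and a: "a > 0" and b: "b > 0"
begin

text \<open>Integer indices turn the group law into addition and subtraction of indices, as in
  \<open>rfl_rfl\<close>. Sums still run over the \<open>2*k\<close> residues, so shifts and
  reversals of the index are handled by periodicity.\<close>

definition c :: "int \<Rightarrow> complex" where
  "c i = cis (real_of_int i * pi / real k)"

definition rot :: "int \<Rightarrow> complex \<Rightarrow> complex" where "rot i x = x * c i"
definition rfl :: "int \<Rightarrow> complex \<Rightarrow> complex" where "rfl i x = cnj x * c i"
definition kappa :: "int \<Rightarrow> real" where "kappa i = (if even i then a else b)"

text \<open>Summed over the 4k group elements and not over the points of the orbit, so that
  invariance needs no case distinction for points on a mirror. Applied to a product it is an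
  invariant inner product of functions on an orbit.\<close>

definition orbit_sum :: "(complex \<Rightarrow> real) \<Rightarrow> complex \<Rightarrow> real" where
  "orbit_sum f x = (\<Sum>i<2*k. f (rot (int i) x) + f (rfl (int i) x))"

text \<open>The operator A of the overview; \<open>refl_diff_eq\<close> separates its scalar part,
  the sum k(a + b) of all multiplicities.\<close>

definition refl_diff :: "(complex \<Rightarrow> real) \<Rightarrow> complex \<Rightarrow> real" where
  "refl_diff f x = (\<Sum>j<2*k. kappa (int j) * (f x - f (rfl (int j) x)))"

lemma k_pos [simp]: "k > 0" "real k > 0" "k \<noteq> 0"
  using k by auto

lemma c_add: "c (i + j) = c i * c j"
  by (simp add: c_def cis_mult ring_distribs add_divide_distrib)

lemma c_0 [simp]: "c 0 = 1"
  by (simp add: c_def)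

lemma c_period [simp]: "c (i + 2 * int k) = c i"
proof -
  have "real_of_int (2 * int k) * pi / real k = 2 * pi" using k_pos by simp
  then have "c (2 * int k) = 1" unfolding c_def by (simp only: cis_2pi)
  then show ?thesis by (simp add: c_add)
qed

lemma c_cnj: "cnj (c i) = c (- i)"
  by (simp add: c_def cis_cnj)

lemma norm_c [simp]: "cmod (c i) = 1"
  by (simp add: c_def)

lemma norm_rot [simp]: "cmod (rot i x) = cmod x"
  by (simp add: rot_def norm_mult)

lemma norm_rfl [simp]: "cmod (rfl i x) = cmod x"
  by (simp add: rfl_def norm_mult)

lemma rfl_rot: "rfl j (rot i x) = rfl (j - i) x"
  by (simp add: rfl_def rot_def c_cnj diff_conv_add_uminus c_add mult_ac del: add_uminus_conv_diff)

lemma rfl_rfl: "rfl j (rfl i x) = rot (j - i) x"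
  by (simp add: rfl_def rot_def c_cnj diff_conv_add_uminus c_add mult_ac del: add_uminus_conv_diff)

lemma rot_rfl: "rot j (rfl i x) = rfl (j + i) x"
  by (simp add: rfl_def rot_def c_add mult_ac)

lemma rot_0 [simp]: "rot 0 x = x"
  by (simp add: rot_def)

lemma rot_period [simp]: "rot (i + 2 * int k) x = rot i x"
  by (simp add: rot_def)

lemma rfl_period [simp]: "rfl (i + 2 * int k) x = rfl i x"
  by (simp add: rfl_def)

lemma kappa_period [simp]: "kappa (i + 2 * int k) = kappa i"
  by (simp add: kappa_def)

lemma kappa_nonneg: "0 \<le> kappa i"
  using a b by (simp add: kappa_def)

lemma dih_refl_eq: "dih_refl k j x = rfl (int j) x"
  by (simp add: dih_refl_def rfl_def c_def)

lemma dih_rot_eq: "dih_rot k j x = rot (int j) x"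
  by (simp add: dih_rot_def rot_def c_def)

lemma dih_mult_eq: "dih_mult k a b j = kappa (int j)"
  by (simp add: dih_mult_def kappa_def)

lemma sum_reflect:
  assumes "\<And>i. h (i + 2 * int k) = h i"
  shows "(\<Sum>i<2*k. h (m - int i)) = (\<Sum>i<2*k. h (int i) :: real)"
  using assms by (intro sum_periodic_reflect) simp

lemma orbit_sum_rfl: "orbit_sum (\<lambda>p. f (rfl j p)) x = orbit_sum f x"
proof -
  have "(\<Sum>i<2*k. f (rfl (j - int i) x)) = (\<Sum>i<2*k. f (rfl (int i) x))"
    by (rule sum_reflect[where h = "\<lambda>i. f (rfl i x)"]) simp
  moreover have "(\<Sum>i<2*k. f (rot (j - int i) x)) = (\<Sum>i<2*k. f (rot (int i) x))"
    by (rule sum_reflect[where h = "\<lambda>i. f (rot i x)"]) simp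
  ultimately show ?thesis
    by (simp add: orbit_sum_def rfl_rot rfl_rfl sum.distrib)
qed

lemma orbit_sum_add: "orbit_sum (\<lambda>p. f p + g p) x = orbit_sum f x + orbit_sum g x"
  by (simp add: orbit_sum_def sum.distrib)

lemma orbit_sum_diff: "orbit_sum (\<lambda>p. f p - g p) x = orbit_sum f x - orbit_sum g x"
  by (simp add: orbit_sum_def sum.distrib sum_subtractf)

lemma orbit_sum_cmult: "orbit_sum (\<lambda>p. r * f p) x = r * orbit_sum f x"
  by (simp add: orbit_sum_def sum_distrib_left ring_distribs)

lemma orbit_sum_sum: "orbit_sum (\<lambda>p. \<Sum>j\<in>J. f j p) x = (\<Sum>j\<in>J. orbit_sum (f j) x)"
  unfolding orbit_sum_def by (subst sum.swap) (simp add: sum.distrib)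

lemma orbit_sum_mono_all: "(\<And>p. f p \<le> g p) \<Longrightarrow> orbit_sum f x \<le> orbit_sum g x"
  unfolding orbit_sum_def by (intro sum_mono add_mono) auto

lemma orbit_sum_sq_nonneg: "0 \<le> orbit_sum (\<lambda>p. (f p)\<^sup>2) x"
  unfolding orbit_sum_def by (intro sum_nonneg add_nonneg_nonneg) auto

lemma orbit_sum_sq_zero:
  assumes "orbit_sum (\<lambda>p. (f p)\<^sup>2) x \<le> 0"
  shows "f (rot i x) = 0" "f (rfl i x) = 0"
proof -
  have eq: "orbit_sum (\<lambda>p. (f p)\<^sup>2) x = 0"
    using assms orbit_sum_sq_nonneg[of f x] by linarith
  then have *: "f (rot (int j) x) = 0 \<and> f (rfl (int j) x) = 0" if "j < 2 * k" for j
    unfolding orbit_sum_def using that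
    by (subst (asm) sum_nonneg_eq_0_iff) (auto simp: add_nonneg_eq_0_iff)
  define j where "j = nat (i mod (2 * int k))"
  have j: "j < 2 * k" "int j = i mod (2 * int k)"
    using k unfolding j_def by (auto simp: nat_less_iff)
  have per: "c (i' + 2 * int k * m) = c i'" for i' m
  proof -
    have "c (2 * int k * m) = 1"
    proof -
      have "real_of_int (2 * int k * m) * pi / real k = 2 * pi * real_of_int m" by simp
      then show ?thesis unfolding c_def by (metis Ints_of_int cis_multiple_2pi)
    qed
    then show ?thesis by (simp add: c_add)
  qed
  have "i = int j + 2 * int k * (i div (2 * int k))"
    unfolding j by (simp only: mod_mult_div_eq)
  then have "c i = c (int j)" by (metis per)
  then have "rot i x = rot (int j) x" "rfl i x = rfl (int j) x"
    by (simp_all add: rot_def rfl_def)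
  with *[OF j(1)] show "f (rot i x) = 0" "f (rfl i x) = 0" by simp_all
qed

lemma sum_kappa: "(\<Sum>j<2*k. kappa (int j)) = real k * (a + b)"
proof -
  have "(\<Sum>j<2*m. kappa (int j)) = real m * (a + b)" for m
    by (induction m) (auto simp: kappa_def algebra_simps)
  then show ?thesis .
qed

text \<open>By 2uv \<le> u^2 + v^2, since \<open>f\<close> and its reflected copy have the same sum
  of squares over the orbit.\<close>

lemma orbit_sum_mult_rfl_le: "\<bar>orbit_sum (\<lambda>p. f p * f (rfl j p)) x\<bar> \<le> orbit_sum (\<lambda>p. (f p)\<^sup>2) x"
proof -
  have eq: "orbit_sum (\<lambda>p. (1/2) * ((f p)\<^sup>2 + (f (rfl j p))\<^sup>2)) x = orbit_sum (\<lambda>p. (f p)\<^sup>2) x"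
    by (simp add: orbit_sum_cmult orbit_sum_add orbit_sum_rfl[of "\<lambda>p. (f p)\<^sup>2"] del: times_divide_eq_left)
  have "f p * f (rfl j p) \<le> (1/2) * ((f p)\<^sup>2 + (f (rfl j p))\<^sup>2)" for p
    using sum_squares_bound[of "f p" "f (rfl j p)"] by simp
  then have "orbit_sum (\<lambda>p. f p * f (rfl j p)) x \<le> orbit_sum (\<lambda>p. (f p)\<^sup>2) x"
    unfolding eq[symmetric] by (rule orbit_sum_mono_all)
  moreover have "-1 * (f p * f (rfl j p)) \<le> (1/2) * ((f p)\<^sup>2 + (f (rfl j p))\<^sup>2)" for p
    using sum_squares_bound[of "f p" "- f (rfl j p)"] by simp
  then have "orbit_sum (\<lambda>p. -1 * (f p * f (rfl j p))) x \<le> orbit_sum (\<lambda>p. (f p)\<^sup>2) x"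
    unfolding eq[symmetric] by (rule orbit_sum_mono_all)
  ultimately show ?thesis unfolding orbit_sum_cmult abs_le_iff by simp
qed

lemma orbit_sum_mult_rfl_sum_le:
  "\<bar>\<Sum>j<2*k. kappa (int j) * orbit_sum (\<lambda>p. f p * f (rfl (int j) p)) x\<bar>
     \<le> real k * (a + b) * orbit_sum (\<lambda>p. (f p)\<^sup>2) x"
proof -
  have "\<bar>\<Sum>j<2*k. kappa (int j) * orbit_sum (\<lambda>p. f p * f (rfl (int j) p)) x\<bar>
      \<le> (\<Sum>j<2*k. kappa (int j) * orbit_sum (\<lambda>p. (f p)\<^sup>2) x)"
    by (rule order.trans[OF sum_abs])
      (intro sum_mono, simp add: abs_mult kappa_nonneg orbit_sum_mult_rfl_le mult_left_mono)
  also have "\<dots> = real k * (a + b) * orbit_sum (\<lambda>p. (f p)\<^sup>2) x"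
    by (simp add: sum_distrib_right[symmetric] sum_kappa)
  finally show ?thesis .
qed

lemma refl_diff_eq: "refl_diff f x = real k * (a + b) * f x - (\<Sum>j<2*k. kappa (int j) * f (rfl (int j) x))"
  by (simp add: refl_diff_def right_diff_distrib sum_subtractf sum_distrib_right[symmetric] sum_kappa)

text \<open>The scalar part of A equals the sum of the multiplicities, which is exactly the bound
  for the contribution of the reflections.\<close>

lemma orbit_sum_refl_diff_nonneg: "0 \<le> orbit_sum (\<lambda>p. f p * refl_diff f p) x"
proof -
  have "orbit_sum (\<lambda>p. f p * refl_diff f p) x = real k * (a + b) * orbit_sum (\<lambda>p. (f p)\<^sup>2) x
      - (\<Sum>j<2*k. kappa (int j) * orbit_sum (\<lambda>p. f p * f (rfl (int j) p)) x)"
    unfolding orbit_sum_cmult[symmetric] orbit_sum_sum[symmetric] orbit_sum_diff[symmetric]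
    by (simp add: refl_diff_eq algebra_simps power2_eq_square sum_distrib_left)
  with orbit_sum_mult_rfl_sum_le[of f x] show ?thesis by linarith
qed

end

section \<open>Uniqueness of the Dunkl kernel\<close>

context dihedral
begin

definition dunkl_eigen :: "complex \<Rightarrow> (complex \<Rightarrow> real) \<Rightarrow> bool" where
  "dunkl_eigen y f \<longleftrightarrow> (\<forall>p. f differentiable (at p)) \<and>
     (\<forall>p. dih_regular k p \<longrightarrow>
        dunkl_op k a b 1 f p = Re y * f p \<and> dunkl_op k a b \<i> f p = Im y * f p)"

lemma dunkl_kernel_eq:
  "dunkl_kernel k a b x y = (THE f. dunkl_eigen y f \<and> f 0 = 1) x"
  unfolding dunkl_kernel_def dunkl_eigen_def by (simp add: conj_ac)

lemma dunkl_op_eq: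
  "dunkl_op k a b e f x = frechet_derivative f (at x) e
     + (\<Sum>j<2*k. kappa (int j) * (dih_root k j \<bullet> e)
          * (f x - f (rfl (int j) x)) / (dih_root k j \<bullet> x))"
  by (simp add: dunkl_op_def dih_mult_eq dih_refl_eq)

lemma inner_complex_split: "(r :: complex) \<bullet> p = Re p * (r \<bullet> 1) + Im p * (r \<bullet> \<i>)"
  by (simp add: inner_complex_def)

text \<open>Lets the equations, stated for the directions 1 and i, be used in the radial direction p
  and the angular direction i p, where the quotients simplify.\<close>

lemma dunkl_op_linear:
  assumes diff: "f differentiable (at p)"
  shows "dunkl_op k a b v f p = Re v * dunkl_op k a b 1 f p + Im v * dunkl_op k a b \<i> f p"
proof -
  let ?D = "frechet_derivative f (at p)"
  have lin: "linear ?D" by (rule linear_frechet_derivative[OF diff])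
  have "?D v = ?D (Re v *\<^sub>R 1 + Im v *\<^sub>R \<i>)"
    by (rule arg_cong[of _ _ ?D]) (simp add: complex_eq_iff)
  also have "\<dots> = Re v * ?D 1 + Im v * ?D \<i>"
    by (simp only: linear_add[OF lin] linear_scale[OF lin] real_scaleR_def)
  finally have D: "?D v = Re v * ?D 1 + Im v * ?D \<i>" .
  have "(\<Sum>j<2*k. kappa (int j) * (dih_root k j \<bullet> v)
          * (f p - f (rfl (int j) p)) / (dih_root k j \<bullet> p))
      = (\<Sum>j<2*k. Re v * (kappa (int j) * (dih_root k j \<bullet> 1)
          * (f p - f (rfl (int j) p)) / (dih_root k j \<bullet> p))
        + Im v * (kappa (int j) * (dih_root k j \<bullet> \<i>)
          * (f p - f (rfl (int j) p)) / (dih_root k j \<bullet> p)))"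
    by (intro sum.cong refl, subst (1) inner_complex_split[where p = v])
      (simp only: ring_distribs add_divide_distrib times_divide_eq_right mult_ac)
  then show ?thesis
    unfolding dunkl_op_eq D by (simp add: sum.distrib sum_distrib_left ring_distribs)
qed

text \<open>In the direction \<open>p\<close> the factor from the root cancels the denominator, so
  the difference quotients become plain differences.\<close>

lemma dunkl_op_radial:
  assumes "dih_regular k p"
  shows "dunkl_op k a b p f p = frechet_derivative f (at p) p + refl_diff f p"
  unfolding dunkl_op_eq refl_diff_def using assms by (auto simp: dih_regular_def intro!: sum.cong)

lemma dih_regular_scaleR: "dih_regular k x \<Longrightarrow> t \<noteq> 0 \<Longrightarrow> dih_regular k (t *\<^sub>R x)"
  by (auto simp: dih_regular_def)

section \<open>Roots, mirrors and regular points\<close>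

definition root :: "int \<Rightarrow> complex" where
  "root i = \<i> * cis (real_of_int i * pi / (2 * real k))"

lemma dih_root_eq: "dih_root k j = root (int j)"
  by (simp add: dih_root_def root_def)

text \<open>The root sits at half the angle of its reflection, so a full period of the index returns
  it only up to sign; the mirror is the same.\<close>

lemma root_period: "root (i + 2 * int k) = - root i"
proof -
  have *: "real_of_int (i + 2 * int k) * pi / (2 * real k) = real_of_int i * pi / (2 * real k) + pi"
    by (simp add: field_simps)
  show ?thesis unfolding root_def * by (simp add: cis_mult[symmetric])
qed

lemma root_add: "root (i + 2 * j) = root i * c j"
  by (simp add: root_def c_def cis_mult add_divide_distrib ring_distribs)

lemma cnj_root: "cnj (root i) = - root (- i)"
  by (simp add: root_def cis_cnj)

lemma inner_mult_unit: "cmod u = 1 \<Longrightarrow> (r * u) \<bullet> (x * u) = r \<bullet> (x :: complex)"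
proof -
  assume "cmod u = 1"
  then have u: "Re u * Re u + Im u * Im u = 1"
    by (simp add: cmod_def power2_eq_square)
  have "(r * u) \<bullet> (x * u) = (r \<bullet> x) * (Re u * Re u + Im u * Im u)"
    by (simp add: inner_complex_def algebra_simps)
  with u show ?thesis by simp
qed

lemma inner_cnj_cnj: "cnj r \<bullet> cnj x = r \<bullet> x"
  by (simp add: inner_complex_def)

lemma root_inner_rot: "root i \<bullet> rot j x = root (i - 2 * j) \<bullet> x"
proof -
  have "root i = root (i - 2 * j) * c j"
    using root_add[of "i - 2 * j" j] by simp
  then show ?thesis unfolding rot_def by (simp add: inner_mult_unit)
qed

lemma root_inner_rfl: "root i \<bullet> rfl j x = - (root (2 * j - i) \<bullet> x)"
proof -
  have "root i \<bullet> rfl j x = root (i - 2 * j) \<bullet> cnj x"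
    using root_inner_rot[of i j "cnj x"] by (simp add: rot_def rfl_def)
  also have "\<dots> = cnj (root (i - 2 * j)) \<bullet> x"
    using inner_cnj_cnj[of "root (i - 2 * j)" "cnj x"] by simp
  also have "\<dots> = - (root (2 * j - i) \<bullet> x)"
    by (simp add: cnj_root inner_minus_left)
  finally show ?thesis .
qed

lemma dih_regular_iff: "dih_regular k x \<longleftrightarrow> (\<forall>i. root i \<bullet> x \<noteq> 0)"
proof
  assume *: "dih_regular k x"
  show "\<forall>i. root i \<bullet> x \<noteq> 0"
  proof
    fix i
    define j where "j = nat (i mod (2 * int k))"
    have j: "j < 2 * k" "int j = i mod (2 * int k)"
      using k unfolding j_def by (auto simp: nat_less_iff)
    have per: "(root (l + 2 * int k * m) \<bullet> x = 0) = (root l \<bullet> x = 0)" for l m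
    proof (induction m rule: int_induct[where k = 0])
      case (step1 m)
      have "root (l + 2 * int k * (m + 1)) = - root (l + 2 * int k * m)"
        using root_period[of "l + 2 * int k * m"] by (simp add: algebra_simps)
      with step1 show ?case by (simp add: inner_minus_left)
    next
      case (step2 m)
      have "root (l + 2 * int k * m) = - root (l + 2 * int k * (m - 1))"
        using root_period[of "l + 2 * int k * (m - 1)"] by (simp add: algebra_simps)
      with step2 show ?case by (simp add: inner_minus_left)
    qed simp
    have "i = int j + 2 * int k * (i div (2 * int k))"
      unfolding j by (simp only: mod_mult_div_eq)
    then have "(root i \<bullet> x = 0) = (root (int j) \<bullet> x = 0)" by (metis per)
    with * j show "root i \<bullet> x \<noteq> 0" by (auto simp: dih_regular_def dih_root_eq)
  qed
qed (auto simp: dih_regular_def dih_root_eq)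

lemma dih_regular_rot: "dih_regular k x \<Longrightarrow> dih_regular k (rot j x)"
  by (auto simp: dih_regular_iff root_inner_rot)

lemma dih_regular_rfl: "dih_regular k x \<Longrightarrow> dih_regular k (rfl j x)"
  by (auto simp: dih_regular_iff root_inner_rfl)

text \<open>The irregular points lie on finitely many lines, a null set, and a nonempty open set is
  not null.\<close>

lemma regular_dense: "closure {p. dih_regular k p} = UNIV"
proof -
  have root0: "root i \<noteq> 0" for i by (simp add: root_def)
  define H where "H = (\<Union>j<2*k. {p. root (int j) \<bullet> p = 0})"
  have "negligible H"
    unfolding H_def by (intro negligible_Union) (auto simp: root0 intro!: negligible_hyperplane)
  have "p \<in> closure {p. dih_regular k p}" for p
  proof (rule ccontr)
    assume "p \<notin> closure {p. dih_regular k p}"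
    define U where "U = - closure {p. dih_regular k p}"
    have U: "open U" "p \<in> U" "U \<inter> {p. dih_regular k p} = {}"
      using \<open>p \<notin> closure {p. dih_regular k p}\<close> closure_subset[of "{p. dih_regular k p}"]
      by (auto simp: U_def)
    then have "U \<subseteq> H" by (auto simp: H_def dih_regular_def dih_root_eq)
    with \<open>negligible H\<close> have "negligible U" by (rule negligible_subset)
    with U open_not_negligible show False by blast
  qed
  then show ?thesis by auto
qed

text \<open>Along the ray through a regular point the derivative of the energy \<open>V t\<close>
  has a factor 2/t in front of two terms. The one from A has the favourable sign and is dropped; the
  one from the eigenvalue is at most \<open>t * cmod x * cmod y\<close> times the energy, which
  cancels 1/t. Continuity extends the vanishing from the dense set of regular points.\<close>

lemma dunkl_eigen_unique_zero:
  assumes f: "dunkl_eigen y f" and f0: "f 0 = 0"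
  shows "f x = 0"
proof -
  have diff: "f differentiable (at p)" for p
    using f by (simp add: dunkl_eigen_def)
  have reg: "f x = 0" if x: "dih_regular k x" for x
  proof -
    let ?D = "\<lambda>p. frechet_derivative f (at p)"
    have rad: "?D p p = (p \<bullet> y) * f p - refl_diff f p" if "dih_regular k p" for p
    proof -
      have "?D p p + refl_diff f p = Re p * (Re y * f p) + Im p * (Im y * f p)"
        using dunkl_op_radial[OF that] dunkl_op_linear[OF diff, of p p] f that by (simp add: dunkl_eigen_def)
      then show ?thesis by (simp add: inner_complex_def algebra_simps)
    qed
    define V where "V t = orbit_sum (\<lambda>p. (f p)\<^sup>2) (t *\<^sub>R x)" for t
    define V' where "V' t = orbit_sum (\<lambda>p. 2 / t * (f p * ?D p p)) (t *\<^sub>R x)" for t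
    have rot_scale: "rot i (t *\<^sub>R x) = t *\<^sub>R rot i x" and rfl_scale: "rfl i (t *\<^sub>R x) = t *\<^sub>R rfl i x" for i t
      by (simp_all add: rot_def rfl_def)
    have d1: "((\<lambda>t. (f (t *\<^sub>R p))\<^sup>2) has_real_derivative
        2 / t * (f (t *\<^sub>R p) * ?D (t *\<^sub>R p) (t *\<^sub>R p))) (at t)" if "t \<noteq> 0" for p t
    proof -
      have "(f has_derivative ?D (t *\<^sub>R p)) (at (t *\<^sub>R p))"
        using diff frechet_derivative_works by blast
      then have "((\<lambda>t. f (t *\<^sub>R p)) has_derivative (\<lambda>h. ?D (t *\<^sub>R p) (h *\<^sub>R p))) (at t)"
        by (rule has_derivative_compose[rotated]) (auto intro!: derivative_eq_intros)
      moreover have "(\<lambda>h. ?D (t *\<^sub>R p) (h *\<^sub>R p)) = (\<lambda>h. ?D (t *\<^sub>R p) p * h)"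
        using linear_scale[OF linear_frechet_derivative[OF diff]] by (simp add: mult.commute)
      ultimately have "((\<lambda>t. f (t *\<^sub>R p)) has_real_derivative ?D (t *\<^sub>R p) p) (at t)"
        by (simp add: has_field_derivative_def)
      then have "((\<lambda>t. (f (t *\<^sub>R p))\<^sup>2) has_real_derivative 2 * (f (t *\<^sub>R p) * ?D (t *\<^sub>R p) p)) (at t)"
        by (auto intro!: derivative_eq_intros)
      moreover have "?D (t *\<^sub>R p) (t *\<^sub>R p) = t * ?D (t *\<^sub>R p) p"
        using linear_scale[OF linear_frechet_derivative[OF diff]] by simp
      ultimately show ?thesis using that by simp
    qed
    have V1: "V 1 = 0"
    proof (rule gronwall_zero[where V = V and d = 1 and V' = V' and C = "2 * (cmod x * cmod y)"])
      have "isCont f p" for p using diff by (rule differentiable_imp_continuous_within)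
      then have "continuous_on UNIV f" by (simp add: continuous_on_eq_continuous_at)
      then show "continuous_on {0..1} V"
        unfolding V_def orbit_sum_def rot_def rfl_def
        by (auto intro!: continuous_intros continuous_on_compose2[of UNIV f])
      show "V 0 = 0" by (simp add: V_def orbit_sum_def rot_def rfl_def f0)
      show "0 \<le> V t" for t unfolding V_def by (rule orbit_sum_sq_nonneg)
      show "(V has_real_derivative V' t) (at t)" if "0 < t" for t
        unfolding V_def V'_def orbit_sum_def rot_scale rfl_scale using that
        by (intro DERIV_sum DERIV_add d1) auto
      show "V' t \<le> 2 * (cmod x * cmod y) * V t" if "0 < t" for t
      proof -
        let ?x = "t *\<^sub>R x"
        have rx: "dih_regular k ?x" using x that by (simp add: dih_regular_scaleR)
        \<comment> \<open>The whole orbit of a regular point is regular, so the radial equation is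
          available in every summand.\<close>
        have "V' t = 2 / t * orbit_sum (\<lambda>p. f p * ((p \<bullet> y) * f p - refl_diff f p)) ?x"
          unfolding V'_def orbit_sum_cmult
          by (simp add: orbit_sum_def rad dih_regular_rot[OF rx] dih_regular_rfl[OF rx])
        also have "orbit_sum (\<lambda>p. f p * ((p \<bullet> y) * f p - refl_diff f p)) ?x
            = orbit_sum (\<lambda>p. (p \<bullet> y) * (f p)\<^sup>2) ?x - orbit_sum (\<lambda>p. f p * refl_diff f p) ?x"
          by (simp add: orbit_sum_diff[symmetric] algebra_simps power2_eq_square)
        also have "2 / t * \<dots> \<le> 2 / t * orbit_sum (\<lambda>p. (p \<bullet> y) * (f p)\<^sup>2) ?x"
          using that orbit_sum_refl_diff_nonneg[of f ?x] by (intro mult_left_mono) auto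
        also have "\<dots> \<le> 2 / t * (orbit_sum (\<lambda>p. (cmod ?x * cmod y) * (f p)\<^sup>2) ?x)"
        proof -
          have "p \<bullet> y \<le> cmod ?x * cmod y" if "cmod p = cmod ?x" for p
            using norm_cauchy_schwarz[of p y] that by simp
          then show ?thesis using that unfolding orbit_sum_def
            by (intro mult_left_mono sum_mono add_mono mult_right_mono) auto
        qed
        also have "\<dots> = 2 * (cmod x * cmod y) * V t"
          using that by (simp add: orbit_sum_cmult V_def)
        finally show ?thesis .
      qed
    qed auto
    then have "f (rot 0 x) = 0"
      by (intro orbit_sum_sq_zero) (simp add: V_def)
    then show "f x = 0" by simp
  qed
  have "continuous_on UNIV f"
    using diff differentiable_imp_continuous_within[of f _ UNIV]
    by (simp add: continuous_on_eq_continuous_within)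
  then have "closed {p. f p = 0}"
    by (intro closed_Collect_eq) auto
  then have "closure {p. dih_regular k p} \<subseteq> {p. f p = 0}"
    using reg by (intro closure_minimal) auto
  then show ?thesis using regular_dense by auto
qed

lemma dunkl_eigen_unique:
  assumes f: "dunkl_eigen y f" and g: "dunkl_eigen y g" and "f 0 = g 0"
  shows "f = g"
proof
  fix x
  have df: "f differentiable (at p)" "g differentiable (at p)" for p
    using f g by (simp_all add: dunkl_eigen_def)
  have "dunkl_op k a b e (\<lambda>p. f p - g p) p = dunkl_op k a b e f p - dunkl_op k a b e g p" for e p
  proof -
    have "frechet_derivative (\<lambda>p. f p - g p) (at p)
        = (\<lambda>h. frechet_derivative f (at p) h - frechet_derivative g (at p) h)"
      by (intro frechet_derivative_at[symmetric] has_derivative_diff)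
        (use df frechet_derivative_works in blast)+
    moreover have "w * (f p - g p - (f q - g q)) / r = w * (f p - f q) / r - w * (g p - g q) / r"
      for w q r by (simp add: algebra_simps diff_divide_distrib add_divide_distrib)
    ultimately show ?thesis
      by (simp add: dunkl_op_eq sum_subtractf)
  qed
  note op_diff = this
  have "dunkl_eigen y (\<lambda>p. f p - g p)"
    unfolding dunkl_eigen_def op_diff right_diff_distrib
  proof (intro conjI allI impI)
    show "(\<lambda>p. f p - g p) differentiable (at p)" for p
      using df by (rule differentiable_diff)
  qed (use f g in \<open>simp_all add: dunkl_eigen_def\<close>)
  from dunkl_eigen_unique_zero[OF this, of x] assms(3) show "f x = g x" by simp
qed

lemma dunkl_kernel_eqI:
  assumes "dunkl_eigen y f" "f 0 = 1"
  shows "dunkl_kernel k a b x y = f x"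
proof -
  have "(THE f. dunkl_eigen y f \<and> f 0 = 1) = f"
    using assms by (intro the_equality) (auto intro!: dunkl_eigen_unique)
  then show ?thesis by (simp add: dunkl_kernel_eq)
qed

end

section \<open>Inverting the radial operator\<close>

context dihedral
begin

text \<open>\<open>U0\<close>, \<open>U1\<close>, \<open>V0\<close>, \<open>V1\<close> average over
  the four cosets of the subgroup generated by the rotation through 2 pi/k: even and odd rotations,
  even and odd reflections. The two reflection cosets are the classes with multiplicity
  \<open>a\<close> and \<open>b\<close>.\<close>

definition U0 :: "(complex \<Rightarrow> real) \<Rightarrow> complex \<Rightarrow> real" where
  "U0 f x = (\<Sum>i<k. f (rot (2 * int i) x)) / real k"
definition U1 :: "(complex \<Rightarrow> real) \<Rightarrow> complex \<Rightarrow> real" where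
  "U1 f x = (\<Sum>i<k. f (rot (2 * int i + 1) x)) / real k"
definition V0 :: "(complex \<Rightarrow> real) \<Rightarrow> complex \<Rightarrow> real" where
  "V0 f x = (\<Sum>i<k. f (rfl (2 * int i) x)) / real k"
definition V1 :: "(complex \<Rightarrow> real) \<Rightarrow> complex \<Rightarrow> real" where
  "V1 f x = (\<Sum>i<k. f (rfl (2 * int i + 1) x)) / real k"

lemma sum_rot_shift: "(\<Sum>i<k. f (rot (2 * int i + 2 * m + l) x)) = (\<Sum>i<k. f (rot (2 * int i + l) x) :: real)"
proof -
  have "f (rot (2 * (i + int k) + l) x) = f (rot (2 * i + l) x)" for i
    using rot_period[of "2 * i + l" x] by (simp add: algebra_simps)
  from sum_periodic_shift[of "\<lambda>i. f (rot (2 * i + l) x)", OF this, of m]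
  show ?thesis by (simp only: ring_distribs)
qed

lemma sum_rfl_shift: "(\<Sum>i<k. f (rfl (2 * int i + 2 * m + l) x)) = (\<Sum>i<k. f (rfl (2 * int i + l) x) :: real)"
proof -
  have "f (rfl (2 * (i + int k) + l) x) = f (rfl (2 * i + l) x)" for i
    using rfl_period[of "2 * i + l" x] by (simp add: algebra_simps)
  from sum_periodic_shift[of "\<lambda>i. f (rfl (2 * i + l) x)", OF this, of m]
  show ?thesis by (simp only: ring_distribs)
qed

text \<open>A reflection permutes the four averages by the parity of its index alone. This and the
  next three lemmas give the permutation, so that A acts on the span of the averages by a 4 by 4
  matrix.\<close>

lemma U0_rfl: "U0 f (rfl j x) = (if even j then V0 f x else V1 f x)"
proof (cases "even j")
  case True
  then obtain m where "j = 2 * m" by (elim evenE)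
  then show ?thesis using sum_rfl_shift[of f m 0 x] by (simp add: U0_def V0_def rot_rfl)
next
  case False
  then obtain m where "j = 2 * m + 1" by (elim oddE)
  then show ?thesis using sum_rfl_shift[of f m 1 x] by (simp add: U0_def V1_def rot_rfl add_ac)
qed

lemma U1_rfl: "U1 f (rfl j x) = (if even j then V1 f x else V0 f x)"
proof (cases "even j")
  case True
  then obtain m where "j = 2 * m" by (elim evenE)
  then show ?thesis using sum_rfl_shift[of f m 1 x] by (simp add: U1_def V1_def rot_rfl add_ac)
next
  case False
  then obtain m where "j = 2 * m + 1" by (elim oddE)
  then show ?thesis using sum_rfl_shift[of f "m + 1" 0 x] by (simp add: U1_def V0_def rot_rfl algebra_simps)
qed

lemma V0_rfl: "V0 f (rfl j x) = (if even j then U0 f x else U1 f x)"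
proof (cases "even j")
  case True
  then obtain m where "j = 2 * m" by (elim evenE)
  then show ?thesis using sum_rot_shift[of f "-m" 0 x] by (simp add: V0_def U0_def rfl_rfl)
next
  case False
  then obtain m where "j = 2 * m + 1" by (elim oddE)
  then show ?thesis using sum_rot_shift[of f "-m - 1" 1 x] by (simp add: V0_def U1_def rfl_rfl algebra_simps)
qed

lemma V1_rfl: "V1 f (rfl j x) = (if even j then U1 f x else U0 f x)"
proof (cases "even j")
  case True
  then obtain m where "j = 2 * m" by (elim evenE)
  then show ?thesis using sum_rot_shift[of f "-m" 1 x] by (simp add: V1_def U1_def rfl_rfl algebra_simps)
next
  case False
  then obtain m where "j = 2 * m + 1" by (elim oddE)
  then show ?thesis using sum_rot_shift[of f "-m" 0 x] by (simp add: V1_def U0_def rfl_rfl algebra_simps)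
qed

lemma sum_even_odd: "(\<Sum>j<2*m. h (int j)) = (\<Sum>i<m. h (2 * int i)) + (\<Sum>i<m. h (2 * int i + 1) :: real)"
  by (induction m) (auto simp: algebra_simps)

lemma sum_kappa_split:
  "(\<Sum>j<2*k. kappa (int j) * h (int j)) = a * (\<Sum>i<k. h (2 * int i)) + b * (\<Sum>i<k. h (2 * int i + 1))"
  using sum_even_odd[of "\<lambda>j. kappa j * h j" k] by (simp add: kappa_def sum_distrib_left)

lemma refl_diff_split:
  "refl_diff f x = real k * (a + b) * f x - a * (\<Sum>i<k. f (rfl (2 * int i) x)) - b * (\<Sum>i<k. f (rfl (2 * int i + 1) x))"
  using sum_kappa_split[of "\<lambda>j. f (rfl j x)"] by (simp add: refl_diff_eq)

text \<open>A sees \<open>f\<close> only through \<open>f\<close> itself and its two reflection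
  averages, and these are determined by \<open>U0 f\<close>. Hence A is the scalar k(a + b) on the
  difference of \<open>f\<close> and \<open>U0 f\<close>.\<close>

lemma refl_diff_VU: "refl_diff f x = real k * ((a + b) * f x - a * V0 f x - b * V1 f x)"
  by (simp add: refl_diff_split V0_def V1_def algebra_simps)

lemma refl_diff_U0: "refl_diff (U0 f) x = real k * ((a + b) * U0 f x - a * V0 f x - b * V1 f x)"
  by (simp add: refl_diff_split U0_rfl algebra_simps)
lemma refl_diff_U1: "refl_diff (U1 f) x = real k * ((a + b) * U1 f x - a * V1 f x - b * V0 f x)"
  by (simp add: refl_diff_split U1_rfl algebra_simps)
lemma refl_diff_V0: "refl_diff (V0 f) x = real k * ((a + b) * V0 f x - a * U0 f x - b * U1 f x)"
  by (simp add: refl_diff_split V0_rfl algebra_simps)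
lemma refl_diff_V1: "refl_diff (V1 f) x = real k * ((a + b) * V1 f x - a * U1 f x - b * U0 f x)"
  by (simp add: refl_diff_split V1_rfl algebra_simps)

lemma refl_diff_add: "refl_diff (\<lambda>x. f x + g x) x = refl_diff f x + refl_diff g x"
  by (simp add: refl_diff_def sum.distrib[symmetric] algebra_simps)
lemma refl_diff_cmult: "refl_diff (\<lambda>x. r * f x) x = r * refl_diff f x"
  by (simp add: refl_diff_def sum_distrib_left algebra_simps)

text \<open>On averages over the rotations by multiples of $2\pi/k$ the group acts through a Klein four-group, on whose
  characters $n + A$ has the eigenvalues $n$, $n + 2ka$, $n + 2kb$ and $n + 2k(a + b)$; on the complement of these averages
  it is $n + k(a + b)$.\<close>

definition res_coeff :: "real \<Rightarrow> real \<Rightarrow> real \<Rightarrow> real" where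
  "res_coeff n e d = (1 / n + e / (n + 2 * real k * a) + d / (n + 2 * real k * b)
     + e * d / (n + 2 * real k * (a + b))) / 4"

text \<open>The first term is the scalar inverse on the complement of the averages. The others are
  Fourier inversion on the Klein four-group: the signs passed to \<open>res_coeff\<close> are the
  values of two generating characters on the coset.\<close>

definition resolvent :: "real \<Rightarrow> (complex \<Rightarrow> real) \<Rightarrow> complex \<Rightarrow> real" where
  "resolvent n f x = (1 / (n + real k * (a + b))) * (f x + (-1) * U0 f x)
     + (res_coeff n 1 1 * U0 f x + (res_coeff n (-1) 1 * V0 f x
     + (res_coeff n 1 (-1) * V1 f x + res_coeff n (-1) (-1) * U1 f x)))"

lemma resolvent_eq:
  assumes n: "n > 0"
  shows "n * resolvent n f x + refl_diff (resolvent n f) x = f x"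
proof -
  define N where "N = n + real k * (a + b)"
  define m1 m2 m3 m4 where "m1 = 1 / n" and "m2 = 1 / (n + 2 * real k * a)"
    and "m3 = 1 / (n + 2 * real k * b)" and "m4 = 1 / (n + 2 * real k * (a + b))"
  have N: "N > 0" using n a b by (simp add: N_def add_pos_nonneg)
  have pos: "n + 2 * real k * a > 0" "n + 2 * real k * b > 0" "n + 2 * real k * (a + b) > 0"
    using n a b by (simp_all add: add_pos_nonneg)
  have m: "m1 * n = 1" "m2 * (n + 2 * real k * a) = 1" "m3 * (n + 2 * real k * b) = 1"
    "m4 * (n + 2 * real k * (a + b)) = 1"
    using n pos by (simp_all add: m1_def m2_def m3_def m4_def)
  define p q s t where "p = (m1 + m2 + m3 + m4) / 4" and "q = (m1 - m2 + m3 - m4) / 4"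
    and "s = (m1 + m2 - m3 - m4) / 4" and "t = (m1 - m2 - m3 + m4) / 4"
  have co: "res_coeff n 1 1 = p" "res_coeff n (-1) 1 = q" "res_coeff n 1 (-1) = s" "res_coeff n (-1) (-1) = t"
    by (simp_all add: res_coeff_def p_def q_def s_def t_def m1_def m2_def m3_def m4_def)
  \<comment> \<open>The coefficients of \<open>U0 f\<close>, \<open>V0 f\<close>,
    \<open>V1 f\<close>, \<open>U1 f\<close> in the image of the four-term part, which has to
    reproduce \<open>U0 f\<close>.\<close>
  have lin: "N * p - real k * a * q - real k * b * s = 1"
    "N * q - real k * a * p - real k * b * t = 0"
    "N * s - real k * a * t - real k * b * p = 0"
    "N * t - real k * a * s - real k * b * q = 0"
  proof -
    let ?M1 = "m1 * n" and ?M2 = "m2 * (n + 2 * real k * a)" and ?fullM = "m3 * (n + 2 * real k * b)"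
      and ?M4 = "m4 * (n + 2 * real k * (a + b))"
    have "N * p - real k * a * q - real k * b * s = (?M1 + ?M2 + ?fullM + ?M4) / 4"
      "N * q - real k * a * p - real k * b * t = (?M1 - ?M2 + ?fullM - ?M4) / 4"
      "N * s - real k * a * t - real k * b * p = (?M1 + ?M2 - ?fullM - ?M4) / 4"
      "N * t - real k * a * s - real k * b * q = (?M1 - ?M2 - ?fullM + ?M4) / 4"
      unfolding N_def p_def q_def s_def t_def by (simp_all add: field_simps)
    then show "N * p - real k * a * q - real k * b * s = 1"
      "N * q - real k * a * p - real k * b * t = 0"
      "N * s - real k * a * t - real k * b * p = 0"
      "N * t - real k * a * s - real k * b * q = 0"
      unfolding m by simp_all
  qed
  have AR: "refl_diff (resolvent n f) x = (1 / N) * (real k * (a + b) * (f x - U0 f x))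
     + p * (real k * ((a + b) * U0 f x - a * V0 f x - b * V1 f x))
     + q * (real k * ((a + b) * V0 f x - a * U0 f x - b * U1 f x))
     + s * (real k * ((a + b) * V1 f x - a * U1 f x - b * U0 f x))
     + t * (real k * ((a + b) * U1 f x - a * V1 f x - b * V0 f x))"
    unfolding resolvent_def[abs_def] co refl_diff_add refl_diff_cmult
    unfolding refl_diff_U0 refl_diff_U1 refl_diff_V0 refl_diff_V1 refl_diff_VU[of f] N_def[symmetric]
    by (simp add: right_diff_distrib)
  define iN where "iN = 1 / N"
  have R: "resolvent n f x = iN * (f x - U0 f x) + p * U0 f x + q * V0 f x + s * V1 f x + t * U1 f x"
    unfolding resolvent_def co iN_def N_def by simp
  have "n * resolvent n f x + refl_diff (resolvent n f) x
     = (1 / N) * (N * (f x - U0 f x)) + U0 f x * (N * p - real k * a * q - real k * b * s)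
       + V0 f x * (N * q - real k * a * p - real k * b * t)
       + V1 f x * (N * s - real k * a * t - real k * b * p)
       + U1 f x * (N * t - real k * a * s - real k * b * q)"
    unfolding AR R iN_def[symmetric] by (simp add: N_def algebra_simps)
  also have "\<dots> = f x" unfolding lin using N by simp
  finally show ?thesis .
qed

text \<open>All four eigenvalues are at least \<open>n\<close>, and \<open>res_coeff\<close> is a
  mean of their signed reciprocals.\<close>

lemma res_coeff_bound:
  assumes n: "n > 0" and "\<bar>e\<bar> = 1" "\<bar>d\<bar> = 1"
  shows "\<bar>res_coeff n e d\<bar> \<le> 1 / n"
proof -
  have *: "\<bar>r / (n + s)\<bar> \<le> 1 / n" if "\<bar>r\<bar> = 1" "s \<ge> 0" for r s :: real
    using n that by (simp add: abs_divide frac_le)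
  have "\<bar>1 / n\<bar> \<le> 1 / n" "\<bar>e / (n + 2 * real k * a)\<bar> \<le> 1 / n" "\<bar>d / (n + 2 * real k * b)\<bar> \<le> 1 / n"
    "\<bar>e * d / (n + 2 * real k * (a + b))\<bar> \<le> 1 / n"
    using n by simp (rule *; use assms a b in \<open>simp add: abs_mult\<close>)+
  moreover have "\<bar>(w + x + y + z) / 4\<bar> \<le> m"
    if "\<bar>w\<bar> \<le> m" "\<bar>x\<bar> \<le> m" "\<bar>y\<bar> \<le> m" "\<bar>z\<bar> \<le> m" for w x y z m :: real
    using that by (simp add: abs_le_iff)
  ultimately show ?thesis unfolding res_coeff_def by blast
qed

lemma abs_mean_le:
  assumes "\<And>i. \<bar>h i\<bar> \<le> M"
  shows "\<bar>(\<Sum>i<k. h i) / real k\<bar> \<le> M"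
proof -
  have "\<bar>\<Sum>i<k. h i\<bar> \<le> (\<Sum>i<k. M)"
    by (rule order.trans[OF sum_abs]) (intro sum_mono assms)
  then show ?thesis by (simp add: abs_divide field_simps)
qed

text \<open>The constant 6 is 2 + 4: at most \<open>2 * M / n\<close> from the difference of
  \<open>f\<close> and \<open>U0 f\<close>, and \<open>M / n\<close> from each of the four averages.
  The gain of 1/n per step becomes the factorial in \<open>Ecomp_bound\<close>.\<close>

lemma resolvent_bound:
  assumes n: "n > 0" and f: "\<And>p. cmod p = cmod x \<Longrightarrow> \<bar>f p\<bar> \<le> M"
  shows "\<bar>resolvent n f x\<bar> \<le> 6 * M / n"
proof -
  have M: "M \<ge> 0" using f[of x] by linarith
  have av: "\<bar>U0 f x\<bar> \<le> M" "\<bar>U1 f x\<bar> \<le> M" "\<bar>V0 f x\<bar> \<le> M" "\<bar>V1 f x\<bar> \<le> M"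
    unfolding U0_def U1_def V0_def V1_def by (intro abs_mean_le f; simp)+
  have "\<bar>(1 / (n + real k * (a + b))) * (f x + (-1) * U0 f x)\<bar> \<le> 1 / n * (2 * M)"
    unfolding abs_mult using av(1) f[of x] n a b
    by (intro mult_mono) (auto intro!: divide_left_mono mult_pos_pos add_pos_nonneg)
  moreover have "\<bar>r * v\<bar> \<le> 1 / n * M" if "\<bar>r\<bar> \<le> 1 / n" "\<bar>v\<bar> \<le> M" for r v
    unfolding abs_mult using that n by (intro mult_mono) auto
  note this[OF res_coeff_bound[OF n]]
  from this[of 1 1, OF _ _ av(1)] this[of "-1" 1, OF _ _ av(3)]
    this[of 1 "-1", OF _ _ av(4)] this[of "-1" "-1", OF _ _ av(2)]
  have "\<bar>res_coeff n 1 1 * U0 f x\<bar> \<le> 1 / n * M" "\<bar>res_coeff n (-1) 1 * V0 f x\<bar> \<le> 1 / n * M"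
    "\<bar>res_coeff n 1 (-1) * V1 f x\<bar> \<le> 1 / n * M" "\<bar>res_coeff n (-1) (-1) * U1 f x\<bar> \<le> 1 / n * M"
    by simp_all
  ultimately have "\<bar>resolvent n f x\<bar> \<le> 1 / n * (2 * M) + 4 * (1 / n * M)"
    unfolding resolvent_def by linarith
  also have "\<dots> = 6 * M / n" using n by (simp add: field_simps)
  finally show ?thesis .
qed

section \<open>Derivative bounds\<close>

definition deriv_bdd :: "(complex \<Rightarrow> real) \<Rightarrow> complex \<Rightarrow> real \<Rightarrow> bool" where
  "deriv_bdd f x M \<longleftrightarrow> (\<exists>D. (f has_derivative D) (at x) \<and> (\<forall>h. \<bar>D h\<bar> \<le> M * cmod h))"

lemma deriv_bdd_add: "deriv_bdd f x M \<Longrightarrow> deriv_bdd g x N \<Longrightarrow> deriv_bdd (\<lambda>x. f x + g x) x (M + N)"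
  unfolding deriv_bdd_def
  by (elim exE, rule exI, rule conjI, rule has_derivative_add)
    (auto simp: ring_distribs intro!: order.trans[OF abs_triangle_ineq] add_mono)

lemma deriv_bdd_cmult:
  assumes f: "deriv_bdd f x M" and r: "\<bar>r\<bar> \<le> R"
  shows "deriv_bdd (\<lambda>x. r * f x) x (R * M)"
proof -
  from f obtain D where D: "(f has_derivative D) (at x)" "\<And>h. \<bar>D h\<bar> \<le> M * cmod h"
    by (auto simp: deriv_bdd_def)
  have "\<bar>r * D h\<bar> \<le> R * M * cmod h" for h
  proof -
    have "\<bar>r * D h\<bar> \<le> R * (M * cmod h)"
      unfolding abs_mult using r D(2)[of h] by (intro mult_mono) auto
    then show ?thesis by (simp add: mult_ac)
  qed
  with D(1) show ?thesis unfolding deriv_bdd_def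
    by (intro exI[of _ "\<lambda>h. r * D h"]) (auto intro!: derivative_intros)
qed

lemma has_derivative_rot: "(rot i has_derivative rot i) (at x)"
  unfolding rot_def[abs_def] by (auto intro!: derivative_eq_intros)

lemma has_derivative_rfl: "(rfl i has_derivative rfl i) (at x)"
  unfolding rfl_def[abs_def]
  by (auto intro!: derivative_eq_intros bounded_linear.has_derivative[OF bounded_linear_cnj])

lemma deriv_bdd_rot:
  assumes "deriv_bdd f (rot i x) M"
  shows "deriv_bdd (\<lambda>x. f (rot i x)) x M"
proof -
  from assms obtain D where D: "(f has_derivative D) (at (rot i x))" "\<And>h. \<bar>D h\<bar> \<le> M * cmod h"
    by (auto simp: deriv_bdd_def)
  have "\<bar>D (rot i h)\<bar> \<le> M * cmod h" for h
    using D(2)[of "rot i h"] by simp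
  with has_derivative_compose[OF has_derivative_rot D(1)] show ?thesis
    unfolding deriv_bdd_def by blast
qed

lemma deriv_bdd_rfl:
  assumes "deriv_bdd f (rfl i x) M"
  shows "deriv_bdd (\<lambda>x. f (rfl i x)) x M"
proof -
  from assms obtain D where D: "(f has_derivative D) (at (rfl i x))" "\<And>h. \<bar>D h\<bar> \<le> M * cmod h"
    by (auto simp: deriv_bdd_def)
  have "\<bar>D (rfl i h)\<bar> \<le> M * cmod h" for h
    using D(2)[of "rfl i h"] by simp
  with has_derivative_compose[OF has_derivative_rfl D(1)] show ?thesis
    unfolding deriv_bdd_def by blast
qed

lemma deriv_bdd_sum:
  assumes "\<And>i :: nat. deriv_bdd (f i) x M"
  shows "deriv_bdd (\<lambda>x. \<Sum>i<m. f i x) x (real m * M)"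
proof (induction m)
  case 0
  show ?case by (auto simp: deriv_bdd_def intro!: exI[of _ "\<lambda>_. 0"])
next
  case (Suc m)
  from deriv_bdd_add[OF this assms[of m]] show ?case by (simp add: ring_distribs add_ac)
qed

lemma deriv_bdd_mean:
  assumes "\<And>i :: nat. deriv_bdd (f i) x M"
  shows "deriv_bdd (\<lambda>x. (\<Sum>i<k. f i x) / real k) x M"
  using deriv_bdd_cmult[OF deriv_bdd_sum[of f, OF assms, of k], of "1 / real k" "1 / real k"] by simp

text \<open>The resolvent combines \<open>f\<close> with finitely many isometries, so existence of
  the derivative and its bound pass through with the same constant 6 = 2 + 4 as for values. Both are
  kept in one predicate because the termwise differentiation of the kernel needs them
  together.\<close>

lemma deriv_bdd_resolvent:
  assumes n: "n > 0" and f: "\<And>p. cmod p = cmod x \<Longrightarrow> deriv_bdd f p M"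
  shows "deriv_bdd (resolvent n f) x (6 * M / n)"
proof -
  have M: "M \<ge> 0"
  proof -
    from f[of x] obtain D where "\<And>h. \<bar>D h\<bar> \<le> M * cmod h" by (auto simp: deriv_bdd_def)
    from this[of 1] show ?thesis by simp
  qed
  have av: "deriv_bdd (U0 f) x M" "deriv_bdd (U1 f) x M" "deriv_bdd (V0 f) x M" "deriv_bdd (V1 f) x M"
    unfolding U0_def[abs_def] U1_def[abs_def] V0_def[abs_def] V1_def[abs_def]
    by (intro deriv_bdd_mean deriv_bdd_rot deriv_bdd_rfl f; simp)+
  have 1: "\<bar>1 / (n + real k * (a + b))\<bar> \<le> 1 / n"
    using n a b by (simp add: abs_divide frac_le)
  have "deriv_bdd (resolvent n f) x (1 / n * (M + 1 * M) + (1 / n * M + (1 / n * M + (1 / n * M + 1 / n * M))))"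
    unfolding resolvent_def[abs_def]
    by (intro deriv_bdd_add deriv_bdd_cmult av f 1 res_coeff_bound n) auto
  moreover have "1 / n * (M + 1 * M) + (1 / n * M + (1 / n * M + (1 / n * M + 1 / n * M))) = 6 * M / n"
    using n by (simp add: field_simps)
  ultimately show ?thesis by simp
qed

end

section \<open>Existence of the Dunkl kernel\<close>

context dihedral
begin

primrec Ecomp :: "complex \<Rightarrow> nat \<Rightarrow> complex \<Rightarrow> real" where
  "Ecomp y 0 = (\<lambda>x. 1)"
| "Ecomp y (Suc n) = resolvent (real (Suc n)) (\<lambda>x. (x \<bullet> y) * Ecomp y n x)"

declare Ecomp.simps(2) [simp del]

lemma Ecomp_rec: "real (Suc n) * Ecomp y (Suc n) x + refl_diff (Ecomp y (Suc n)) x = (x \<bullet> y) * Ecomp y n x"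
  unfolding Ecomp.simps by (rule resolvent_eq) simp

text \<open>The group acts linearly, so the resolvent commutes with dilations. This gives
  homogeneity of the components in the first variable and, with \<open>t = 1\<close>, in the
  second.\<close>

lemma resolvent_cong_scale:
  assumes "\<And>p. g (t *\<^sub>R p) = s * f p"
  shows "resolvent n g (t *\<^sub>R x) = s * resolvent n f x"
proof -
  have rot: "rot i (t *\<^sub>R p) = t *\<^sub>R rot i p" and rfl: "rfl i (t *\<^sub>R p) = t *\<^sub>R rfl i p" for i p
    by (simp_all add: rot_def rfl_def)
  have "U0 g (t *\<^sub>R x) = s * U0 f x" "U1 g (t *\<^sub>R x) = s * U1 f x"
    "V0 g (t *\<^sub>R x) = s * V0 f x" "V1 g (t *\<^sub>R x) = s * V1 f x"
    by (simp_all add: U0_def U1_def V0_def V1_def rot rfl assms sum_distrib_left)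
  then show ?thesis by (simp add: resolvent_def assms algebra_simps)
qed

lemma Ecomp_scale: "Ecomp y n (t *\<^sub>R x) = t ^ n * Ecomp y n x"
proof (induction n arbitrary: x)
  case (Suc n)
  show ?case unfolding Ecomp.simps
    by (rule resolvent_cong_scale) (simp add: Suc algebra_simps)
qed simp

lemma Ecomp_scale_snd: "Ecomp (t *\<^sub>R y) n x = t ^ n * Ecomp y n x"
proof (induction n arbitrary: x)
  case (Suc n)
  have "resolvent (real (Suc n)) (\<lambda>x. (x \<bullet> t *\<^sub>R y) * Ecomp (t *\<^sub>R y) n x) (1 *\<^sub>R x)
      = t ^ Suc n * resolvent (real (Suc n)) (\<lambda>x. (x \<bullet> y) * Ecomp y n x) x"
    by (rule resolvent_cong_scale) (simp add: Suc algebra_simps)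
  then show ?case by (simp add: Ecomp.simps)
qed simp

lemma Ecomp_bound: "\<bar>Ecomp y n x\<bar> \<le> (6 * (cmod x * cmod y)) ^ n / fact n"
proof (induction n arbitrary: x)
  case (Suc n)
  let ?M = "(cmod x * cmod y) * ((6 * (cmod x * cmod y)) ^ n / fact n)"
  have "\<bar>(p \<bullet> y) * Ecomp y n p\<bar> \<le> ?M" if "cmod p = cmod x" for p
    unfolding abs_mult using Suc[of p] Cauchy_Schwarz_ineq2[of p y] that
    by (intro mult_mono) auto
  then have "\<bar>Ecomp y (Suc n) x\<bar> \<le> 6 * ?M / real (Suc n)"
    unfolding Ecomp.simps by (intro resolvent_bound) auto
  also have "\<dots> = (6 * (cmod x * cmod y)) ^ Suc n / fact (Suc n)"
    by (simp add: mult_ac)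
  finally show ?case .
qed simp

lemma deriv_bdd_inner_mult:
  assumes f: "deriv_bdd f x M" and B: "\<bar>f x\<bar> \<le> B"
  shows "deriv_bdd (\<lambda>x. (x \<bullet> y) * f x) x (cmod y * B + cmod x * cmod y * M)"
proof -
  from f obtain D where D: "(f has_derivative D) (at x)" "\<And>h. \<bar>D h\<bar> \<le> M * cmod h"
    by (auto simp: deriv_bdd_def)
  have "\<bar>(x \<bullet> y) * D h + (h \<bullet> y) * f x\<bar> \<le> (cmod y * B + cmod x * cmod y * M) * cmod h" for h
  proof -
    have "\<bar>(x \<bullet> y) * D h\<bar> \<le> (cmod x * cmod y) * (M * cmod h)"
      unfolding abs_mult using D(2)[of h] Cauchy_Schwarz_ineq2[of x y] by (intro mult_mono) auto
    moreover have "\<bar>(h \<bullet> y) * f x\<bar> \<le> (cmod h * cmod y) * B"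
      unfolding abs_mult using B Cauchy_Schwarz_ineq2[of h y] by (intro mult_mono) auto
    ultimately show ?thesis by (simp add: algebra_simps)
  qed
  moreover have "((\<lambda>x. (x \<bullet> y) * f x) has_derivative (\<lambda>h. (x \<bullet> y) * D h + (h \<bullet> y) * f x)) (at x)"
    using D(1) by (auto intro!: derivative_eq_intros)
  ultimately show ?thesis unfolding deriv_bdd_def by blast
qed

lemma deriv_bdd_mono: "deriv_bdd f x M \<Longrightarrow> M \<le> N \<Longrightarrow> deriv_bdd f x N"
  unfolding deriv_bdd_def
  by (elim exE conjE, intro exI conjI allI, assumption)
    (erule allE, erule order.trans, simp add: mult_right_mono)

lemma deriv_bdd_Ecomp:
  assumes "cmod x \<le> R"
  shows "deriv_bdd (Ecomp y n) x (real n * (6 * (cmod y * (1 + R))) ^ n / fact n)"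
  using assms
proof (induction n arbitrary: x)
  case 0
  show ?case by (auto simp: deriv_bdd_def intro!: exI[of _ "\<lambda>_. 0"])
next
  case (Suc n)
  let ?C = "6 * (cmod y * (1 + R))"
  \<comment> \<open>With \<open>B\<close> the bound for the values, the product rule gives
    \<open>cmod y * B + cmod x * cmod y * (n * B)\<close>. The factor \<open>1 + R\<close> absorbs
    both summands at the price of \<open>n + 1\<close> in place of \<open>n\<close>, and the
    resolvent divides by \<open>n + 1\<close>.\<close>
  let ?M = "cmod y * (1 + R) * (real (Suc n) * (?C ^ n / fact n))"
  have R: "R \<ge> 0" using Suc.prems norm_ge_zero order.trans by blast
  have "deriv_bdd (\<lambda>x. (x \<bullet> y) * Ecomp y n x) p ?M" if p: "cmod p = cmod x" for p
  proof (rule deriv_bdd_mono[OF deriv_bdd_inner_mult[OF Suc.IH]])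
    have pR: "cmod p \<le> R" using p Suc.prems by simp
    show "cmod p \<le> R" by (rule pR)
    have "\<bar>Ecomp y n p\<bar> \<le> (6 * (cmod p * cmod y)) ^ n / fact n" by (rule Ecomp_bound)
    also have "\<dots> \<le> ?C ^ n / fact n"
      using mult_mono[of "cmod p" "1 + R" "cmod y" "cmod y"] pR R
      by (intro divide_right_mono power_mono mult_left_mono) (simp_all add: mult.commute)
    finally show "\<bar>Ecomp y n p\<bar> \<le> ?C ^ n / fact n" .
    define B where "B = ?C ^ n / fact n"
    have B: "0 \<le> B" using R unfolding B_def
      by (intro divide_nonneg_nonneg zero_le_power mult_nonneg_nonneg) auto
    have "cmod p * (cmod y * (real n * B)) \<le> R * (cmod y * (real n * B))"
      using pR B by (intro mult_right_mono mult_nonneg_nonneg) auto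
    moreover have "0 \<le> cmod y * (real n * B)" "0 \<le> R * (cmod y * B)"
      using B R by (intro mult_nonneg_nonneg; simp)+
    ultimately have "cmod y * B + cmod p * cmod y * (real n * B) \<le> cmod y * (1 + R) * (real (Suc n) * B)"
      by (simp add: algebra_simps)
    then show "cmod y * (?C ^ n / fact n) + cmod p * cmod y * (real n * ?C ^ n / fact n) \<le> ?M"
      by (simp only: B_def times_divide_eq_right)
  qed
  then have "deriv_bdd (Ecomp y (Suc n)) x (6 * ?M / real (Suc n))"
    unfolding Ecomp.simps by (intro deriv_bdd_resolvent) auto
  moreover have "6 * ?M / real (Suc n) = real (Suc n) * ?C ^ Suc n / fact (Suc n)"
    by (simp add: field_simps)
  ultimately show ?case by (simp only:)
qed

lemma Ecomp_has_derivative: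
  "(Ecomp y n has_derivative frechet_derivative (Ecomp y n) (at x)) (at x)"
proof -
  obtain D where "(Ecomp y n has_derivative D) (at x)"
    using deriv_bdd_Ecomp[of x "cmod x" y n] by (auto simp: deriv_bdd_def)
  then show ?thesis by (simp add: frechet_derivative_works[symmetric] differentiableI)
qed

lemma Ecomp_differentiable: "Ecomp y n differentiable (at x)"
  using Ecomp_has_derivative by (rule differentiableI)

lemma Ecomp_frechet_bound:
  assumes "cmod x \<le> R"
  shows "\<bar>frechet_derivative (Ecomp y n) (at x) h\<bar> \<le> real n * (6 * (cmod y * (1 + R))) ^ n / fact n * cmod h"
proof -
  obtain D where "(Ecomp y n has_derivative D) (at x)"
    and "\<And>h. \<bar>D h\<bar> \<le> real n * (6 * (cmod y * (1 + R))) ^ n / fact n * cmod h"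
    using deriv_bdd_Ecomp[OF assms, of y n] by (auto simp: deriv_bdd_def)
  then show ?thesis by (simp add: frechet_derivative_at[symmetric])
qed

text \<open>Euler's identity for homogeneous functions, from differentiating
  \<open>Ecomp_scale\<close> in the scaling factor at 1. It turns the recursion solved by the
  resolvent into the radial Dunkl equation.\<close>

lemma Ecomp_Euler: "frechet_derivative (Ecomp y n) (at x) x = real n * Ecomp y n x"
proof -
  have "((\<lambda>t. Ecomp y n (t *\<^sub>R x)) has_derivative (\<lambda>h. frechet_derivative (Ecomp y n) (at x) (h *\<^sub>R x))) (at 1)"
    by (rule has_derivative_compose[where f = "\<lambda>t. t *\<^sub>R x"])
      (auto intro!: derivative_eq_intros Ecomp_has_derivative)
  then have "((\<lambda>t. t ^ n * Ecomp y n x) has_derivative (\<lambda>h. frechet_derivative (Ecomp y n) (at x) (h *\<^sub>R x))) (at 1)"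
    by (simp add: Ecomp_scale)
  moreover have "((\<lambda>t. t ^ n * Ecomp y n x) has_derivative (\<lambda>h. real n * Ecomp y n x * h)) (at 1)"
    by (auto intro!: derivative_eq_intros)
  ultimately have "(\<lambda>h. frechet_derivative (Ecomp y n) (at x) (h *\<^sub>R x)) = (\<lambda>h. real n * Ecomp y n x * h)"
    by (rule has_derivative_unique)
  from fun_cong[OF this, of 1] show ?thesis by simp
qed

section \<open>The angular component of the Dunkl operators\<close>

definition ang_coeff :: "int \<Rightarrow> complex \<Rightarrow> real" where
  "ang_coeff i x = (root i \<bullet> (\<i> * x)) / (root i \<bullet> x)"

definition Theta :: "(complex \<Rightarrow> real) \<Rightarrow> complex \<Rightarrow> real" where
  "Theta f x = frechet_derivative f (at x) (\<i> * x)
     + (\<Sum>j<2*k. kappa (int j) * ang_coeff (int j) x * (f x - f (rfl (int j) x)))"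

lemma dunkl_op_angular: "dunkl_op k a b (\<i> * x) f x = Theta f x"
  by (simp add: dunkl_op_eq Theta_def ang_coeff_def dih_root_eq)

lemma ang_coeff_period: "ang_coeff (i + 2 * int k) x = ang_coeff i x"
  by (simp add: ang_coeff_def root_period inner_minus_left)

lemma i_rfl: "\<i> * rfl j x = - rfl j (\<i> * x)"
  by (simp add: rfl_def)

text \<open>\<open>ang_coeff\<close> is the cotangent of the oriented angle from the mirror to the
  point, and reflecting both of them reverses that angle.\<close>

lemma ang_coeff_rfl: "ang_coeff (2 * j - i) (rfl j x) = - ang_coeff i x"
  unfolding ang_coeff_def i_rfl inner_minus_right root_inner_rfl by simp

text \<open>The derivative changes sign because a reflection reverses the angular direction. In the
  difference part, conjugation sends the reflection \<open>i\<close> to \<open>2 * j - i\<close>,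
  which lies in the same class, while the cotangent changes sign.\<close>

lemma Theta_rfl:
  assumes diff: "f differentiable (at (rfl j x))"
  shows "Theta (\<lambda>p. f (rfl j p)) x = - Theta f (rfl j x)"
proof -
  have "((\<lambda>p. f (rfl j p)) has_derivative (\<lambda>h. frechet_derivative f (at (rfl j x)) (rfl j h))) (at x)"
    using diff by (intro has_derivative_compose[OF has_derivative_rfl]) (simp add: frechet_derivative_works)
  then have "frechet_derivative (\<lambda>p. f (rfl j p)) (at x) (\<i> * x)
      = frechet_derivative f (at (rfl j x)) (rfl j (\<i> * x))"
    by (simp add: frechet_derivative_at[symmetric])
  also have "rfl j (\<i> * x) = - (\<i> * rfl j x)" by (simp add: i_rfl)
  also have "frechet_derivative f (at (rfl j x)) (- (\<i> * rfl j x))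
      = - frechet_derivative f (at (rfl j x)) (\<i> * rfl j x)"
    by (rule linear_neg[OF linear_frechet_derivative[OF diff]])
  finally have D: "frechet_derivative (\<lambda>p. f (rfl j p)) (at x) (\<i> * x)
      = - frechet_derivative f (at (rfl j x)) (\<i> * rfl j x)" .
  let ?h = "\<lambda>i. kappa i * ang_coeff i (rfl j x) * (f (rfl j x) - f (rfl i (rfl j x)))"
  have "(\<Sum>i<2*k. ?h (int i)) = (\<Sum>i<2*k. ?h (2 * j - int i))"
    by (rule sum_reflect[where h = ?h, symmetric]) (simp add: ang_coeff_period)
  also have "\<dots> = (\<Sum>i<2*k. - (kappa (int i) * ang_coeff (int i) x * (f (rfl j x) - f (rfl j (rfl (int i) x)))))"
  proof (intro sum.cong refl)
    fix i
    have "rfl (2 * j - int i) (rfl j x) = rfl j (rfl (int i) x)" by (simp add: rfl_rfl)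
    moreover have "kappa (2 * j - int i) = kappa (int i)" by (simp add: kappa_def)
    ultimately show "?h (2 * j - int i) = - (kappa (int i) * ang_coeff (int i) x * (f (rfl j x) - f (rfl j (rfl (int i) x))))"
      by (simp add: ang_coeff_rfl)
  qed
  finally show ?thesis unfolding Theta_def D by (simp add: sum_negf)
qed

lemma rfl_root: "rfl j x = x - (2 * (root j \<bullet> x)) *\<^sub>R root j"
proof -
  define t where "t = real_of_int j * pi / (2 * real k)"
  have "real_of_int j * pi / real k = 2 * t" by (simp add: t_def)
  then have "rfl j x = cnj x * cis (2 * t)" "root j = \<i> * cis t"
    unfolding rfl_def c_def root_def t_def by simp_all
  moreover have cos_sq: "cos t * cos t = 1 - sin t * sin t"
    using sin_cos_squared_add[of t] by (simp add: power2_eq_square)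
  moreover have "cis (2 * t) = Complex (1 - 2 * (sin t * sin t)) (2 * (sin t * cos t))"
    using cos_sq by (simp add: complex_eq_iff cos_double sin_double power2_eq_square)
  ultimately have "rfl j x = cnj x * Complex (1 - 2 * (sin t * sin t)) (2 * (sin t * cos t))"
    "root j = Complex (- sin t) (cos t)" by (simp_all add: complex_eq_iff)
  moreover have cos_sq2: "cos t * (cos t * 2) = 2 - sin t * (sin t * 2)"
    using cos_sq by (simp only: mult.assoc[symmetric]) simp
  ultimately show ?thesis
    by (simp add: complex_eq_iff inner_complex_def algebra_simps cos_sq2)
qed

text \<open>The vector \<open>x - rfl j x\<close> is the root times
  \<open>2 * (root j \<bullet> x)\<close>, which cancels the denominator of the cotangent.\<close>

lemma ang_coeff_inner:
  assumes "dih_regular k x"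
  shows "ang_coeff j x * (x \<bullet> y - rfl j x \<bullet> y) = (\<i> * x) \<bullet> y + (\<i> * rfl j x) \<bullet> y"
proof -
  have "root j \<bullet> x \<noteq> 0" using assms by (simp add: dih_regular_iff)
  moreover have "x \<bullet> y - rfl j x \<bullet> y = 2 * (root j \<bullet> x) * (root j \<bullet> y)"
    by (simp add: rfl_root[of j x] inner_diff_left)
  moreover have "(\<i> * x) \<bullet> y + (\<i> * rfl j x) \<bullet> y = 2 * (root j \<bullet> (\<i> * x)) * (root j \<bullet> y)"
    unfolding i_rfl by (simp add: rfl_root[of j "\<i> * x"] inner_diff_left inner_minus_left)
  ultimately show ?thesis by (simp add: ang_coeff_def)
qed

text \<open>A Leibniz rule with defect: the difference part is not a derivation, but by
  \<open>ang_coeff_inner\<close> its defect is a sum without denominators.\<close>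

lemma Theta_inner_mult:
  assumes reg: "dih_regular k x" and diff: "f differentiable (at x)"
  shows "Theta (\<lambda>x. (x \<bullet> y) * f x) x = ((\<i> * x) \<bullet> y) * f x + (x \<bullet> y) * Theta f x
    + (\<Sum>j<2*k. kappa (int j) * (((\<i> * x) \<bullet> y) + ((\<i> * rfl (int j) x) \<bullet> y)) * f (rfl (int j) x))"
proof -
  have "((\<lambda>x. (x \<bullet> y) * f x) has_derivative
      (\<lambda>h. (x \<bullet> y) * frechet_derivative f (at x) h + (h \<bullet> y) * f x)) (at x)"
    by (rule derivative_eq_intros diff[unfolded frechet_derivative_works] refl)+ simp
  then have D: "frechet_derivative (\<lambda>x. (x \<bullet> y) * f x) (at x)
      = (\<lambda>h. (x \<bullet> y) * frechet_derivative f (at x) h + (h \<bullet> y) * f x)"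
    by (rule frechet_derivative_at[symmetric])
  have "kappa (int j) * ang_coeff (int j) x * ((x \<bullet> y) * f x - (rfl (int j) x \<bullet> y) * f (rfl (int j) x))
    = (x \<bullet> y) * (kappa (int j) * ang_coeff (int j) x * (f x - f (rfl (int j) x)))
      + kappa (int j) * (((\<i> * x) \<bullet> y) + ((\<i> * rfl (int j) x) \<bullet> y)) * f (rfl (int j) x)" for j
    unfolding ang_coeff_inner[OF reg, symmetric] by (simp add: algebra_simps)
  then have S: "(\<Sum>j<2*k. kappa (int j) * ang_coeff (int j) x * ((x \<bullet> y) * f x - (rfl (int j) x \<bullet> y) * f (rfl (int j) x)))
      = (x \<bullet> y) * (\<Sum>j<2*k. kappa (int j) * ang_coeff (int j) x * (f x - f (rfl (int j) x)))
        + (\<Sum>j<2*k. kappa (int j) * (((\<i> * x) \<bullet> y) + ((\<i> * rfl (int j) x) \<bullet> y)) * f (rfl (int j) x))"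
    by (simp only: sum.distrib sum_distrib_left)
  show ?thesis
    unfolding Theta_def D S by (simp only: ring_distribs add_ac)
qed

lemma Theta_add:
  assumes "f differentiable (at x)" "g differentiable (at x)"
  shows "Theta (\<lambda>x. f x + g x) x = Theta f x + Theta g x"
proof -
  have "((\<lambda>x. f x + g x) has_derivative
      (\<lambda>h. frechet_derivative f (at x) h + frechet_derivative g (at x) h)) (at x)"
    using assms by (intro has_derivative_add) (simp_all add: frechet_derivative_works)
  then have D: "frechet_derivative (\<lambda>x. f x + g x) (at x)
      = (\<lambda>h. frechet_derivative f (at x) h + frechet_derivative g (at x) h)"
    by (rule frechet_derivative_at[symmetric])
  show ?thesis unfolding Theta_def D
    by (simp add: sum.distrib[symmetric] algebra_simps)
qed

lemma Theta_cmult: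
  assumes "f differentiable (at x)"
  shows "Theta (\<lambda>x. r * f x) x = r * Theta f x"
proof -
  have "((\<lambda>x. r * f x) has_derivative (\<lambda>h. r * frechet_derivative f (at x) h)) (at x)"
    using assms by (intro has_derivative_mult_right) (simp add: frechet_derivative_works)
  then have D: "frechet_derivative (\<lambda>x. r * f x) (at x) = (\<lambda>h. r * frechet_derivative f (at x) h)"
    by (rule frechet_derivative_at[symmetric])
  show ?thesis unfolding Theta_def D
    by (simp add: sum_distrib_left algebra_simps)
qed

lemma Theta_const: "Theta (\<lambda>x. r) x = 0"
  by (simp add: Theta_def)

lemma Theta_sum:
  fixes m :: nat
  assumes "\<And>j. f j differentiable (at x)"
  shows "Theta (\<lambda>x. \<Sum>j<m. f j x) x = (\<Sum>j<m. Theta (f j) x)"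
proof (induction m)
  case (Suc m)
  have "(\<lambda>x. \<Sum>j<m. f j x) differentiable (at x)"
    by (intro differentiable_sum) (auto simp: assms)
  with Suc show ?case by (simp add: Theta_add assms)
qed (simp add: Theta_const)

lemma differentiable_rfl: "f differentiable (at (rfl j x)) \<Longrightarrow> (\<lambda>p. f (rfl j p)) differentiable (at x)"
  unfolding differentiable_def by (elim exE, rule exI, rule has_derivative_compose[OF has_derivative_rfl])

text \<open>Reflections reverse orientation, so they anticommute with the angular operator. Applied to the radial
  recursion, the angular operator therefore turns $n + \sum_j \kappa_j (1 - \sigma_j)$ into $n + \sum_j \kappa_j (1 + \sigma_j)$, which
  is again injective.\<close>

lemma Theta_Ecomp_step:
  assumes prev: "\<And>p. dih_regular k p \<Longrightarrow>
      (p \<bullet> y) * Theta (Ecomp y n) p = ((\<i> * p) \<bullet> y) * (real n * Ecomp y n p + refl_diff (Ecomp y n) p)"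
    and x: "dih_regular k x"
  shows "Theta (Ecomp y (Suc n)) x = ((\<i> * x) \<bullet> y) * Ecomp y n x"
proof -
  let ?e = "Ecomp y (Suc n)" and ?N = "real (Suc n) + real k * (a + b)"
  define m where "m p = Theta ?e p - ((\<i> * p) \<bullet> y) * Ecomp y n p" for p
  have diff: "Ecomp y l differentiable (at p)" for l p by (rule Ecomp_differentiable)
  \<comment> \<open>\<open>m\<close> is the defect of the angular equation. \<open>Theta\<close> is
    applied to the recursion and \<open>prev\<close> is inserted; part of the Leibniz defect then
    cancels against the reflections in \<open>refl_diff\<close>, and the rest has the same shape as
    the left-hand side.\<close>
  have key: "?N * m p + (\<Sum>j<2*k. kappa (int j) * m (rfl (int j) p)) = 0" if p: "dih_regular k p" for p
  proof -
    have "(\<lambda>p. ?N * ?e p + (\<Sum>j<2*k. (- kappa (int j)) * ?e (rfl (int j) p))) = (\<lambda>p. (p \<bullet> y) * Ecomp y n p)"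
    proof
      fix p
      show "?N * ?e p + (\<Sum>j<2*k. (- kappa (int j)) * ?e (rfl (int j) p)) = (p \<bullet> y) * Ecomp y n p"
        using Ecomp_rec[of n y p] by (simp add: refl_diff_eq sum_negf algebra_simps)
    qed
    then have "Theta (\<lambda>p. ?N * ?e p + (\<Sum>j<2*k. (- kappa (int j)) * ?e (rfl (int j) p))) p
        = Theta (\<lambda>p. (p \<bullet> y) * Ecomp y n p) p" by (rule arg_cong)
    moreover have "Theta (\<lambda>p. ?N * ?e p + (\<Sum>j<2*k. (- kappa (int j)) * ?e (rfl (int j) p))) p
        = ?N * Theta ?e p + (\<Sum>j<2*k. kappa (int j) * Theta ?e (rfl (int j) p))"
    proof -
      have d: "(\<lambda>p. ?e (rfl (int j) p)) differentiable (at p)" for j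
        by (intro differentiable_rfl diff)
      have d': "(\<lambda>p. (- kappa (int j)) * ?e (rfl (int j) p)) differentiable (at p)" for j
        by (rule differentiable_mult[OF differentiable_const d])
      have "Theta (\<lambda>p. ?N * ?e p + (\<Sum>j<2*k. (- kappa (int j)) * ?e (rfl (int j) p))) p
        = Theta (\<lambda>p. ?N * ?e p) p + Theta (\<lambda>p. \<Sum>j<2*k. (- kappa (int j)) * ?e (rfl (int j) p)) p"
        by (intro Theta_add differentiable_mult differentiable_const diff differentiable_sum d' ballI) auto
      also have "Theta (\<lambda>p. ?N * ?e p) p = ?N * Theta ?e p"
        by (rule Theta_cmult[OF diff])
      also have "Theta (\<lambda>p. \<Sum>j<2*k. (- kappa (int j)) * ?e (rfl (int j) p)) p
        = (\<Sum>j<2*k. Theta (\<lambda>p. (- kappa (int j)) * ?e (rfl (int j) p)) p)"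
        by (rule Theta_sum[OF d'])
      also have "\<dots> = (\<Sum>j<2*k. kappa (int j) * Theta ?e (rfl (int j) p))"
        by (simp only: Theta_cmult[OF d] Theta_rfl[OF diff] minus_mult_minus)
      finally show ?thesis .
    qed
    ultimately have "?N * Theta ?e p + (\<Sum>j<2*k. kappa (int j) * Theta ?e (rfl (int j) p))
      = ((\<i> * p) \<bullet> y) * Ecomp y n p + (p \<bullet> y) * Theta (Ecomp y n) p
        + (\<Sum>j<2*k. kappa (int j) * (((\<i> * p) \<bullet> y) + ((\<i> * rfl (int j) p) \<bullet> y)) * Ecomp y n (rfl (int j) p))"
      by (simp only: Theta_inner_mult[OF p diff])
    also have "(\<Sum>j<2*k. kappa (int j) * (((\<i> * p) \<bullet> y) + ((\<i> * rfl (int j) p) \<bullet> y)) * Ecomp y n (rfl (int j) p))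
      = ((\<i> * p) \<bullet> y) * (\<Sum>j<2*k. kappa (int j) * Ecomp y n (rfl (int j) p))
        + (\<Sum>j<2*k. kappa (int j) * (((\<i> * rfl (int j) p) \<bullet> y) * Ecomp y n (rfl (int j) p)))"
      by (simp add: ring_distribs sum.distrib sum_distrib_left mult_ac)
    finally show ?thesis
      unfolding m_def prev[OF p] refl_diff_eq
      by (simp add: right_diff_distrib sum_subtractf) (simp add: algebra_simps)
  qed
  \<comment> \<open>Paired with \<open>m\<close> over the orbit: the reflections contribute at least
    minus k(a + b) times the energy, so \<open>n + 1\<close> times the energy is at most 0.\<close>
  have "?N * orbit_sum (\<lambda>p. (m p)\<^sup>2) x + (\<Sum>j<2*k. kappa (int j) * orbit_sum (\<lambda>p. m p * m (rfl (int j) p)) x)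
      = orbit_sum (\<lambda>p. m p * (?N * m p + (\<Sum>j<2*k. kappa (int j) * m (rfl (int j) p)))) x"
    unfolding orbit_sum_cmult[symmetric] orbit_sum_sum[symmetric] orbit_sum_add[symmetric]
    by (simp add: algebra_simps power2_eq_square sum_distrib_left)
  also have "\<dots> = 0"
    unfolding orbit_sum_def
    by (intro sum.neutral ballI)
      (simp only: key dih_regular_rot[OF x] dih_regular_rfl[OF x] mult_zero_right add_0)
  finally have "?N * orbit_sum (\<lambda>p. (m p)\<^sup>2) x
      + (\<Sum>j<2*k. kappa (int j) * orbit_sum (\<lambda>p. m p * m (rfl (int j) p)) x) = 0" .
  moreover have "?N * orbit_sum (\<lambda>p. (m p)\<^sup>2) x
      = real (Suc n) * orbit_sum (\<lambda>p. (m p)\<^sup>2) x + real k * (a + b) * orbit_sum (\<lambda>p. (m p)\<^sup>2) x"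
    by (rule distrib_right)
  ultimately have "real (Suc n) * orbit_sum (\<lambda>p. (m p)\<^sup>2) x \<le> 0"
    using orbit_sum_mult_rfl_sum_le[of m x] by linarith
  then have "orbit_sum (\<lambda>p. (m p)\<^sup>2) x \<le> 0"
    by (simp add: mult_le_0_iff)
  then have "m (rot 0 x) = 0" by (rule orbit_sum_sq_zero)
  then show ?thesis by (simp add: m_def)
qed

text \<open>The hypothesis of the step carries the factor \<open>p \<bullet> y\<close> and is
  phrased through \<open>refl_diff\<close> so that it makes sense at \<open>n = 0\<close>, where
  both sides vanish. For later \<open>n\<close> both sides are the two inner products times the
  preceding component.\<close>

lemma Theta_Ecomp:
  "dih_regular k x \<Longrightarrow> Theta (Ecomp y (Suc n)) x = ((\<i> * x) \<bullet> y) * Ecomp y n x"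
proof (induction n arbitrary: x)
  case 0
  have "Theta (Ecomp y 0) p = 0" "refl_diff (Ecomp y 0) p = 0" for p
    by (simp_all add: Theta_const refl_diff_def)
  then show ?case by (intro Theta_Ecomp_step 0) simp
next
  case (Suc n)
  show ?case
    by (rule Theta_Ecomp_step[OF _ Suc.prems]) (simp only: Ecomp_rec Suc.IH mult_ac)
qed

text \<open>For nonzero \<open>x\<close> the vectors x and i x form an orthogonal basis, so the
  radial and the angular equation determine the operator in both coordinate directions. The origin
  is not regular.\<close>

lemma dunkl_op_Ecomp_Suc:
  assumes x: "dih_regular k x"
  shows "dunkl_op k a b e (Ecomp y (Suc n)) x = (e \<bullet> y) * Ecomp y n x"
proof -
  have x0: "x \<noteq> 0" using x by (auto simp: dih_regular_iff)
  let ?d = "\<lambda>e. dunkl_op k a b e (Ecomp y (Suc n)) x"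
  have lin: "?d v = Re v * ?d 1 + Im v * ?d \<i>" for v
    by (rule dunkl_op_linear[OF Ecomp_differentiable])
  have 1: "Re x * ?d 1 + Im x * ?d \<i> = (x \<bullet> y) * Ecomp y n x"
    unfolding lin[of x, symmetric] dunkl_op_radial[OF x] Ecomp_Euler by (rule Ecomp_rec)
  have "Re (\<i> * x) * ?d 1 + Im (\<i> * x) * ?d \<i> = ((\<i> * x) \<bullet> y) * Ecomp y n x"
    unfolding lin[of "\<i> * x", symmetric] dunkl_op_angular by (rule Theta_Ecomp[OF x])
  then have 2: "- Im x * ?d 1 + Re x * ?d \<i> = (Re x * Im y - Im x * Re y) * Ecomp y n x"
    by (simp add: inner_complex_def)
  have nz: "Re x * Re x + Im x * Im x \<noteq> 0"
    using x0 by (simp add: complex_eq_iff sum_squares_eq_zero_iff)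
  let ?E = "Ecomp y n x"
  have "(Re x * Re x + Im x * Im x) * ?d 1 = Re x * ((x \<bullet> y) * ?E) - Im x * ((Re x * Im y - Im x * Re y) * ?E)"
    unfolding 1[symmetric] 2[symmetric] by (simp add: algebra_simps)
  also have "\<dots> = (Re x * Re x + Im x * Im x) * (Re y * ?E)"
    by (simp add: inner_complex_def algebra_simps)
  finally have d1: "?d 1 = Re y * ?E" using nz mult_left_cancel by blast
  have "(Re x * Re x + Im x * Im x) * ?d \<i> = Im x * ((x \<bullet> y) * ?E) + Re x * ((Re x * Im y - Im x * Re y) * ?E)"
    unfolding 1[symmetric] 2[symmetric] by (simp add: algebra_simps)
  also have "\<dots> = (Re x * Re x + Im x * Im x) * (Im y * ?E)"
    by (simp add: inner_complex_def algebra_simps)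
  finally have d2: "?d \<i> = Im y * ?E" using nz mult_left_cancel by blast
  show ?thesis unfolding lin[of e] d1 d2 by (simp add: inner_complex_def algebra_simps)
qed

section \<open>Summation of the components\<close>

definition Eser :: "complex \<Rightarrow> complex \<Rightarrow> real" where
  "Eser y x = (\<Sum>n. Ecomp y n x)"

lemma summable_Ecomp: "summable (\<lambda>n. Ecomp y n x)"
proof (rule summable_comparison_test[OF _ summable_exp[of "6 * (cmod x * cmod y)"]])
  show "\<exists>N. \<forall>n\<ge>N. norm (Ecomp y n x) \<le> inverse (fact n) * (6 * (cmod x * cmod y)) ^ n"
    using Ecomp_bound[of y _ x] by (simp add: field_simps)
qed

lemma Eser_sums: "(\<lambda>n. Ecomp y n x) sums Eser y x"
  unfolding Eser_def by (rule summable_sums[OF summable_Ecomp])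

text \<open>Termwise differentiation: on a ball around 0 that contains \<open>x\<close>, the
  derivatives of the components are dominated by the convergent series \<open>B\<close>, uniformly
  in the point and linearly in the direction.\<close>

lemma Eser_has_derivative:
  shows "summable (\<lambda>n. frechet_derivative (Ecomp y n) (at x) h)"
    and "(Eser y has_derivative (\<lambda>h. \<Sum>n. frechet_derivative (Ecomp y n) (at x) h)) (at x)"
proof -
  define R where "R = cmod x + 1"
  let ?S = "ball (0::complex) R"
  define C where "C = 6 * (cmod y * (1 + R))"
  define B where "B n = real n * C ^ n / fact n" for n
  have "summable B"
  proof (subst summable_Suc_iff[symmetric])
    have "B (Suc n) = C * (inverse (fact n) * C ^ n)" for n
      unfolding B_def by (simp add: divide_inverse fact_Suc del: of_nat_Suc)
    then show "summable (\<lambda>n. B (Suc n))"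
      by (simp only: summable_mult summable_exp)
  qed
  have bnd: "\<bar>frechet_derivative (Ecomp y n) (at p) h\<bar> \<le> B n * cmod h" if "p \<in> ?S" for n p h
    unfolding B_def C_def using that by (intro Ecomp_frechet_bound) auto
  have summ: "summable (\<lambda>n. frechet_derivative (Ecomp y n) (at p) h)" if "p \<in> ?S" for p h
    by (rule summable_comparison_test[OF _ summable_mult2[OF \<open>summable B\<close>]])
      (use bnd[OF that] in auto)
  have xS: "x \<in> ?S" by (simp add: R_def)
  show "summable (\<lambda>n. frechet_derivative (Ecomp y n) (at x) h)" by (rule summ[OF xS])
  have "\<exists>g. \<forall>p\<in>?S. (\<lambda>n. Ecomp y n p) sums (g p) \<and>
      (g has_derivative (\<lambda>h. \<Sum>n. frechet_derivative (Ecomp y n) (at p) h)) (at p within ?S)"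
  proof (rule has_derivative_series)
    show "convex ?S" by simp
    show "(Ecomp y n has_derivative frechet_derivative (Ecomp y n) (at p)) (at p within ?S)" for n p
      by (rule has_derivative_at_withinI[OF Ecomp_has_derivative])
    show "x \<in> ?S" by (rule xS)
    show "(\<lambda>n. Ecomp y n x) sums Eser y x" by (rule Eser_sums)
    fix e :: real assume "e > 0"
    have "(\<lambda>N. \<Sum>n. B (n + N)) \<longlonglongrightarrow> 0"
      by (rule suminf_exist_split2[OF \<open>summable B\<close>])
    then have ev: "\<forall>\<^sub>F N in sequentially. (\<Sum>n. B (n + N)) < e"
      using \<open>e > 0\<close> by (rule order_tendstoD(2))
    then show "\<forall>\<^sub>F N in sequentially. \<forall>p\<in>?S. \<forall>h.
        norm ((\<Sum>i<N. frechet_derivative (Ecomp y i) (at p) h) - (\<Sum>n. frechet_derivative (Ecomp y n) (at p) h))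
          \<le> e * norm h"
    proof (rule eventually_mono, intro ballI allI)
      fix N p h assume N: "(\<Sum>n. B (n + N)) < e" and p: "p \<in> ?S"
      let ?f = "\<lambda>n. frechet_derivative (Ecomp y n) (at p) h"
      have sB: "summable (\<lambda>n. B (n + N) * cmod h)"
        by (intro summable_mult2 summable_ignore_initial_segment \<open>summable B\<close>)
      have "(\<Sum>i<N. ?f i) - (\<Sum>n. ?f n) = - (\<Sum>n. ?f (n + N))"
        using suminf_split_initial_segment[OF summ[OF p, of h], of N] by simp
      then have "norm ((\<Sum>i<N. ?f i) - (\<Sum>n. ?f n)) = \<bar>\<Sum>n. ?f (n + N)\<bar>" by simp
      also have "\<dots> \<le> (\<Sum>n. B (n + N) * cmod h)"
        using norm_suminf_le[of "\<lambda>n. ?f (n + N)" "\<lambda>n. B (n + N) * cmod h"] bnd[OF p] sB by simp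
      also have "\<dots> = (\<Sum>n. B (n + N)) * cmod h"
        by (intro suminf_mult2[symmetric] summable_ignore_initial_segment \<open>summable B\<close>)
      also have "\<dots> \<le> e * norm h" using N by (intro mult_right_mono) auto
      finally show "norm ((\<Sum>i<N. ?f i) - (\<Sum>n. ?f n)) \<le> e * norm h" .
    qed
  qed
  then obtain g where g: "\<And>p. p \<in> ?S \<Longrightarrow> (\<lambda>n. Ecomp y n p) sums (g p)"
    "\<And>p. p \<in> ?S \<Longrightarrow> (g has_derivative (\<lambda>h. \<Sum>n. frechet_derivative (Ecomp y n) (at p) h)) (at p within ?S)"
    by blast
  have "(g has_derivative (\<lambda>h. \<Sum>n. frechet_derivative (Ecomp y n) (at x) h)) (at x)"
    using g(2)[OF xS] xS at_within_open[of x ?S] by simp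
  then show "(Eser y has_derivative (\<lambda>h. \<Sum>n. frechet_derivative (Ecomp y n) (at x) h)) (at x)"
  proof (rule has_derivative_transform_within_open[OF _ _ xS])
    show "g p = Eser y p" if "p \<in> ?S" for p
      using g(1)[OF that] Eser_sums sums_unique2 by blast
  qed simp
qed

text \<open>The operator annihilates the constant component and lowers the index of all others by
  one, so the shifted series reproduces \<open>Eser y\<close>.\<close>

lemma dunkl_op_Eser:
  assumes x: "dih_regular k x"
  shows "dunkl_op k a b e (Eser y) x = (e \<bullet> y) * Eser y x"
proof -
  let ?D = "\<lambda>n. frechet_derivative (Ecomp y n) (at x) e"
  have "frechet_derivative (Eser y) (at x) = (\<lambda>h. \<Sum>n. frechet_derivative (Ecomp y n) (at x) h)"
    by (rule frechet_derivative_at[OF Eser_has_derivative(2), symmetric])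
  then have D: "?D sums frechet_derivative (Eser y) (at x) e"
    using Eser_has_derivative(1) by (simp add: summable_sums)
  have "(\<lambda>n. dunkl_op k a b e (Ecomp y n) x) sums dunkl_op k a b e (Eser y) x"
    unfolding dunkl_op_eq
    by (intro sums_add D sums_sum sums_divide sums_mult sums_diff Eser_sums)
  moreover have "dunkl_op k a b e (Ecomp y 0) x = 0"
    by (simp add: dunkl_op_eq)
  ultimately have "(\<lambda>n. (e \<bullet> y) * Ecomp y n x) sums dunkl_op k a b e (Eser y) x"
    using sums_Suc_iff[of "\<lambda>n. dunkl_op k a b e (Ecomp y n) x" "dunkl_op k a b e (Eser y) x"]
    by (simp add: dunkl_op_Ecomp_Suc[OF x])
  moreover have "(\<lambda>n. (e \<bullet> y) * Ecomp y n x) sums ((e \<bullet> y) * Eser y x)"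
    by (intro sums_mult Eser_sums)
  ultimately show ?thesis by (rule sums_unique2)
qed

lemma Ecomp_at_0: "Ecomp y n 0 = (if n = 0 then 1 else 0)"
  using Ecomp_scale[of y n 0 0] by (cases n) simp_all

lemma dunkl_kernel_eq_Eser: "dunkl_kernel k a b x y = Eser y x"
proof (rule dunkl_kernel_eqI)
  show "Eser y 0 = 1"
    unfolding Eser_def Ecomp_at_0 by (subst suminf_finite[of "{0}"]) auto
  show "dunkl_eigen y (Eser y)"
    unfolding dunkl_eigen_def using Eser_has_derivative(2)
    by (auto simp: dunkl_op_Eser inner_complex_def intro: differentiableI)
qed

end

section \<open>The measures on the interval\<close>

text \<open>Difference quotients along an arbitrary null sequence are bounded by \<open>B\<close>
  through the mean value inequality, so dominated convergence applies.\<close>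

lemma has_derivative_LINT:
  fixes f f' :: "real \<Rightarrow> 'x \<Rightarrow> real"
  assumes fin: "finite_measure M" and d: "d > 0"
    and int: "\<And>R. \<bar>R - R0\<bar> < d \<Longrightarrow> integrable M (f R)"
    and meas': "f' R0 \<in> borel_measurable M"
    and deriv: "AE w in M. \<forall>R. \<bar>R - R0\<bar> < d \<longrightarrow>
      ((\<lambda>R. f R w) has_real_derivative f' R w) (at R) \<and> \<bar>f' R w\<bar> \<le> B"
  shows "((\<lambda>R. \<integral>w. f R w \<partial>M) has_real_derivative (\<integral>w. f' R0 w \<partial>M)) (at R0)"
  unfolding DERIV_def tendsto_at_iff_sequentially
proof (intro allI impI)
  interpret finite_measure M by fact
  fix X :: "nat \<Rightarrow> real"
  assume X: "\<forall>i. X i \<in> UNIV - {0}" and lim: "X \<longlonglongrightarrow> 0"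
  from lim d have "\<forall>\<^sub>F i in sequentially. \<bar>X i\<bar> < d"
    by (auto simp: tendsto_iff dist_real_def)
  then obtain N where N: "\<And>i. i \<ge> N \<Longrightarrow> \<bar>X i\<bar> < d"
    by (auto simp: eventually_sequentially)
  define Y where "Y i = X (i + N)" for i
  have Y: "Y i \<noteq> 0" "\<bar>Y i\<bar> < d" for i using X N by (auto simp: Y_def)
  have Ylim: "Y \<longlonglongrightarrow> 0" unfolding Y_def using lim by (rule LIMSEQ_ignore_initial_segment)
  have intY: "integrable M (f (R0 + Y i))" and int0: "integrable M (f R0)" for i
    using Y d by (auto intro!: int)
  have "(\<lambda>i. \<integral>w. (f (R0 + Y i) w - f R0 w) / Y i \<partial>M) \<longlonglongrightarrow> (\<integral>w. f' R0 w \<partial>M)"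
  proof (rule integral_dominated_convergence[where w = "\<lambda>_. B"])
    show "(\<lambda>w. (f (R0 + Y i) w - f R0 w) / Y i) \<in> borel_measurable M" for i
      using intY int0 by measurable
    show "AE w in M. (\<lambda>i. (f (R0 + Y i) w - f R0 w) / Y i) \<longlonglongrightarrow> f' R0 w"
      using deriv
    proof eventually_elim
      case (elim w)
      then have "(\<lambda>h. (f (R0 + h) w - f R0 w) / h) \<midarrow>0\<rightarrow> f' R0 w"
        using d by (auto simp: DERIV_def)
      then show ?case
        using Y Ylim unfolding tendsto_at_iff_sequentially by (auto simp: comp_def)
    qed
    show "AE w in M. norm ((f (R0 + Y i) w - f R0 w) / Y i) \<le> B" for i
      using deriv
    proof eventually_elim
      case (elim w)
      have "norm (f (R0 + Y i) w - f R0 w) \<le> B * norm (R0 + Y i - R0)"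
      proof (rule field_differentiable_bound[where S = "ball R0 d"])
        fix R assume "R \<in> ball R0 d"
        then have "\<bar>R - R0\<bar> < d" by (simp add: dist_real_def abs_minus_commute)
        with elim have "((\<lambda>R. f R w) has_real_derivative f' R w) (at R)" "\<bar>f' R w\<bar> \<le> B" by blast+
        then show "((\<lambda>R. f R w) has_field_derivative f' R w) (at R within ball R0 d)" "norm (f' R w) \<le> B"
          by (simp_all add: has_field_derivative_at_within)
      qed (use Y d in \<open>auto simp: dist_real_def\<close>)
      then show ?case using Y(1)[of i] by (simp add: abs_divide divide_le_eq)
    qed
  qed (use meas' in auto)
  then have "(\<lambda>i. ((\<integral>w. f (R0 + Y i) w \<partial>M) - (\<integral>w. f R0 w \<partial>M)) / Y i) \<longlonglongrightarrow> (\<integral>w. f' R0 w \<partial>M)"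
    by (simp add: Bochner_Integration.integral_diff[OF intY int0])
  then have "(\<lambda>i. ((\<lambda>h. ((\<integral>w. f (R0 + h) w \<partial>M) - (\<integral>w. f R0 w \<partial>M)) / h) \<circ> X) (i + N))
      \<longlonglongrightarrow> (\<integral>w. f' R0 w \<partial>M)"
    by (simp add: Y_def)
  then show "((\<lambda>h. ((\<integral>w. f (R0 + h) w \<partial>M) - (\<integral>w. f R0 w \<partial>M)) / h) \<circ> X) \<longlonglongrightarrow> (\<integral>w. f' R0 w \<partial>M)"
    by (rule LIMSEQ_offset)
qed

section \<open>The probability measures with density \<open>nu_density\<close>\<close>

definition nuM :: "real \<Rightarrow> real measure" where
  "nuM a = density lborel (\<lambda>u. ennreal (indicator {-1..1} u * nu_density a u))"

lemma nu_density_measurable [measurable]: "nu_density a \<in> borel_measurable borel"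
  unfolding nu_density_def[abs_def] by measurable

lemma nu_density_nonneg: "a > 0 \<Longrightarrow> 0 \<le> nu_density a u"
  by (simp add: nu_density_def)

lemma sets_nuM [measurable_cong, simp]: "sets (nuM a) = sets borel"
  by (simp add: nuM_def)

lemma space_nuM [simp]: "space (nuM a) = UNIV"
  by (simp add: nuM_def)

text \<open>The Beta integral under the affine map x = (u + 1)/2, where 1 - u^2 becomes 4x(1 - x).
  That the constant is right is Legendre's duplication formula.\<close>

lemma nu_density_has_integral:
  assumes a: "a > 0"
  shows "(nu_density a has_integral 1) {-1..1}"
proof -
  have "((\<lambda>u. (((1/2) *\<^sub>R u + 1/2) powr (a - 1) * (1 - ((1/2) *\<^sub>R u + 1/2)) powr (a - 1)))
      has_integral (Beta a a /\<^sub>R (1/2) ^ DIM(real))) (cbox ((0 - 1/2) /\<^sub>R (1/2)) ((1 - 1/2) /\<^sub>R (1/2)))"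
    using has_integral_Beta_real[OF a a] by (intro has_integral_affinity') auto
  then have 1: "((\<lambda>u. ((1/2) * u + 1/2) powr (a - 1) * (1 - ((1/2) * u + 1/2)) powr (a - 1))
      has_integral (2 * Beta a a)) {-1..1}"
    by (simp add: mult.commute)
  define K where "K = Gamma (a + 1/2) / (sqrt pi * Gamma a)"
  have h1: "((\<lambda>u. K * 4 powr (a - 1) * (((1/2) * u + 1/2) powr (a - 1) * (1 - ((1/2) * u + 1/2)) powr (a - 1)))
      has_integral (K * 4 powr (a - 1) * (2 * Beta a a))) {-1..1}"
    by (rule has_integral_mult_right[OF 1])
  have h2: "K * 4 powr (a - 1) * (2 * Beta a a) = 1"
  proof -
    have nz: "complex_of_real a \<notin> \<int>\<^sub>\<le>\<^sub>0" "complex_of_real a + 1/2 \<notin> \<int>\<^sub>\<le>\<^sub>0"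
      using a by (auto elim!: nonpos_Ints_cases simp: complex_eq_iff)
    have "complex_of_real (Gamma a * Gamma (a + 1/2))
        = complex_of_real (exp ((1 - 2 * a) * ln 2) * sqrt pi * Gamma (2 * a))"
      using Gamma_legendre_duplication[OF nz]
      by (simp add: Gamma_complex_of_real[symmetric] exp_of_real[symmetric])
    then have leg: "Gamma a * Gamma (a + 1/2) = exp ((1 - 2 * a) * ln 2) * sqrt pi * Gamma (2 * a)"
      by (simp only: of_real_eq_iff)
    have "(4::real) powr (a - 1) = exp ((a - 1) * ln 4)" by (simp add: powr_def)
    also have "ln (4::real) = 2 * ln 2" using ln_realpow[of 2 2] by simp
    finally have "(4::real) powr (a - 1) * (2 * exp ((1 - 2 * a) * ln 2)) = exp ((a - 1) * (2 * ln 2)) * (exp (ln 2) * exp ((1 - 2 * a) * ln 2))"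
      by simp
    also have "\<dots> = 1"
      by (simp add: exp_add[symmetric] del: exp_ln) (simp add: algebra_simps)
    finally have p: "(4::real) powr (a - 1) * (2 * exp ((1 - 2 * a) * ln 2)) = 1" .
    have pos: "Gamma a > 0" "Gamma (2 * a) > 0" "sqrt pi > 0" using a by auto
    have "K * 4 powr (a - 1) * (2 * Beta a a) = (Gamma a * Gamma (a + 1/2)) * 4 powr (a - 1) * 2 / (sqrt pi * Gamma (2 * a))"
      using pos by (simp add: K_def Beta_def field_simps)
    also have "\<dots> = (4::real) powr (a - 1) * (2 * exp ((1 - 2 * a) * ln 2))"
      unfolding leg using pos by (simp add: field_simps)
    finally show ?thesis using p by simp
  qed
  have h3: "K * 4 powr (a - 1) * (((1/2) * u + 1/2) powr (a - 1) * (1 - ((1/2) * u + 1/2)) powr (a - 1)) = nu_density a u"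
    if "u \<in> {-1..1}" for u
  proof -
    have "4 * (((1/2) * u + 1/2) * (1 - ((1/2) * u + 1/2))) = 1 - u\<^sup>2"
      by (simp add: field_simps power2_eq_square)
    moreover have "4 powr (a - 1) * (((1/2) * u + 1/2) powr (a - 1) * (1 - ((1/2) * u + 1/2)) powr (a - 1))
        = (4 * (((1/2) * u + 1/2) * (1 - ((1/2) * u + 1/2)))) powr (a - 1)"
      using that by (subst powr_mult, simp, simp, subst powr_mult) auto
    ultimately show ?thesis unfolding nu_density_def K_def by (simp only: mult.assoc)
  qed
  show ?thesis using has_integral_eq[OF h3 h1] unfolding h2 .
qed

lemma emeasure_nuM: "a > 0 \<Longrightarrow> emeasure (nuM a) UNIV = 1"
proof -
  assume a: "a > 0"
  have "emeasure (nuM a) UNIV = (\<integral>\<^sup>+u. ennreal (indicator {-1..1} u * nu_density a u) \<partial>lborel)"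
    by (simp add: nuM_def emeasure_density)
  also have "\<dots> = 1"
    using nn_integral_has_integral_lebesgue[OF _ nu_density_has_integral[OF a]] nu_density_nonneg[OF a] by simp
  finally show ?thesis .
qed

lemma finite_measure_nuM: "a > 0 \<Longrightarrow> finite_measure (nuM a)"
  by (intro finite_measureI) (simp add: emeasure_nuM)

lemma AE_nuM: "AE u in nuM a. u \<in> {-1..1}"
  unfolding nuM_def by (subst AE_density) (auto simp: indicator_def)

lemma LINT_nuM:
  fixes f :: "real \<Rightarrow> real"
  assumes a: "a > 0" and [measurable]: "f \<in> borel_measurable borel"
  shows "(LINT u|nuM a. f u) = (LINT u:{-1..1}|lborel. nu_density a u * f u)"
  unfolding nuM_def set_lebesgue_integral_def using nu_density_nonneg[OF a]
  by (subst integral_density) (auto simp: mult_ac)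

lemma integrable_nuM:
  fixes f :: "real \<Rightarrow> real"
  assumes a: "a > 0" and f: "f \<in> borel_measurable borel" and B: "\<And>u. u \<in> {-1..1} \<Longrightarrow> \<bar>f u\<bar> \<le> B"
  shows "integrable (nuM a) f"
proof -
  interpret finite_measure "nuM a" by (rule finite_measure_nuM[OF a])
  show ?thesis
  proof (rule integrable_const_bound[where B = B])
    show "AE u in nuM a. norm (f u) \<le> B"
      using AE_nuM[of a] by (rule eventually_mono) (use B in auto)
  qed (use f in simp)
qed

lemma LINT_nuM_uminus:
  fixes f :: "real \<Rightarrow> real"
  assumes a: "a > 0" and [measurable]: "f \<in> borel_measurable borel"
  shows "(LINT u|nuM a. f (- u)) = (LINT u|nuM a. f u)"
proof -
  have "(LINT u|nuM a. f u) = (LINT u|lborel. indicator {-1..1} u * (nu_density a u * f u))"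
    by (simp add: LINT_nuM[OF a] set_lebesgue_integral_def)
  also have "\<dots> = (LINT u|lborel. indicator {-1..1} (0 + (-1) * u) * (nu_density a (0 + (-1) * u) * f (0 + (-1) * u)))"
    by (subst lborel_integral_real_affine[where c = "-1" and t = 0]) auto
  also have "\<dots> = (LINT u|lborel. indicator {-1..1} u * (nu_density a u * f (- u)))"
    by (intro Bochner_Integration.integral_cong) (auto simp: indicator_def nu_density_def)
  also have "\<dots> = (LINT u|nuM a. f (- u))"
    by (subst LINT_nuM[OF a]) (auto simp: set_lebesgue_integral_def)
  finally show ?thesis by simp
qed

text \<open>The density times the integrand is the derivative of a constant times
  \<open>(1 - u\<^sup>2) powr a * f u\<close>. The boundary terms vanish because
  \<open>a > 0\<close>, also where the density itself is unbounded at the endpoints.\<close>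

lemma nuM_by_parts:
  fixes f f' :: "real \<Rightarrow> real"
  assumes a: "a > 0" and [measurable]: "f \<in> borel_measurable borel" "f' \<in> borel_measurable borel"
    and deriv: "\<And>u. u \<in> {-1..1} \<Longrightarrow> (f has_real_derivative f' u) (at u)"
    and cont': "continuous_on {-1..1} f'"
  shows "(LINT u|nuM a. - 2 * a * u * f u + (1 - u\<^sup>2) * f' u) = 0"
proof -
  define K where "K = Gamma (a + 1/2) / (sqrt pi * Gamma a)"
  define g where "g u = - 2 * a * u * f u + (1 - u\<^sup>2) * f' u" for u
  have [measurable]: "g \<in> borel_measurable borel" unfolding g_def[abs_def] by measurable
  have cont: "continuous_on {-1..1} f"
    using deriv by (meson DERIV_continuous_on has_field_derivative_at_within)
  have "continuous_on {-1..1} g" unfolding g_def by (intro continuous_intros cont cont')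
  then have "bounded (g ` {-1..1})" by (intro compact_imp_bounded compact_continuous_image) auto
  then obtain B where "\<forall>y\<in>g ` {-1..1}. norm y \<le> B" unfolding bounded_iff by blast
  then have B: "\<bar>g u\<bar> \<le> B" if "u \<in> {-1..1}" for u using that by simp
  have "integrable (nuM a) g" by (rule integrable_nuM[OF a _ B]) auto
  then have "set_integrable lborel {-1..1} (\<lambda>u. nu_density a u * g u)"
    unfolding nuM_def set_integrable_def using nu_density_nonneg[OF a]
    by (subst (asm) integrable_density) (auto simp: mult_ac)
  note int = set_borel_integral_eq_integral(2)[OF this]
  have "((\<lambda>u. nu_density a u * g u) has_integral (K * ((1 - 1\<^sup>2) powr a * f 1) - K * ((1 - (-1)\<^sup>2) powr a * f (-1)))) {-1..1}"
  proof (rule fundamental_theorem_of_calculus_interior)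
    have "continuous_on {-1..1} (\<lambda>u::real. (1 - u\<^sup>2) powr a)"
      using a by (intro continuous_on_powr') (auto intro!: continuous_intros simp: abs_square_le_1 abs_le_iff)
    then show "continuous_on {-1..1} (\<lambda>u. K * ((1 - u\<^sup>2) powr a * f u))"
      by (intro continuous_on_mult continuous_on_const cont)
    fix u :: real assume u: "u \<in> {-1<..<1}"
    then have pos: "1 - u\<^sup>2 > 0" by (simp add: abs_square_less_1 abs_less_iff)
    have "((\<lambda>u. K * ((1 - u\<^sup>2) powr a * f u)) has_real_derivative
        K * ((a * (1 - u\<^sup>2) powr (a - 1) * (- (2 * u))) * f u + (1 - u\<^sup>2) powr a * f' u)) (at u)"
      using pos u deriv[of u]
      by (auto intro!: derivative_eq_intros simp: powr_diff field_simps)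
    also have "(1 - u\<^sup>2) powr a = (1 - u\<^sup>2) powr (a - 1) * (1 - u\<^sup>2)"
      using pos by (simp add: powr_diff)
    also have "K * ((a * (1 - u\<^sup>2) powr (a - 1) * (- (2 * u))) * f u + (1 - u\<^sup>2) powr (a - 1) * (1 - u\<^sup>2) * f' u)
        = nu_density a u * g u"
      unfolding nu_density_def K_def[symmetric] g_def by (simp add: algebra_simps)
    finally show "((\<lambda>u. K * ((1 - u\<^sup>2) powr a * f u)) has_vector_derivative nu_density a u * g u) (at u)"
      by (simp add: has_real_derivative_iff_has_vector_derivative)
  qed simp
  then have "integral {-1..1} (\<lambda>u. nu_density a u * g u) = 0"
    by (simp add: integral_unique)
  then show ?thesis using int LINT_nuM[OF a, of g] by (simp add: g_def)
qed

section \<open>The two-variable Gegenbauer integral\<close>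

definition nu2 :: "real \<Rightarrow> real \<Rightarrow> (real \<times> real) measure" where
  "nu2 a b = nuM a \<Otimes>\<^sub>M nuM b"

lemma sets_nu2 [measurable_cong, simp]: "sets (nu2 a b) = sets (borel \<Otimes>\<^sub>M borel)"
  unfolding nu2_def by (rule sets_pair_measure_cong) simp_all

text \<open>\<open>fst x\<close> is u and \<open>snd x\<close> is v. When \<open>p\<close> and
  \<open>s\<close> are the products of the cosines and of the sines, the bracket is
  \<open>xi_uv\<close>.\<close>

definition gen :: "real \<Rightarrow> real \<Rightarrow> real \<Rightarrow> real \<times> real \<Rightarrow> real" where
  "gen p s R x = 1 - 2 * R * (snd x * p + fst x * s) + R\<^sup>2"

lemma gen_measurable [measurable]: "gen p s R \<in> borel_measurable (borel \<Otimes>\<^sub>M borel)"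
  unfolding gen_def[abs_def] by measurable

text \<open>The bound on \<open>p\<close> and \<open>s\<close> keeps vp + us in [-1,1], and it is
  invariant under separate sign changes of \<open>p\<close> and \<open>s\<close>, which is what the
  reflections of the group will cause.\<close>

locale gegenbauer_kernel =
  fixes a b p s :: real
  assumes a: "a > 0" and b: "b > 0" and ps: "\<bar>p\<bar> + \<bar>s\<bar> \<le> 1"
begin

sublocale A: finite_measure "nuM a" by (rule finite_measure_nuM[OF a])
sublocale B: finite_measure "nuM b" by (rule finite_measure_nuM[OF b])
sublocale P: pair_sigma_finite "nuM a" "nuM b" ..

lemma finite_nu2: "finite_measure (nu2 a b)"
proof
  have "emeasure (nu2 a b) (UNIV \<times> UNIV) = emeasure (nuM a) UNIV * emeasure (nuM b) UNIV"
    unfolding nu2_def by (rule B.emeasure_pair_measure_Times) auto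
  then show "emeasure (nu2 a b) (space (nu2 a b)) \<noteq> \<infinity>"
    by (simp add: nu2_def space_pair_measure emeasure_nuM[OF a] emeasure_nuM[OF b])
qed

definition box :: "(real \<times> real) set" where "box = {-1..1} \<times> {-1..1}"

lemma AE_box: "AE x in nu2 a b. x \<in> box"
  unfolding nu2_def
proof (rule P.AE_pair_measure)
  have "box \<in> sets (nuM a \<Otimes>\<^sub>M nuM b)" unfolding box_def by (intro pair_measureI) auto
  then show "{x \<in> space (nuM a \<Otimes>\<^sub>M nuM b). x \<in> box} \<in> sets (nuM a \<Otimes>\<^sub>M nuM b)"
    by (simp add: space_pair_measure)
  show "AE x in nuM a. AE y in nuM b. (x, y) \<in> box"
    using AE_nuM[of a] by eventually_elim (use AE_nuM[of b] in \<open>eventually_elim, auto simp: box_def\<close>)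
qed

lemma integrable_nu2:
  fixes f :: "real \<times> real \<Rightarrow> real"
  assumes "f \<in> borel_measurable (borel \<Otimes>\<^sub>M borel)" and B: "\<And>x. x \<in> box \<Longrightarrow> \<bar>f x\<bar> \<le> B"
  shows "integrable (nu2 a b) f"
proof -
  interpret N: finite_measure "nu2 a b" by (rule finite_nu2)
  show ?thesis
  proof (rule N.integrable_const_bound[where B = B])
    show "AE x in nu2 a b. norm (f x) \<le> B"
      using AE_box by (rule eventually_mono) (use B in auto)
  qed (use assms(1) in simp)
qed

lemma LINT_nu2_cong:
  assumes "f \<in> borel_measurable (borel \<Otimes>\<^sub>M borel)" "g \<in> borel_measurable (borel \<Otimes>\<^sub>M borel)"
    and "\<And>x. x \<in> box \<Longrightarrow> f x = g x"
  shows "(LINT x|nu2 a b. f x) = (LINT x|nu2 a b. g x :: real)"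
  using AE_box assms by (intro integral_cong_AE) (auto elim!: eventually_mono)

lemma xi_bound: "x \<in> box \<Longrightarrow> \<bar>snd x * p + fst x * s\<bar> \<le> 1"
proof -
  assume "x \<in> box"
  then have "\<bar>snd x\<bar> \<le> 1" "\<bar>fst x\<bar> \<le> 1" by (auto simp: box_def)
  then have "\<bar>snd x * p\<bar> \<le> \<bar>p\<bar>" "\<bar>fst x * s\<bar> \<le> \<bar>s\<bar>"
    by (simp_all add: abs_mult mult_left_le_one_le)
  with ps show ?thesis by linarith
qed

lemma gen_lower: "x \<in> box \<Longrightarrow> (1 - \<bar>R\<bar>)\<^sup>2 \<le> gen p s R x"
proof -
  assume "x \<in> box"
  from xi_bound[OF this] have "R * (snd x * p + fst x * s) \<le> \<bar>R\<bar> * 1"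
    by (metis abs_ge_self abs_ge_zero abs_mult mult_left_mono order.trans)
  moreover have "\<bar>R\<bar> * \<bar>R\<bar> = R * R" by (rule abs_mult_self_eq)
  ultimately show ?thesis by (simp add: gen_def power2_eq_square algebra_simps)
qed

lemma gen_pos: "x \<in> box \<Longrightarrow> \<bar>R\<bar> < 1 \<Longrightarrow> gen p s R x > 0"
  using gen_lower[of x R] zero_less_power[of "1 - \<bar>R\<bar>" 2] by linarith

lemma gen_powr_bound:
  assumes "x \<in> box" "\<bar>R\<bar> \<le> r" "r < 1" "e \<le> 0"
  shows "\<bar>gen p s R x powr e\<bar> \<le> ((1 - r)\<^sup>2) powr e"
proof -
  have "(1 - r)\<^sup>2 \<le> (1 - \<bar>R\<bar>)\<^sup>2" using assms by (intro power_mono) auto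
  also have "\<dots> \<le> gen p s R x" by (rule gen_lower[OF assms(1)])
  finally have "gen p s R x powr e \<le> ((1 - r)\<^sup>2) powr e"
    using assms by (intro powr_mono2') auto
  then show ?thesis by simp
qed

lemma integrable_gen:
  assumes R: "\<bar>R\<bar> < 1" and e: "e \<le> 0" and [measurable]: "g \<in> borel_measurable (borel \<Otimes>\<^sub>M borel)"
    and B: "\<And>x. x \<in> box \<Longrightarrow> \<bar>g x\<bar> \<le> B"
  shows "integrable (nu2 a b) (\<lambda>x. g x * gen p s R x powr e)"
proof (rule integrable_nu2)
  show "\<bar>g x * gen p s R x powr e\<bar> \<le> B * ((1 - \<bar>R\<bar>)\<^sup>2) powr e" if "x \<in> box" for x
    unfolding abs_mult using B[OF that] gen_powr_bound[OF that order.refl R e]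
    by (intro mult_mono) auto
qed measurable

lemma integrable_gen_cont:
  assumes R: "\<bar>R\<bar> < 1" and e: "e \<le> 0" and h: "continuous_on box h" "h \<in> borel_measurable (borel \<Otimes>\<^sub>M borel)"
  shows "integrable (nu2 a b) (\<lambda>x. h x * gen p s R x powr e)"
proof -
  have "compact box" unfolding box_def by (intro compact_Times) auto
  then have "bounded (h ` box)" using h by (intro compact_imp_bounded compact_continuous_image)
  then obtain C where "\<forall>y\<in>h ` box. norm y \<le> C" unfolding bounded_iff by blast
  then have "\<bar>h x\<bar> \<le> C" if "x \<in> box" for x using that by simp
  then show ?thesis by (intro integrable_gen R e h)
qed

abbreviation lam :: real where "lam \<equiv> a + b"

text \<open>With the weight (1 + u)(1 + v) this is, up to the factor 1 - R^2, the Poisson kernel of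
  the group generated by two orthogonal reflections; the exponent is the sum \<open>lam\<close> of
  its two multiplicities plus 1.\<close>

definition Ik :: "(real \<times> real \<Rightarrow> real) \<Rightarrow> real \<Rightarrow> real" where
  "Ik g R = (LINT x|nu2 a b. g x * gen p s R x powr (- lam - 1))"

lemma lam_pos: "lam > 0" using a b by simp

lemma gen_deriv:
  assumes "x \<in> box" "\<bar>R\<bar> < 1"
  shows "((\<lambda>R. g x * gen p s R x powr (- lam - 1)) has_real_derivative
    g x * ((- lam - 1) * gen p s R x powr (- lam - 2) * (2 * R - 2 * (snd x * p + fst x * s)))) (at R)"
proof -
  have "((\<lambda>R. gen p s R x) has_real_derivative (2 * R - 2 * (snd x * p + fst x * s))) (at R)"
    unfolding gen_def by (auto intro!: derivative_eq_intros)
  moreover have "- lam - 1 - of_nat 1 = - lam - 2" by simp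
  ultimately show ?thesis
    using DERIV_fun_powr[of "\<lambda>R. gen p s R x" _ R "- lam - 1", OF _ gen_pos[OF assms]]
    by (intro DERIV_cmult) (simp only:)
qed

lemma Ik_deriv:
  assumes R: "\<bar>R\<bar> < 1" and [measurable]: "g \<in> borel_measurable (borel \<Otimes>\<^sub>M borel)"
    and B: "\<And>x. x \<in> box \<Longrightarrow> \<bar>g x\<bar> \<le> B"
  shows "(Ik g has_real_derivative (LINT x|nu2 a b. g x *
     ((- lam - 1) * gen p s R x powr (- lam - 2) * (2 * R - 2 * (snd x * p + fst x * s))))) (at R)"
  unfolding Ik_def
proof (rule has_derivative_LINT[OF finite_nu2])
  \<comment> \<open>Halfway between \<open>\<bar>R\<bar>\<close> and 1: within distance
    \<open>d\<close> of \<open>R\<close> the base of the power stays above the positive constant (1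
    - r)^2.\<close>
  define r where "r = (1 + \<bar>R\<bar>) / 2"
  define d where "d = (1 - \<bar>R\<bar>) / 2"
  show "d > 0" using R by (simp add: d_def)
  have rd: "\<bar>R'\<bar> \<le> r" "r < 1" if "\<bar>R' - R\<bar> < d" for R'
    using that R abs_triangle_ineq[of "R' - R" R] by (auto simp: d_def r_def)
  show "integrable (nu2 a b) (\<lambda>x. g x * gen p s R' x powr (- lam - 1))" if "\<bar>R' - R\<bar> < d" for R'
    using rd[OF that] B lam_pos by (intro integrable_gen) auto
  show "(\<lambda>x. g x * ((- lam - 1) * gen p s R x powr (- lam - 2) * (2 * R - 2 * (snd x * p + fst x * s))))
      \<in> borel_measurable (nu2 a b)"
    by measurable
  show "AE x in nu2 a b. \<forall>R'. \<bar>R' - R\<bar> < d \<longrightarrow>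
      ((\<lambda>R. g x * gen p s R x powr (- lam - 1)) has_real_derivative
        g x * ((- lam - 1) * gen p s R' x powr (- lam - 2) * (2 * R' - 2 * (snd x * p + fst x * s)))) (at R') \<and>
      \<bar>g x * ((- lam - 1) * gen p s R' x powr (- lam - 2) * (2 * R' - 2 * (snd x * p + fst x * s)))\<bar>
        \<le> B * ((lam + 1) * ((1 - r)\<^sup>2) powr (- lam - 2) * 4)"
    using AE_box
  proof (rule eventually_mono, intro allI impI conjI)
    fix x R' assume x: "x \<in> box" and R': "\<bar>R' - R\<bar> < d"
    note rd = rd[OF R']
    show "((\<lambda>R. g x * gen p s R x powr (- lam - 1)) has_real_derivative
        g x * ((- lam - 1) * gen p s R' x powr (- lam - 2) * (2 * R' - 2 * (snd x * p + fst x * s)))) (at R')"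
      using rd by (intro gen_deriv x) auto
    have "\<bar>gen p s R' x powr (- lam - 2)\<bar> \<le> ((1 - r)\<^sup>2) powr (- lam - 2)"
      using rd lam_pos by (intro gen_powr_bound x) auto
    moreover have "\<bar>2 * R' - 2 * (snd x * p + fst x * s)\<bar> \<le> 4"
    proof -
      have aux: "\<bar>2 * r - 2 * y\<bar> \<le> 4" if "\<bar>y\<bar> \<le> 1" "\<bar>r\<bar> \<le> 1" for r y :: real
        using that by (auto simp: abs_le_iff)
      show ?thesis using xi_bound[OF x] rd by (intro aux) auto
    qed
    moreover have "\<bar>- lam - 1\<bar> \<le> lam + 1" using lam_pos by simp
    moreover have "B \<ge> 0" using B[OF x] by linarith
    ultimately show "\<bar>g x * ((- lam - 1) * gen p s R' x powr (- lam - 2) * (2 * R' - 2 * (snd x * p + fst x * s)))\<bar>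
        \<le> B * ((lam + 1) * ((1 - r)\<^sup>2) powr (- lam - 2) * 4)"
      unfolding abs_mult using B[OF x] lam_pos
      by (intro mult_mono mult_nonneg_nonneg) auto
  qed
qed

text \<open>\<open>nuM_by_parts\<close> in u for the function
  \<open>gen p s R (u, v) powr (- lam - 1)\<close>, integrated over v with the weight 1 + v.\<close>

lemma by_parts_fst:
  assumes R: "\<bar>R\<bar> < 1"
  shows "(LINT x|nu2 a b. (1 + snd x) * (- 2 * a * fst x * gen p s R x powr (- lam - 1)
      + (1 - (fst x)\<^sup>2) * ((lam + 1) * (2 * R * s) * gen p s R x powr (- lam - 2)))) = 0" (is "(LINT x|_. ?f x) = 0")
proof -
  define F where "F = ?f"
  have "F = (\<lambda>x. ((1 + snd x) * (- 2 * a * fst x)) * gen p s R x powr (- lam - 1)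
      + ((1 + snd x) * ((1 - (fst x)\<^sup>2) * ((lam + 1) * (2 * R * s)))) * gen p s R x powr (- lam - 2))"
    unfolding F_def by (simp add: algebra_simps)
  moreover have "integrable (nu2 a b) \<dots>"
    using lam_pos by (intro Bochner_Integration.integrable_add integrable_gen_cont R) (auto intro!: continuous_intros)
  ultimately have intF: "integrable (nu2 a b) F" by (simp only:)
  then have [measurable]: "F \<in> borel_measurable (borel \<Otimes>\<^sub>M borel)"
    using borel_measurable_integrable by (simp cong: measurable_cong_sets)
  from intF have int: "integrable (nuM a \<Otimes>\<^sub>M nuM b) (\<lambda>(u, v). F (u, v))"
    by (simp add: nu2_def case_prod_eta)
  have "(LINT x|nu2 a b. F x) = (LINT v|nuM b. LINT u|nuM a. F (u, v))"
    using P.integral_snd[OF int] by (simp add: nu2_def)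
  also have "\<dots> = (LINT v|nuM b. 0)"
  proof (rule integral_cong_AE)
    show "AE v in nuM b. (LINT u|nuM a. F (u, v)) = 0"
      using AE_nuM[of b]
    proof (rule eventually_mono)
      fix v :: real assume v: "v \<in> {-1..1}"
      have "(LINT u|nuM a. - 2 * a * u * gen p s R (u, v) powr (- lam - 1)
          + (1 - u\<^sup>2) * ((lam + 1) * (2 * R * s) * gen p s R (u, v) powr (- lam - 2))) = 0"
      proof (rule nuM_by_parts[OF a])
        fix u :: real assume u: "u \<in> {-1..1}"
        have pos: "gen p s R (u, v) > 0" using u v R by (intro gen_pos) (auto simp: box_def)
        have "((\<lambda>u. gen p s R (u, v)) has_real_derivative - 2 * R * s) (at u)"
          unfolding gen_def by (auto intro!: derivative_eq_intros)
        from DERIV_fun_powr[OF this pos, of "- lam - 1"]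
        have "((\<lambda>u. gen p s R (u, v) powr (- lam - 1)) has_real_derivative
            (- lam - 1) * gen p s R (u, v) powr (- lam - 1 - of_nat 1) * (- 2 * R * s)) (at u)" .
        moreover have "- lam - 1 - of_nat 1 = - lam - 2" by simp
        moreover have "(- lam - 1) * P * (- 2 * R * s) = (lam + 1) * (2 * R * s) * P" for P
          by (simp add: algebra_simps)
        ultimately show "((\<lambda>u. gen p s R (u, v) powr (- lam - 1)) has_real_derivative
            (lam + 1) * (2 * R * s) * gen p s R (u, v) powr (- lam - 2)) (at u)"
          by (simp only:)
      next
        have "gen p s R (u, v) > 0" if "u \<in> {-1..1}" for u
          using that v R by (intro gen_pos) (auto simp: box_def)
        moreover have "continuous_on {-1..1} (\<lambda>u. gen p s R (u, v))"
          unfolding gen_def by (auto intro!: continuous_intros)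
        ultimately show "continuous_on {-1..1} (\<lambda>u. (lam + 1) * (2 * R * s) * gen p s R (u, v) powr (- lam - 2))"
          by (intro continuous_intros) force+
      qed measurable
      then show "(LINT u|nuM a. F (u, v)) = 0" by (simp add: F_def)
    qed
  qed (use P.borel_measurable_lebesgue_integral in measurable)
  finally show ?thesis by (simp add: F_def)
qed

text \<open>The situation is symmetric under exchanging the coordinates together with
  \<open>a\<close>, \<open>b\<close> and with \<open>p\<close>, \<open>s\<close>.\<close>

lemma by_parts_snd:
  assumes R: "\<bar>R\<bar> < 1"
  shows "(LINT x|nu2 a b. (1 + fst x) * (- 2 * b * snd x * gen p s R x powr (- lam - 1)
      + (1 - (snd x)\<^sup>2) * ((lam + 1) * (2 * R * p) * gen p s R x powr (- lam - 2)))) = 0" (is "(LINT x|_. ?f x) = 0")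
proof -
  interpret sw: gegenbauer_kernel b a s p by unfold_locales (use a b ps in auto)
  have "gen p s R (snd x, fst x) = gen s p R x" for x by (simp add: gen_def add.commute)
  then have "(LINT x|(nuM b \<Otimes>\<^sub>M nuM a). (\<lambda>(v, u). ?f (u, v)) x) = 0"
    using sw.by_parts_fst[OF R] by (simp add: nu2_def case_prod_beta' add.commute[of b a])
  moreover have "(LINT x|(nuM b \<Otimes>\<^sub>M nuM a). (\<lambda>(v, u). ?f (u, v)) x) = (LINT x|(nuM a \<Otimes>\<^sub>M nuM b). ?f x)"
    by (rule P.integral_product_swap) measurable
  ultimately show ?thesis by (simp add: nu2_def)
qed

lemma box_bounds:
  assumes "x \<in> box"
  shows "\<bar>1 + fst x\<bar> \<le> 2" "\<bar>1 - fst x\<bar> \<le> 2" "\<bar>1 + snd x\<bar> \<le> 2" "\<bar>1 - snd x\<bar> \<le> 2"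
  using assms by (auto simp: box_def abs_le_iff)

lemma box_prod_bounds:
  assumes "x \<in> box"
  shows "\<bar>(1 + fst x) * (1 + snd x)\<bar> \<le> 4" "\<bar>(1 - fst x) * (1 + snd x)\<bar> \<le> 4"
    "\<bar>(1 + fst x) * (1 - snd x)\<bar> \<le> 4" "\<bar>(1 - fst x) * (1 - snd x)\<bar> \<le> 4"
  using box_bounds[OF assms] mult_mono[of _ 2 _ 2] unfolding abs_mult by fastforce+

text \<open>The radial equation for $k = 1$: both sides differ by exact derivatives in $u$ and $v$.\<close>

lemma Ik_radial:
  assumes R: "\<bar>R\<bar> < 1"
  defines "N \<equiv> 1 - 2 * R * (p + s) + R\<^sup>2"
  shows "\<exists>I'. (Ik (\<lambda>x. (1 + fst x) * (1 + snd x)) has_real_derivative I') (at R) \<and>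
     lam * N * Ik (\<lambda>x. (1 + fst x) * (1 + snd x)) R
       + R * ((2 * R - 2 * (p + s)) * Ik (\<lambda>x. (1 + fst x) * (1 + snd x)) R + N * I')
     = (1 - R\<^sup>2) * (a * Ik (\<lambda>x. (1 - fst x) * (1 + snd x)) R + b * Ik (\<lambda>x. (1 + fst x) * (1 - snd x)) R)"
proof (intro exI conjI)
  let ?g = "\<lambda>x :: real \<times> real. (1 + fst x) * (1 + snd x)"
  let ?g1 = "\<lambda>x :: real \<times> real. (1 - fst x) * (1 + snd x)"
  let ?g2 = "\<lambda>x :: real \<times> real. (1 + fst x) * (1 - snd x)"
  let ?D = "\<lambda>x. gen p s R x"
  let ?P = "\<lambda>x. ?D x powr (- lam - 2)"
  let ?Q = "\<lambda>x. ?D x powr (- lam - 1)"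
  let ?g' = "\<lambda>x. ?g x * ((- lam - 1) * ?P x * (2 * R - 2 * (snd x * p + fst x * s)))"
  let ?B1 = "\<lambda>x. (1 + snd x) * (- 2 * a * fst x * ?Q x + (1 - (fst x)\<^sup>2) * ((lam + 1) * (2 * R * s) * ?P x))"
  let ?B2 = "\<lambda>x. (1 + fst x) * (- 2 * b * snd x * ?Q x + (1 - (snd x)\<^sup>2) * ((lam + 1) * (2 * R * p) * ?P x))"
  show "(Ik ?g has_real_derivative (LINT x|nu2 a b. ?g' x)) (at R)"
    using box_prod_bounds(1) by (intro Ik_deriv R) measurable
  have e: "- lam - 1 \<le> 0" "- lam - 2 \<le> 0" using lam_pos by auto
  have i0: "integrable (nu2 a b) (\<lambda>x. ?g x * ?Q x)" and i1: "integrable (nu2 a b) (\<lambda>x. ?g1 x * ?Q x)"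
    and i2: "integrable (nu2 a b) (\<lambda>x. ?g2 x * ?Q x)"
    using box_prod_bounds by (intro integrable_gen R e; measurable)+
  have i': "integrable (nu2 a b) ?g'"
  proof -
    have "integrable (nu2 a b) (\<lambda>x. (?g x * ((- lam - 1) * (2 * R - 2 * (snd x * p + fst x * s)))) * ?P x)"
      using e by (intro integrable_gen_cont R) (auto intro!: continuous_intros)
    then show ?thesis by (simp add: mult_ac)
  qed
  have iB1: "integrable (nu2 a b) ?B1"
  proof -
    have "integrable (nu2 a b) (\<lambda>x. ((1 + snd x) * (- 2 * a * fst x)) * ?Q x
        + ((1 + snd x) * ((1 - (fst x)\<^sup>2) * ((lam + 1) * (2 * R * s)))) * ?P x)"
      using e by (intro Bochner_Integration.integrable_add integrable_gen_cont R) (auto intro!: continuous_intros)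
    then show ?thesis by (simp only: distrib_left mult.assoc)
  qed
  have iB2: "integrable (nu2 a b) ?B2"
  proof -
    have "integrable (nu2 a b) (\<lambda>x. ((1 + fst x) * (- 2 * b * snd x)) * ?Q x
        + ((1 + fst x) * ((1 - (snd x)\<^sup>2) * ((lam + 1) * (2 * R * p)))) * ?P x)"
      using e by (intro Bochner_Integration.integrable_add integrable_gen_cont R) (auto intro!: continuous_intros)
    then show ?thesis by (simp only: distrib_left mult.assoc)
  qed
  have "lam * N * Ik ?g R + R * ((2 * R - 2 * (p + s)) * Ik ?g R + N * (LINT x|nu2 a b. ?g' x))
      = (LINT x|nu2 a b. (lam * N + R * (2 * R - 2 * (p + s))) * (?g x * ?Q x) + R * N * ?g' x)"
  proof -
    define G where "G = (LINT x|nu2 a b. ?g' x)"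
    have "(LINT x|nu2 a b. (lam * N + R * (2 * R - 2 * (p + s))) * (?g x * ?Q x) + R * N * ?g' x)
        = (lam * N + R * (2 * R - 2 * (p + s))) * Ik ?g R + R * N * G"
      unfolding Ik_def G_def
      by (subst Bochner_Integration.integral_add[OF integrable_mult_right[OF i0] integrable_mult_right[OF i']])
        (simp only: integral_mult_right_zero)
    then show ?thesis unfolding G_def[symmetric] by (simp add: algebra_simps)
  qed
  \<comment> \<open>The expressions \<open>?B1\<close> and \<open>?B2\<close> have integral 0;
    subtracting them makes the two sides agree pointwise.\<close>
  also have "\<dots> = (LINT x|nu2 a b. (1 - R\<^sup>2) * (a * (?g1 x * ?Q x) + b * (?g2 x * ?Q x) - ?B1 x - ?B2 x))"
  proof (rule LINT_nu2_cong)
    fix x assume x: "x \<in> box"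
    define u v P D where "u = fst x" and "v = snd x" and "P = ?P x" and "D = ?D x"
    \<comment> \<open>One power of the base is split off, so that the claim is a polynomial identity
      times the common power \<open>P\<close>.\<close>
    have Q: "?Q x = D * P"
      using gen_pos[OF x R] powr_add[of "?D x" 1 "- lam - 2"] by (simp add: D_def P_def)
    have D: "D = 1 - 2 * R * (v * p + u * s) + R\<^sup>2" by (simp add: D_def gen_def u_def v_def)
    show "(lam * N + R * (2 * R - 2 * (p + s))) * (?g x * ?Q x) + R * N * ?g' x
      = (1 - R\<^sup>2) * (a * (?g1 x * ?Q x) + b * (?g2 x * ?Q x) - ?B1 x - ?B2 x)"
      unfolding Q u_def[symmetric] v_def[symmetric] P_def[symmetric] N_def D by algebra
  qed measurable
  also have "\<dots> = (1 - R\<^sup>2) * (a * Ik ?g1 R + b * Ik ?g2 R - (LINT x|nu2 a b. ?B1 x) - (LINT x|nu2 a b. ?B2 x))"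
    unfolding Ik_def
    by (simp only: integral_mult_right_zero Bochner_Integration.integral_add Bochner_Integration.integral_diff
        Bochner_Integration.integrable_add Bochner_Integration.integrable_diff integrable_mult_right i1 i2 iB1 iB2)
  also have "\<dots> = (1 - R\<^sup>2) * (a * Ik ?g1 R + b * Ik ?g2 R)"
    unfolding by_parts_fst[OF R] by_parts_snd[OF R] by simp
  finally show "lam * N * Ik ?g R + R * ((2 * R - 2 * (p + s)) * Ik ?g R + N * (LINT x|nu2 a b. ?g' x))
     = (1 - R\<^sup>2) * (a * Ik ?g1 R + b * Ik ?g2 R)" .
qed

section \<open>Sign changes in the two variables\<close>

lemma LINT_nu2_flip_fst:
  fixes f :: "real \<times> real \<Rightarrow> real"
  assumes f [measurable]: "f \<in> borel_measurable (borel \<Otimes>\<^sub>M borel)" and B: "\<And>x. x \<in> box \<Longrightarrow> \<bar>f x\<bar> \<le> B"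
  shows "(LINT x|nu2 a b. f (- fst x, snd x)) = (LINT x|nu2 a b. f x)"
proof -
  have 1: "integrable (nuM a \<Otimes>\<^sub>M nuM b) (\<lambda>(u, v). f (u, v))"
    using integrable_nu2[OF f B] by (simp add: nu2_def case_prod_eta)
  have "integrable (nu2 a b) (\<lambda>x. f (- fst x, snd x))"
    by (rule integrable_nu2[OF _ B]) (auto simp: box_def)
  then have 2: "integrable (nuM a \<Otimes>\<^sub>M nuM b) (\<lambda>(u, v). f (- u, v))"
    by (simp add: nu2_def case_prod_beta')
  have "(LINT v|nuM b. LINT u|nuM a. f (- u, v)) = (LINT v|nuM b. LINT u|nuM a. f (u, v))"
    by (intro Bochner_Integration.integral_cong refl LINT_nuM_uminus[OF a, of "\<lambda>u. f (u, _)"]) simp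
  then show ?thesis
    using P.integral_snd[OF 1] P.integral_snd[OF 2] by (simp add: nu2_def case_prod_beta')
qed

lemma LINT_nu2_flip_snd:
  fixes f :: "real \<times> real \<Rightarrow> real"
  assumes f [measurable]: "f \<in> borel_measurable (borel \<Otimes>\<^sub>M borel)" and B: "\<And>x. x \<in> box \<Longrightarrow> \<bar>f x\<bar> \<le> B"
  shows "(LINT x|nu2 a b. f (fst x, - snd x)) = (LINT x|nu2 a b. f x)"
proof -
  have 1: "integrable (nuM a \<Otimes>\<^sub>M nuM b) (\<lambda>(u, v). f (u, v))"
    using integrable_nu2[OF f B] by (simp add: nu2_def case_prod_eta)
  have "integrable (nu2 a b) (\<lambda>x. f (fst x, - snd x))"
    by (rule integrable_nu2[OF _ B]) (auto simp: box_def)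
  then have 2: "integrable (nuM a \<Otimes>\<^sub>M nuM b) (\<lambda>(u, v). f (u, - v))"
    by (simp add: nu2_def case_prod_beta')
  have "(LINT u|nuM a. LINT v|nuM b. f (u, - v)) = (LINT u|nuM a. LINT v|nuM b. f (u, v))"
    by (intro Bochner_Integration.integral_cong refl LINT_nuM_uminus[OF b, of "\<lambda>v. f (_, v)"]) simp
  then show ?thesis
    using P.integral_fst[OF 1] P.integral_fst[OF 2] by (simp add: nu2_def case_prod_beta')
qed

lemma gen_integrand_bound:
  assumes "\<bar>R\<bar> < 1" "\<And>x. x \<in> box \<Longrightarrow> \<bar>g x\<bar> \<le> B" "x \<in> box"
  shows "\<bar>g x * gen p s R x powr (- lam - 1)\<bar> \<le> B * ((1 - \<bar>R\<bar>)\<^sup>2) powr (- lam - 1)"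
  unfolding abs_mult using assms(2)[OF assms(3)] gen_powr_bound[OF assms(3) order.refl assms(1)] lam_pos
  by (intro mult_mono) auto

text \<open>Changing the sign of \<open>s\<close> in the base amounts to changing the sign of u, and
  the measure is even in u. The weight keeps the trace of this change.\<close>

lemma Ik_flip_fst:
  assumes "\<bar>R\<bar> < 1" and [measurable]: "g \<in> borel_measurable (borel \<Otimes>\<^sub>M borel)"
    and B: "\<And>x. x \<in> box \<Longrightarrow> \<bar>g x\<bar> \<le> B"
  shows "gegenbauer_kernel.Ik a b p (- s) g R = Ik (\<lambda>x. g (- fst x, snd x)) R"
proof -
  interpret m: gegenbauer_kernel a b p "- s" using a b ps by unfold_locales auto
  have "m.Ik g R = (LINT x|nu2 a b. g (- fst x, snd x) * gen p (- s) R (- fst x, snd x) powr (- lam - 1))"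
    unfolding m.Ik_def
    using m.gen_integrand_bound[OF assms(1) B]
    by (intro m.LINT_nu2_flip_fst[symmetric, where f = "\<lambda>x. g x * gen p (- s) R x powr (- lam - 1)"]) measurable
  then show ?thesis by (simp add: Ik_def gen_def)
qed

lemma Ik_flip_snd:
  assumes "\<bar>R\<bar> < 1" and [measurable]: "g \<in> borel_measurable (borel \<Otimes>\<^sub>M borel)"
    and B: "\<And>x. x \<in> box \<Longrightarrow> \<bar>g x\<bar> \<le> B"
  shows "gegenbauer_kernel.Ik a b (- p) s g R = Ik (\<lambda>x. g (fst x, - snd x)) R"
proof -
  interpret m: gegenbauer_kernel a b "- p" s using a b ps by unfold_locales auto
  have "m.Ik g R = (LINT x|nu2 a b. g (fst x, - snd x) * gen (- p) s R (fst x, - snd x) powr (- lam - 1))"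
    unfolding m.Ik_def
    using m.gen_integrand_bound[OF assms(1) B]
    by (intro m.LINT_nu2_flip_snd[symmetric, where f = "\<lambda>x. g x * gen (- p) s R x powr (- lam - 1)"]) measurable
  then show ?thesis by (simp add: Ik_def gen_def)
qed

end

section \<open>Poisson kernel sums and products over roots of unity\<close>

lemma cis_root_power: "k > 0 \<Longrightarrow> cis (2 * pi * real i / real k) ^ k = 1"
proof -
  assume "k > 0"
  then have "real k * (2 * pi * real i / real k) = 2 * pi * real i" by simp
  then show ?thesis unfolding Complex.DeMoivre using cis_multiple_2pi[of "real i"] by simp
qed

text \<open>Over the common denominator \<open>1 - z ^ k\<close> each term is a geometric sum;
  summation over the roots of unity keeps only the exponent 0.\<close>

lemma sum_inverse_one_minus_roots:
  assumes k: "k > 0" and z: "cmod z < 1"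
  shows "(\<Sum>i<k. 1 / (1 - z * cis (2 * pi * real i / real k))) = of_nat k / (1 - z ^ k)"
proof -
  let ?w = "\<lambda>i. cis (2 * pi * real i / real k)"
  have zk: "1 - z ^ k \<noteq> 0"
    using z k power_less_one_iff[of "cmod z" k] by (auto simp: norm_power[symmetric])
  have tm: "1 / (1 - z * ?w i) = (\<Sum>m<k. z ^ m * ?w m ^ i) / (1 - z ^ k)" for i
  proof -
    have sw: "?w i ^ m = ?w m ^ i" for m by (simp add: Complex.DeMoivre mult_ac)
    have "1 - (z * ?w i) ^ k = (1 - z * ?w i) * (\<Sum>m<k. (z * ?w i) ^ m)"
      by (rule one_diff_power_eq)
    then have "1 - z ^ k = (1 - z * ?w i) * (\<Sum>m<k. z ^ m * ?w m ^ i)"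
      by (simp add: power_mult_distrib cis_root_power[OF k] sw)
    with zk show ?thesis by (auto simp: field_simps)
  qed
  have geo: "(\<Sum>i<k. ?w m ^ i) = (if m = 0 then of_nat k else 0)" if "m < k" for m
  proof (cases "m = 0")
    case False
    have "?w m \<noteq> ?w 0"
      using inj_onD[OF bij_betw_imp_inj_on[OF Complex.bij_betw_roots_unity[OF k]], of m 0] that False k by auto
    then have "?w m \<noteq> 1" by simp
    then show ?thesis
      using geometric_sum[of "?w m" k] False by (simp add: cis_root_power[OF k])
  qed simp
  have "(\<Sum>i<k. 1 / (1 - z * ?w i)) = (\<Sum>i<k. \<Sum>m<k. z ^ m * ?w m ^ i) / (1 - z ^ k)"
    by (simp only: tm sum_divide_distrib)
  also have "(\<Sum>i<k. \<Sum>m<k. z ^ m * ?w m ^ i) = (\<Sum>m<k. z ^ m * (\<Sum>i<k. ?w m ^ i))"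
    by (subst sum.swap) (simp add: sum_distrib_left)
  also have "\<dots> = (\<Sum>m<k. if m = 0 then of_nat k else 0)"
    by (intro sum.cong) (auto simp: geo)
  also have "\<dots> = of_nat k" using k by simp
  finally show ?thesis .
qed

text \<open>X^k - 1 is squarefree, hence the product over its roots; this is evaluated at 1/z and
  multiplied by \<open>z ^ k\<close>.\<close>

lemma prod_one_minus_roots:
  assumes k: "k > 0"
  shows "(\<Prod>i<k. 1 - z * cis (2 * pi * real i / real k)) = 1 - z ^ k"
proof (cases "z = 0")
  case True
  then show ?thesis using k by simp
next
  case False
  define p :: "complex poly" where "p = monom 1 k - 1"
  have deg: "degree (monom 1 k :: complex poly) = k" by (simp add: degree_monom_eq)
  have "degree p = k" unfolding p_def
    by (subst diff_conv_add_uminus, subst degree_add_eq_left) (use k deg in auto)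
  then have lead: "lead_coeff p = 1" using k by (simp add: p_def)
  have p_eval: "poly p x = x ^ k - 1" for x by (simp add: p_def poly_monom)
  have "rsquarefree p"
    unfolding rsquarefree_roots
  proof (intro allI notI)
    fix x assume x: "poly p x = 0 \<and> poly (pderiv p) x = 0"
    have "poly (pderiv p) x = of_nat k * x ^ (k - 1)"
      by (simp add: p_def pderiv_diff pderiv_monom poly_monom)
    with x k have "x = 0" by auto
    with x k show False by (simp add: p_eval power_0_left)
  qed
  from complex_poly_decompose_rsquarefree[OF this]
  have "p = (\<Prod>x | poly p x = 0. [:- x, 1:])" using lead by simp
  then have "poly p (1 / z) = poly (\<Prod>x | poly p x = 0. [:- x, 1:]) (1 / z)" by (rule arg_cong)
  also have "\<dots> = (\<Prod>x | x ^ k = 1. 1 / z - x)"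
    by (simp add: poly_prod p_eval)
  also have "\<dots> = (\<Prod>i<k. 1 / z - cis (2 * pi * real i / real k))"
    by (rule prod.reindex_bij_betw[OF Complex.bij_betw_roots_unity[OF k], symmetric])
  finally have e: "1 / z ^ k - 1 = (\<Prod>i<k. 1 / z - cis (2 * pi * real i / real k))"
    by (simp add: p_eval power_divide)
  have "(\<Prod>i<k. 1 - z * cis (2 * pi * real i / real k))
      = (\<Prod>i<k. z * (1 / z - cis (2 * pi * real i / real k)))"
    using False by (simp add: right_diff_distrib)
  also have "\<dots> = z ^ k * (1 / z ^ k - 1)"
    by (simp only: prod.distrib prod_constant card_lessThan e)
  finally show ?thesis using False by (simp add: right_diff_distrib)
qed

lemma norm_one_minus_sq:
  assumes "cmod t = 1"
  shows "(cmod (1 - of_real r * t))\<^sup>2 = 1 - 2 * r * Re t + r\<^sup>2"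
proof -
  have "Re t * Re t + Im t * Im t = 1"
    using assms by (simp add: cmod_def power2_eq_square)
  moreover have "(cmod (1 - of_real r * t))\<^sup>2 = 1 - 2 * r * Re t + r\<^sup>2 * (Re t * Re t + Im t * Im t)"
    unfolding cmod_power2 by (simp add: power2_eq_square algebra_simps)
  ultimately show ?thesis by simp
qed

lemma poisson_denom_pos:
  assumes "cmod t = 1" "\<bar>r\<bar> < 1"
  shows "1 - 2 * r * Re t + r\<^sup>2 > 0"
proof -
  have "cmod (of_real r * t) < 1" using assms by (simp add: norm_mult)
  then have "1 - of_real r * t \<noteq> 0" by auto
  then show ?thesis unfolding norm_one_minus_sq[OF assms(1), symmetric] by simp
qed

lemma poisson_kernel_eq:
  assumes t: "cmod t = 1" and r: "\<bar>r\<bar> < 1"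
  shows "2 * Re (1 / (1 - of_real r * t)) - 1 = (1 - r\<^sup>2) / (1 - 2 * r * Re t + r\<^sup>2)"
proof -
  note pos = poisson_denom_pos[OF t r]
  have "Re (1 / (1 - of_real r * t)) = (1 - r * Re t) / (1 - 2 * r * Re t + r\<^sup>2)"
    unfolding norm_one_minus_sq[OF t, symmetric] by (simp add: Re_divide cmod_power2)
  then show ?thesis using pos by (simp add: field_simps)
qed

text \<open>The reason for the change of variable in the generating function: a factor linear in the
  inner product becomes a Poisson denominator up to \<open>1 + r\<^sup>2\<close>, where
  \<open>r\<close> is already the new parameter.\<close>

lemma poisson_shift:
  assumes t: "cmod t = 1" and r: "\<bar>r\<bar> < 1"
  shows "1 - 2 * r / (1 + r\<^sup>2) * Re t = (1 - 2 * r * Re t + r\<^sup>2) / (1 + r\<^sup>2)"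
proof -
  have "1 + r\<^sup>2 > 0" by (simp add: add_pos_nonneg)
  then show ?thesis by (simp add: field_simps)
qed

text \<open>Each term is a multiple of a Poisson kernel, which is affine in the real part of a
  Cauchy kernel. The sum over the roots of unity is therefore again a Poisson kernel, at radius
  \<open>r ^ k\<close> and point \<open>t ^ k\<close>.\<close>

lemma sum_poisson:
  assumes k: "k > 0" and t: "cmod t = 1" and r: "\<bar>r\<bar> < 1"
  shows "(\<Sum>i<k. 1 / (1 - 2 * r / (1 + r\<^sup>2) * Re (t * cis (2 * pi * real i / real k))))
    = real k * (1 + r\<^sup>2) * (1 - (r ^ k)\<^sup>2) / ((1 - r\<^sup>2) * (1 - 2 * r ^ k * Re (t ^ k) + (r ^ k)\<^sup>2))"
proof -
  let ?w = "\<lambda>i. cis (2 * pi * real i / real k)"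
  have tw: "cmod (t * ?w i) = 1" for i using t by (simp add: norm_mult)
  have tk: "cmod (t ^ k) = 1" using t by (simp add: norm_power)
  have rk: "\<bar>r ^ k\<bar> < 1" using r k by (simp add: power_abs power_less_one_iff)
  have r1: "1 - r\<^sup>2 > 0" using r by (simp add: abs_square_less_1)
  have pos: "1 + r\<^sup>2 > 0" by (simp add: add_pos_nonneg)
  have "1 / (1 - 2 * r / (1 + r\<^sup>2) * Re (t * ?w i))
      = (1 + r\<^sup>2) / (1 - r\<^sup>2) * (2 * Re (1 / (1 - of_real r * t * ?w i)) - 1)" for i
    unfolding poisson_shift[OF tw r] using poisson_kernel_eq[OF tw r, of i] poisson_denom_pos[OF tw r, of i] r1 pos
    by (simp add: mult.assoc)
  then have "(\<Sum>i<k. 1 / (1 - 2 * r / (1 + r\<^sup>2) * Re (t * ?w i)))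
      = (1 + r\<^sup>2) / (1 - r\<^sup>2) * (2 * Re (\<Sum>i<k. 1 / (1 - of_real r * t * ?w i)) - real k)"
    by (simp only: sum_distrib_left[symmetric] sum_subtractf Re_sum) simp
  also have "(\<Sum>i<k. 1 / (1 - of_real r * t * ?w i)) = of_nat k * (1 / (1 - of_real (r ^ k) * t ^ k))"
    using sum_inverse_one_minus_roots[OF k, of "of_real r * t"] r t
    by (simp add: norm_mult power_mult_distrib)
  also have "2 * Re (of_nat k * (1 / (1 - of_real (r ^ k) * t ^ k))) - real k
      = real k * (2 * Re (1 / (1 - of_real (r ^ k) * t ^ k)) - 1)"
  proof -
    have "2 * Re (of_nat k * z) - real k = real k * (2 * Re z - 1)" for z :: complex
      by (simp add: algebra_simps)
    then show ?thesis .
  qed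
  also have "\<dots> = real k * ((1 - (r ^ k)\<^sup>2) / (1 - 2 * r ^ k * Re (t ^ k) + (r ^ k)\<^sup>2))"
    by (subst poisson_kernel_eq[OF tk rk]) simp
  finally show ?thesis by simp
qed

lemma prod_poisson:
  assumes k: "k > 0" and t: "cmod t = 1" and r: "\<bar>r\<bar> < 1"
  shows "(\<Prod>i<k. 1 - 2 * r / (1 + r\<^sup>2) * Re (t * cis (2 * pi * real i / real k)))
    = (1 - 2 * r ^ k * Re (t ^ k) + (r ^ k)\<^sup>2) / (1 + r\<^sup>2) ^ k"
proof -
  let ?w = "\<lambda>i. cis (2 * pi * real i / real k)"
  have tw: "cmod (t * ?w i) = 1" for i using t by (simp add: norm_mult)
  have tk: "cmod (t ^ k) = 1" using t by (simp add: norm_power)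
  have "1 - 2 * r / (1 + r\<^sup>2) * Re (t * ?w i) = (cmod (1 - of_real r * t * ?w i))\<^sup>2 / (1 + r\<^sup>2)" for i
    unfolding poisson_shift[OF tw r] norm_one_minus_sq[OF tw, symmetric] by (simp only: mult.assoc)
  then have "(\<Prod>i<k. 1 - 2 * r / (1 + r\<^sup>2) * Re (t * ?w i))
      = (cmod (\<Prod>i<k. 1 - of_real r * t * ?w i))\<^sup>2 / (1 + r\<^sup>2) ^ k"
    by (simp only: prod_dividef prod_constant card_lessThan prod_norm prod_power_distrib[symmetric])
  also have "(\<Prod>i<k. 1 - of_real r * t * ?w i) = 1 - of_real (r ^ k) * t ^ k"
    by (simp add: prod_one_minus_roots[OF k] power_mult_distrib)
  finally show ?thesis by (simp only: norm_one_minus_sq[OF tk])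
qed

section \<open>The generating function in closed form\<close>

context dihedral
begin

lemma c_power: "c i ^ k = (if even i then 1 else -1)"
proof -
  have "c i ^ k = cis (real_of_int i * pi)"
    unfolding c_def Complex.DeMoivre using k_pos by simp
  also have "\<dots> = (if even i then 1 else -1)"
  proof (cases "even i")
    case True
    then obtain m where "i = 2 * m" by (elim evenE)
    then show ?thesis using cis_multiple_2pi[of "real_of_int m"] by (simp add: mult_ac)
  next
    case False
    then obtain m where "i = 2 * m + 1" by (elim oddE)
    then have "real_of_int i * pi = 2 * pi * real_of_int m + pi" by (simp add: algebra_simps)
    then show ?thesis using cis_multiple_2pi[of "real_of_int m"] False by (simp add: cis_mult[symmetric])
  qed
  finally show ?thesis .
qed

lemma c_even: "c (2 * int i) = cis (2 * pi * real i / real k)"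
  by (simp add: c_def mult_ac)

lemma rot_power: "rot j x ^ k = (if even j then x ^ k else - (x ^ k))"
  by (simp add: rot_def power_mult_distrib c_power)

lemma rfl_power: "rfl j x ^ k = (if even j then cnj (x ^ k) else - cnj (x ^ k))"
  by (simp add: rfl_def power_mult_distrib c_power)

definition pp :: "complex \<Rightarrow> complex \<Rightarrow> real" where "pp x y = Re (x ^ k) * Re (y ^ k)"
definition ss :: "complex \<Rightarrow> complex \<Rightarrow> real" where "ss x y = Im (x ^ k) * Im (y ^ k)"

lemma pp_ss_kernel:
  assumes "cmod x = 1" "cmod y = 1"
  shows "gegenbauer_kernel a b (pp x y) (ss x y)"
proof
  define X Y where "X = x ^ k" and "Y = y ^ k"
  have "cmod X = 1" "cmod Y = 1" using assms by (simp_all add: X_def Y_def norm_power)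
  then have "\<bar>Re X\<bar> * \<bar>Re X\<bar> + \<bar>Im X\<bar> * \<bar>Im X\<bar> = 1" "\<bar>Re Y\<bar> * \<bar>Re Y\<bar> + \<bar>Im Y\<bar> * \<bar>Im Y\<bar> = 1"
    by (simp_all add: cmod_def power2_eq_square)
  moreover have "2 * \<bar>Re X\<bar> * \<bar>Re Y\<bar> \<le> \<bar>Re X\<bar>\<^sup>2 + \<bar>Re Y\<bar>\<^sup>2" "2 * \<bar>Im X\<bar> * \<bar>Im Y\<bar> \<le> \<bar>Im X\<bar>\<^sup>2 + \<bar>Im Y\<bar>\<^sup>2"
    by (rule sum_squares_bound)+
  ultimately have "\<bar>Re X\<bar> * \<bar>Re Y\<bar> + \<bar>Im X\<bar> * \<bar>Im Y\<bar> \<le> 1"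
    unfolding power2_eq_square by linarith
  then show "\<bar>pp x y\<bar> + \<bar>ss x y\<bar> \<le> 1" by (simp add: pp_def ss_def X_def Y_def abs_mult)
qed (use a b in auto)

definition Jk :: "(real \<times> real \<Rightarrow> real) \<Rightarrow> complex \<Rightarrow> complex \<Rightarrow> real \<Rightarrow> real" where
  "Jk g y x R = gegenbauer_kernel.Ik a b (pp x y) (ss x y) g R"

definition rr :: "real \<Rightarrow> real" where "rr t = 2 * t / (1 + t\<^sup>2)"

text \<open>For unit vectors this is the squared modulus of
  \<open>1 - R * x ^ k * cnj (y ^ k)\<close>, that is, \<open>gen\<close> at u = v = 1.\<close>

definition Nk :: "complex \<Rightarrow> complex \<Rightarrow> real \<Rightarrow> real" where
  "Nk y x R = 1 - 2 * R * (pp x y + ss x y) + R\<^sup>2"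

text \<open>The four weights arise from \<open>wpp\<close> by sign changes of u and v, and they add
  up to 4.\<close>

abbreviation "wpp \<equiv> \<lambda>x :: real \<times> real. (1 + fst x) * (1 + snd x)"
abbreviation "wmp \<equiv> \<lambda>x :: real \<times> real. (1 - fst x) * (1 + snd x)"
abbreviation "wpm \<equiv> \<lambda>x :: real \<times> real. (1 + fst x) * (1 - snd x)"
abbreviation "wmm \<equiv> \<lambda>x :: real \<times> real. (1 - fst x) * (1 - snd x)"

text \<open>The argument \<open>t\<close> is the Poisson radius $\rho$ with \<open>rr t\<close> $= 2\rho/(1+\rho^2)$; up to elementary factors
  the closed form is the Poisson kernel of $I_2$ at $(x^k, y^k)$.\<close>

definition Qk :: "complex \<Rightarrow> complex \<Rightarrow> real \<Rightarrow> real" where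
  "Qk y x t = (1 + t\<^sup>2) powr (real k * (a + b)) * (Nk y x (t ^ k) * Jk wpp y x (t ^ k))"

definition Sclosed :: "complex \<Rightarrow> real \<Rightarrow> complex \<Rightarrow> real" where
  "Sclosed y t x = Qk y x t / (1 - rr t * (x \<bullet> y))"

lemma Jk_flips:
  assumes x: "cmod x = 1" and y: "cmod y = 1" and R: "\<bar>R\<bar> < 1"
  shows "gegenbauer_kernel.Ik a b (pp x y) (- ss x y) wpp R = Jk wmp y x R"
    and "gegenbauer_kernel.Ik a b (- pp x y) (ss x y) wpp R = Jk wpm y x R"
    and "gegenbauer_kernel.Ik a b (- pp x y) (- ss x y) wpp R = Jk wmm y x R"
proof -
  interpret g: gegenbauer_kernel a b "pp x y" "ss x y" by (rule pp_ss_kernel[OF x y])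
  interpret g': gegenbauer_kernel a b "pp x y" "- ss x y"
    by unfold_locales (use a b g.ps in auto)
  show "gegenbauer_kernel.Ik a b (pp x y) (- ss x y) wpp R = Jk wmp y x R"
    using g.Ik_flip_fst[OF R, of wpp 4] g.box_prod_bounds(1) by (simp add: Jk_def)
  show "gegenbauer_kernel.Ik a b (- pp x y) (ss x y) wpp R = Jk wpm y x R"
    using g.Ik_flip_snd[OF R, of wpp 4] g.box_prod_bounds(1) by (simp add: Jk_def)
  have "gegenbauer_kernel.Ik a b (- pp x y) (- ss x y) wpp R = g'.Ik wpm R"
    using g'.Ik_flip_snd[OF R, of wpp 4] g'.box_prod_bounds(1) by simp
  also have "\<dots> = Jk wmm y x R"
    using g.Ik_flip_fst[OF R, of wpm 4] g.box_prod_bounds(3) by (simp add: Jk_def)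
  finally show "gegenbauer_kernel.Ik a b (- pp x y) (- ss x y) wpp R = Jk wmm y x R" .
qed

lemma inner_Re: "x \<bullet> y = Re (x * cnj y)"
  by (simp add: inner_complex_def)

lemma pow_lt_1: "\<bar>t\<bar> < 1 \<Longrightarrow> \<bar>t ^ k\<bar> < (1 :: real)"
  by (simp add: power_abs power_less_one_iff)

text \<open>The common factor of all coset sums of \<open>Sclosed\<close>. It is free of the points,
  because \<open>Nk\<close> cancels in such a sum.\<close>

definition Ck :: "real \<Rightarrow> real" where
  "Ck t = (1 + t\<^sup>2) powr (real k * (a + b)) * (real k * (1 + t\<^sup>2) * (1 - (t ^ k)\<^sup>2) / (1 - t\<^sup>2))"

text \<open>Within a coset of the even rotations the k-th powers are constant, so only the
  denominator of \<open>Sclosed\<close> varies, through all k-th roots of unity. The resulting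
  Poisson sum has \<open>Nk\<close> in its denominator, which is why the closed form carries
  \<open>Nk\<close> in front.\<close>

lemma sum_Sclosed_coset:
  assumes t: "\<bar>t\<bar> < 1" and u: "cmod u = 1"
    and in_eq: "\<And>i. i < k \<Longrightarrow> X i \<bullet> Y i = Re (u * cis (2 * pi * real i / real k))"
    and pp: "\<And>i. i < k \<Longrightarrow> pp (X i) (Y i) = p" and ss: "\<And>i. i < k \<Longrightarrow> ss (X i) (Y i) = s"
    and u_pow: "Re (u ^ k) = p + s"
  shows "(\<Sum>i<k. Sclosed (Y i) t (X i)) = Ck t * gegenbauer_kernel.Ik a b p s wpp (t ^ k)"
proof -
  let ?w = "\<lambda>i. cis (2 * pi * real i / real k)"
  define Q where "Q = (1 + t\<^sup>2) powr (real k * (a + b)) * ((1 - 2 * t ^ k * (p + s) + (t ^ k)\<^sup>2)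
    * gegenbauer_kernel.Ik a b p s wpp (t ^ k))"
  have "(\<Sum>i<k. Sclosed (Y i) t (X i)) = (\<Sum>i<k. Q * (1 / (1 - rr t * Re (u * ?w i))))"
    by (intro sum.cong) (auto simp: Sclosed_def Qk_def Nk_def Jk_def Q_def in_eq pp ss)
  also have "\<dots> = Q * (\<Sum>i<k. 1 / (1 - rr t * Re (u * ?w i)))"
    by (simp only: sum_distrib_left)
  also have "\<dots> = Q * (real k * (1 + t\<^sup>2) * (1 - (t ^ k)\<^sup>2)
      / ((1 - t\<^sup>2) * (1 - 2 * t ^ k * (p + s) + (t ^ k)\<^sup>2)))"
    unfolding rr_def by (simp only: sum_poisson[OF k_pos(1) u t] u_pow)
  also have "\<dots> = Ck t * gegenbauer_kernel.Ik a b p s wpp (t ^ k)"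
  proof -
    have "cmod (u ^ k) = 1" using u by (simp add: norm_power)
    from poisson_denom_pos[OF this pow_lt_1[OF t]] have "1 - 2 * t ^ k * (p + s) + (t ^ k)\<^sup>2 > 0"
      by (simp add: u_pow)
    then have nz: "1 - 2 * t ^ k * (p + s) + (t ^ k)\<^sup>2 \<noteq> 0" by simp
    have "W * (n * I) * (z / (q * n)) = W * (z / q) * I" if "n \<noteq> 0" for W n I z q :: real
      using that by simp
    from this[OF nz] show ?thesis unfolding Q_def Ck_def .
  qed
  finally show ?thesis .
qed

text \<open>A reflection conjugates the k-th power, with a further sign if its index is odd. Even
  indices thus flip \<open>ss\<close> and odd ones flip \<open>pp\<close>, and these flips move into
  the weights.\<close>

lemma sum_kappa_Sclosed:
  assumes x: "cmod x = 1" and y: "cmod y = 1" and t: "\<bar>t\<bar> < 1"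
  shows "(\<Sum>j<2*k. kappa (int j) * Sclosed y t (rfl (int j) x)) = Ck t * (a * Jk wmp y x (t ^ k) + b * Jk wpm y x (t ^ k))"
proof -
  have "(\<Sum>i<k. Sclosed y t (rfl (2 * int i) x)) = Ck t * gegenbauer_kernel.Ik a b (pp x y) (- ss x y) wpp (t ^ k)"
  proof (rule sum_Sclosed_coset[OF t, where u = "cnj x * cnj y"])
    show "cmod (cnj x * cnj y) = 1" using x y by (simp add: norm_mult)
    show "rfl (2 * int i) x \<bullet> y = Re (cnj x * cnj y * cis (2 * pi * real i / real k))" for i
      unfolding inner_Re rfl_def c_even by (simp only: mult_ac)
    show "Re ((cnj x * cnj y) ^ k) = pp x y + - ss x y"
      by (simp add: power_mult_distrib pp_def ss_def flip: complex_cnj_power)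
  qed (auto simp: pp_def ss_def rfl_power simp del: complex_cnj_power)
  moreover have "(\<Sum>i<k. Sclosed y t (rfl (2 * int i + 1) x)) = Ck t * gegenbauer_kernel.Ik a b (- pp x y) (ss x y) wpp (t ^ k)"
  proof (rule sum_Sclosed_coset[OF t, where u = "cnj x * cnj y * c 1"])
    show "cmod (cnj x * cnj y * c 1) = 1" using x y by (simp add: norm_mult)
    show "rfl (2 * int i + 1) x \<bullet> y = Re (cnj x * cnj y * c 1 * cis (2 * pi * real i / real k))" for i
      unfolding inner_Re rfl_def c_add c_even by (simp only: mult_ac)
    show "Re ((cnj x * cnj y * c 1) ^ k) = - pp x y + ss x y"
      by (simp add: power_mult_distrib pp_def ss_def c_power flip: complex_cnj_power)
  qed (auto simp: pp_def ss_def rfl_power simp del: complex_cnj_power)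
  ultimately show ?thesis
    using sum_kappa_split[of "\<lambda>j. Sclosed y t (rfl j x)"] Jk_flips(1,2)[OF x y pow_lt_1[OF t]]
    by (simp add: algebra_simps)
qed

text \<open>The radial equation of \<open>Ik\<close> pulled back along R = t^k, where t d/dt is k R
  d/dR. The power of 1 + t^2 in \<open>Qk\<close> turns the coefficient k(a + b)(1 + t^2) of the
  undifferentiated term into k(a + b)(1 - t^2).\<close>

lemma Qk_deriv:
  assumes x: "cmod x = 1" and y: "cmod y = 1" and t: "\<bar>t\<bar> < 1"
  shows "\<exists>Q'. (Qk y x has_real_derivative Q') (at t) \<and>
    t * (1 + t\<^sup>2) * Q' + real k * (a + b) * (1 - t\<^sup>2) * Qk y x t
      = (1 - t\<^sup>2) * (\<Sum>j<2*k. kappa (int j) * Sclosed y t (rfl (int j) x))"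
proof -
  interpret g: gegenbauer_kernel a b "pp x y" "ss x y" by (rule pp_ss_kernel[OF x y])
  define R where "R = t ^ k"
  have R: "\<bar>R\<bar> < 1" unfolding R_def by (rule pow_lt_1[OF t])
  define I where "I = Jk wpp y x R"
  obtain I' where I': "(Jk wpp y x has_real_derivative I') (at R)"
    and eq: "(a + b) * Nk y x R * I + R * ((2 * R - 2 * (pp x y + ss x y)) * I + Nk y x R * I')
     = (1 - R\<^sup>2) * (a * Jk wmp y x R + b * Jk wpm y x R)"
    using g.Ik_radial[OF R] unfolding Jk_def[abs_def] Nk_def I_def by blast
  define W where "W = (1 + t\<^sup>2) powr (real k * (a + b))"
  define G where "G = (2 * R - 2 * (pp x y + ss x y)) * I + Nk y x R * I'"
  have pos: "1 + t\<^sup>2 > 0" by (simp add: add_pos_nonneg)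
  have dW: "((\<lambda>t. (1 + t\<^sup>2) powr (real k * (a + b))) has_real_derivative
      real k * (a + b) * (2 * t) * W / (1 + t\<^sup>2)) (at t)"
    using pos unfolding W_def
    by (auto intro!: derivative_eq_intros simp: powr_diff)
  have dN: "((\<lambda>R. Nk y x R * Jk wpp y x R) has_real_derivative G) (at R)"
    unfolding Nk_def G_def I_def
    by (auto intro!: derivative_eq_intros I' simp: Nk_def)
  have dP: "((\<lambda>t. t ^ k) has_real_derivative (real k * t ^ (k - 1))) (at t)"
    by (auto intro!: derivative_eq_intros)
  have dNt: "((\<lambda>t. Nk y x (t ^ k) * Jk wpp y x (t ^ k)) has_real_derivative G * (real k * t ^ (k - 1))) (at t)"
    using DERIV_chain2[OF dN[unfolded R_def] dP] by (simp add: R_def)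
  have dQ: "(Qk y x has_real_derivative
      (real k * (a + b) * (2 * t) * W / (1 + t\<^sup>2)) * (Nk y x R * I) + (G * (real k * t ^ (k - 1))) * W) (at t)"
    unfolding Qk_def[abs_def] using DERIV_mult[OF dW dNt] by (simp add: W_def R_def I_def)
  show ?thesis
  proof (intro exI conjI)
    have tk: "t * t ^ (k - 1) = R" unfolding R_def using k_pos by (metis power_eq_if mult.commute not_gr0)
    have "t * (1 + t\<^sup>2) * ((real k * (a + b) * (2 * t) * W / (1 + t\<^sup>2)) * (Nk y x R * I) + (G * (real k * t ^ (k - 1))) * W)
        = real k * (a + b) * 2 * t\<^sup>2 * W * (Nk y x R * I) + (1 + t\<^sup>2) * G * real k * (t * t ^ (k - 1)) * W"
      using pos by (simp add: field_simps power2_eq_square)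
    then have "t * (1 + t\<^sup>2) * ((real k * (a + b) * (2 * t) * W / (1 + t\<^sup>2)) * (Nk y x R * I) + (G * (real k * t ^ (k - 1))) * W)
        + real k * (a + b) * (1 - t\<^sup>2) * (W * (Nk y x R * I))
        = W * real k * (1 + t\<^sup>2) * ((a + b) * Nk y x R * I + R * G)"
      unfolding tk by (simp add: algebra_simps)
    also have "\<dots> = W * real k * (1 + t\<^sup>2) * ((1 - R\<^sup>2) * (a * Jk wmp y x R + b * Jk wpm y x R))"
      unfolding G_def eq ..
    also have "\<dots> = (1 - t\<^sup>2) * (Ck t * (a * Jk wmp y x R + b * Jk wpm y x R))"
    proof -
      have "1 - t\<^sup>2 > 0" using t by (simp add: abs_square_less_1)
      then show ?thesis by (simp add: Ck_def W_def R_def)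
    qed
    finally show "t * (1 + t\<^sup>2) * ((real k * (a + b) * (2 * t) * W / (1 + t\<^sup>2)) * (Nk y x R * I) + (G * (real k * t ^ (k - 1))) * W)
        + real k * (a + b) * (1 - t\<^sup>2) * Qk y x t
        = (1 - t\<^sup>2) * (\<Sum>j<2*k. kappa (int j) * Sclosed y t (rfl (int j) x))"
      by (simp add: sum_kappa_Sclosed[OF x y t] Qk_def W_def R_def I_def)
  qed (rule dQ)
qed

lemma rr_deriv: "(rr has_real_derivative 2 * (1 - t\<^sup>2) / (1 + t\<^sup>2)\<^sup>2) (at t)"
proof -
  have "1 + t\<^sup>2 > 0" by (simp add: add_pos_nonneg)
  then show ?thesis unfolding rr_def[abs_def]
    by (auto intro!: derivative_eq_intros simp: field_simps power2_eq_square)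
qed

lemma rr_bound: "\<bar>rr t\<bar> \<le> 2 * \<bar>t\<bar>"
proof -
  have "1 + t\<^sup>2 \<ge> 1" by simp
  then have "2 * \<bar>t\<bar> / (1 + t\<^sup>2) \<le> 2 * \<bar>t\<bar> / 1" by (intro frac_le) auto
  then show ?thesis by (simp add: rr_def abs_mult abs_divide)
qed

lemma rr_inner_lt_1:
  assumes x: "cmod x = 1" and y: "cmod y = 1" and t: "\<bar>t\<bar> < 1"
  shows "1 - rr t * (x \<bullet> y) > 0"
proof -
  have u: "cmod (x * cnj y) = 1" using x y by (simp add: norm_mult)
  have "1 - rr t * (x \<bullet> y) = (1 - 2 * t * Re (x * cnj y) + t\<^sup>2) / (1 + t\<^sup>2)"
    unfolding rr_def inner_Re by (rule poisson_shift[OF u t])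
  also have "\<dots> > 0"
    using poisson_denom_pos[OF u t] by (intro divide_pos_pos) (auto simp: add_pos_nonneg)
  finally show ?thesis .
qed

text \<open>The equation of \<open>Sser_deriv\<close> in the variable t in place of r =
  \<open>rr t\<close>: the operator r d/dr becomes t(1 + t^2)/(1 - t^2) d/dt, and the denominators
  are cleared.\<close>

lemma Sclosed_deriv:
  assumes x: "cmod x = 1" and y: "cmod y = 1" and t: "\<bar>t\<bar> < 1"
  shows "\<exists>S'. ((\<lambda>t. Sclosed y t x) has_real_derivative S') (at t) \<and>
    t * (1 + t\<^sup>2) * (1 - rr t * (x \<bullet> y)) * S'
      = (1 - t\<^sup>2) * ((real k * (a + b) + 1) * rr t * (x \<bullet> y) * Sclosed y t x - refl_diff (Sclosed y t) x)"
proof -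
  obtain Q' where dQ: "(Qk y x has_real_derivative Q') (at t)"
    and eq: "t * (1 + t\<^sup>2) * Q' + real k * (a + b) * (1 - t\<^sup>2) * Qk y x t
      = (1 - t\<^sup>2) * (\<Sum>j<2*k. kappa (int j) * Sclosed y t (rfl (int j) x))"
    using Qk_deriv[OF x y t] by blast
  define w where "w = 1 - rr t * (x \<bullet> y)"
  define r' where "r' = 2 * (1 - t\<^sup>2) / (1 + t\<^sup>2)\<^sup>2"
  define S where "S = Sclosed y t x"
  have w: "w > 0" unfolding w_def by (rule rr_inner_lt_1[OF x y t])
  have Q: "Qk y x t = w * S" using w by (simp add: S_def Sclosed_def w_def)
  have pos: "1 + t\<^sup>2 > 0" by (simp add: add_pos_nonneg)
  have "((\<lambda>t. Sclosed y t x) has_real_derivative (Q' * w - Qk y x t * (- (r' * (x \<bullet> y)))) / (w * w)) (at t)"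
    unfolding Sclosed_def w_def r'_def using w[unfolded w_def]
    by (auto intro!: derivative_eq_intros dQ rr_deriv)
  moreover have "(Q' * w - Qk y x t * (- (r' * (x \<bullet> y)))) / (w * w) = (Q' + r' * (x \<bullet> y) * S) / w"
    unfolding Q using w by (simp add: field_simps)
  ultimately have d: "((\<lambda>t. Sclosed y t x) has_real_derivative (Q' + r' * (x \<bullet> y) * S) / w) (at t)" by simp
  have tr: "t * (1 + t\<^sup>2) * r' = (1 - t\<^sup>2) * rr t"
  proof -
    have "t * D * (2 * z / D\<^sup>2) = z * (2 * t / D)" if "D \<noteq> 0" for D z
      using that by (simp add: power2_eq_square)
    moreover have "1 + t\<^sup>2 \<noteq> 0" using pos by simp
    ultimately show ?thesis unfolding r'_def rr_def by blast
  qed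
  have "t * (1 + t\<^sup>2) * w * ((Q' + r' * (x \<bullet> y) * S) / w) = t * (1 + t\<^sup>2) * Q' + (t * (1 + t\<^sup>2) * r') * ((x \<bullet> y) * S)"
    using w by (simp add: field_simps)
  also have "t * (1 + t\<^sup>2) * Q' = (1 - t\<^sup>2) * ((\<Sum>j<2*k. kappa (int j) * Sclosed y t (rfl (int j) x)) - real k * (a + b) * (w * S))"
    using eq unfolding Q by (simp add: algebra_simps)
  also have "(1 - t\<^sup>2) * ((\<Sum>j<2*k. kappa (int j) * Sclosed y t (rfl (int j) x)) - real k * (a + b) * (w * S))
      + (t * (1 + t\<^sup>2) * r') * ((x \<bullet> y) * S)
      = (1 - t\<^sup>2) * ((real k * (a + b) + 1) * rr t * (x \<bullet> y) * S - refl_diff (Sclosed y t) x)"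
    unfolding tr refl_diff_eq S_def[symmetric] w_def by (simp add: algebra_simps)
  finally show ?thesis using d unfolding w_def S_def by blast
qed

text \<open>At t = 0 only the mean of (1 + u)(1 + v) is left, and both measures are even probability
  measures.\<close>

lemma Sclosed_0:
  assumes x: "cmod x = 1" and y: "cmod y = 1"
  shows "Sclosed y 0 x = 1"
proof -
  interpret g: gegenbauer_kernel a b "pp x y" "ss x y" by (rule pp_ss_kernel[OF x y])
  have lin: "(LINT u|nuM d. 1 + u) = 1" if d: "d > 0" for d
  proof -
    interpret D: finite_measure "nuM d" by (rule finite_measure_nuM[OF d])
    have i: "integrable (nuM d) (\<lambda>u. u)" by (rule integrable_nuM[OF d, where B = 1]) auto
    have "(LINT u|nuM d. - u) = (LINT u|nuM d. u)" by (rule LINT_nuM_uminus[OF d]) simp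
    then have "(LINT u|nuM d. u) = 0" by simp
    moreover have "(LINT u|nuM d. (1 :: real)) = 1" by (simp add: measure_def emeasure_nuM[OF d])
    ultimately show ?thesis using i by simp
  qed
  have int: "integrable (nuM a \<Otimes>\<^sub>M nuM b) (\<lambda>(u, v). (1 + u) * (1 + v))"
    using g.integrable_nu2[of wpp 4] g.box_prod_bounds(1) by (simp add: nu2_def case_prod_beta')
  have "g.Ik wpp 0 = (LINT x|nu2 a b. wpp x)" by (simp add: g.Ik_def gen_def)
  also have "\<dots> = (LINT u|nuM a. LINT v|nuM b. (1 + u) * (1 + v))"
    using g.P.integral_fst[OF int] by (simp add: nu2_def case_prod_beta')
  also have "\<dots> = 1" using lin[OF a] lin[OF b] by simp
  finally have "Jk wpp y x 0 = 1" by (simp add: Jk_def)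
  then show ?thesis using k_pos by (simp add: Sclosed_def Qk_def Nk_def rr_def power_0_left)
qed

end

section \<open>The generating function as a power series\<close>

lemma pochhammer_binomial_sums:
  fixes z q :: real
  assumes "\<bar>z\<bar> < 1"
  shows "(\<lambda>n. pochhammer q n / fact n * z ^ n) sums (1 - z) powr (- q)"
proof -
  have "((- q) gchoose n) * (- z) ^ n = pochhammer q n / fact n * z ^ n" for n
    by (cases "even n") (simp_all add: gbinomial_pochhammer)
  then show ?thesis using gen_binomial_real[of "- z" "- q"] assms by simp
qed

context dihedral
begin

abbreviation cq :: real where "cq \<equiv> real k * (a + b) + 1"

lemma cq_pos: "cq > 0" using a b by (simp add: add_nonneg_pos)

definition scoef :: "complex \<Rightarrow> nat \<Rightarrow> complex \<Rightarrow> real" where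
  "scoef y n x = pochhammer cq n * Ecomp y n x"

definition Sser :: "complex \<Rightarrow> real \<Rightarrow> complex \<Rightarrow> real" where
  "Sser y r x = (\<Sum>n. scoef y n x * r ^ n)"

lemma scoef_bound:
  assumes "cmod x = 1" "cmod y = 1"
  shows "\<bar>scoef y n x\<bar> \<le> pochhammer cq n / fact n * 6 ^ n"
proof -
  have "pochhammer cq n \<ge> 0" using cq_pos by (simp add: pochhammer_nonneg)
  moreover have "\<bar>Ecomp y n x\<bar> \<le> 6 ^ n / fact n" using Ecomp_bound[of y n x] assms by simp
  ultimately show ?thesis
    unfolding scoef_def abs_mult using mult_left_mono[of "\<bar>Ecomp y n x\<bar>" "6 ^ n / fact n" "pochhammer cq n"] by simp
qed

text \<open>The radius 1/6 comes from the constant 6 of the resolvent bound; the pochhammer symbol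
  uses up the factorial that made the kernel entire. A neighbourhood of 0 is enough to compare
  coefficients.\<close>

lemma Sser_sums:
  assumes x: "cmod x = 1" and y: "cmod y = 1" and r: "\<bar>r\<bar> < 1/6"
  shows "(\<lambda>n. scoef y n x * r ^ n) sums Sser y r x"
proof -
  have "summable (\<lambda>n. pochhammer cq n / fact n * (6 * \<bar>r\<bar>) ^ n)"
    using pochhammer_binomial_sums[of "6 * \<bar>r\<bar>" cq] r by (auto simp: sums_iff)
  then have "summable (\<lambda>n. scoef y n x * r ^ n)"
  proof (rule summable_comparison_test[rotated], intro exI allI impI)
    fix n
    show "norm (scoef y n x * r ^ n) \<le> pochhammer cq n / fact n * (6 * \<bar>r\<bar>) ^ n"
      using mult_right_mono[OF scoef_bound[OF x y, of n], of "\<bar>r\<bar> ^ n"]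
      by (simp add: abs_mult power_abs power_mult_distrib mult_ac)
  qed
  then show ?thesis unfolding Sser_def by (rule summable_sums)
qed

lemma scoef_rec:
  "real (Suc n) * scoef y (Suc n) x + refl_diff (scoef y (Suc n)) x = (cq + real n) * (x \<bullet> y) * scoef y n x"
proof -
  have "real (Suc n) * scoef y (Suc n) x + refl_diff (scoef y (Suc n)) x
      = pochhammer cq (Suc n) * (real (Suc n) * Ecomp y (Suc n) x + refl_diff (Ecomp y (Suc n)) x)"
    unfolding scoef_def[abs_def] refl_diff_cmult by (simp only: algebra_simps)
  also have "\<dots> = (cq + real n) * (x \<bullet> y) * scoef y n x"
    unfolding Ecomp_rec scoef_def by (simp only: pochhammer_Suc mult_ac)
  finally show ?thesis .
qed

text \<open>The quotient \<open>cq + n\<close> of consecutive pochhammer weights is linear in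
  \<open>n\<close>, so the recursion of the components becomes a first-order equation; the part
  \<open>n\<close> yields a second derivative term, which gives the factor
  \<open>1 - r * (x \<bullet> y)\<close>.\<close>

lemma Sser_deriv:
  assumes x: "cmod x = 1" and y: "cmod y = 1" and r: "\<bar>r\<bar> < 1/6"
  shows "\<exists>S'. ((\<lambda>r. Sser y r x) has_real_derivative S') (at r) \<and>
    r * (1 - r * (x \<bullet> y)) * S' = cq * r * (x \<bullet> y) * Sser y r x - refl_diff (Sser y r) x"
proof -
  define K where "K = (\<bar>r\<bar> + 1/6) / 2"
  have K: "\<bar>K\<bar> < 1/6" "\<bar>r\<bar> < \<bar>K\<bar>" using r by (auto simp: K_def)
  have sK: "summable (\<lambda>n. scoef y n x * K ^ n)" using Sser_sums[OF x y K(1)] by (rule sums_summable)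
  define S' where "S' = (\<Sum>n. diffs (\<lambda>n. scoef y n x) n * r ^ n)"
  have d: "((\<lambda>r. Sser y r x) has_real_derivative S') (at r)"
    unfolding Sser_def S'_def using K by (intro termdiffs_strong[OF sK]) auto
  have sd: "(\<lambda>n. diffs (\<lambda>n. scoef y n x) n * r ^ n) sums S'"
    unfolding S'_def
  proof (intro summable_sums termdiff_converges[where K = "\<bar>K\<bar>"])
    show "summable (\<lambda>n. scoef y n x * q ^ n)" if "norm q < \<bar>K\<bar>" for q
      using that K by (intro sums_summable[OF Sser_sums[OF x y]]) auto
  qed (use K in simp)
  then have s1: "(\<lambda>n. real (Suc n) * scoef y (Suc n) x * r ^ n) sums S'"
    by (simp only: diffs_def)
  have sA: "(\<lambda>n. refl_diff (scoef y n) x * r ^ n) sums refl_diff (Sser y r) x"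
  proof -
    have "(\<lambda>n. \<Sum>j<2*k. kappa (int j) * (scoef y n x * r ^ n - scoef y n (rfl (int j) x) * r ^ n)) sums refl_diff (Sser y r) x"
      unfolding refl_diff_def using x y r by (intro sums_sum sums_mult sums_diff Sser_sums) auto
    then show ?thesis by (simp only: refl_diff_def sum_distrib_right left_diff_distrib mult.assoc)
  qed
  have "refl_diff (scoef y 0) x = 0" by (simp add: refl_diff_def scoef_def)
  with sA have sA': "(\<lambda>n. refl_diff (scoef y (Suc n)) x * r ^ Suc n) sums refl_diff (Sser y r) x"
    by (subst sums_Suc_iff) simp
  have L: "(\<lambda>n. r * (real (Suc n) * scoef y (Suc n) x * r ^ n) + refl_diff (scoef y (Suc n)) x * r ^ Suc n)
      sums (r * S' + refl_diff (Sser y r) x)"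
    by (intro sums_add sums_mult s1 sA')
  have s2: "(\<lambda>n. real n * scoef y n x * r ^ n) sums (r * S')"
  proof -
    have "(\<lambda>n. real (Suc n) * scoef y (Suc n) x * r ^ Suc n) sums (r * S')"
      using sums_mult[OF s1, of r] by (simp add: mult_ac)
    then show ?thesis using sums_Suc_iff[of "\<lambda>n. real n * scoef y n x * r ^ n" "r * S'"] by simp
  qed
  have Rh: "(\<lambda>n. (r * (x \<bullet> y)) * (cq * (scoef y n x * r ^ n) + real n * scoef y n x * r ^ n))
      sums ((r * (x \<bullet> y)) * (cq * Sser y r x + r * S'))"
    by (intro sums_mult sums_add s2 Sser_sums[OF x y r])
  have "r * (real (Suc n) * scoef y (Suc n) x * r ^ n) + refl_diff (scoef y (Suc n)) x * r ^ Suc n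
      = (r * (x \<bullet> y)) * (cq * (scoef y n x * r ^ n) + real n * scoef y n x * r ^ n)" for n
  proof -
    have "r * (real (Suc n) * scoef y (Suc n) x * r ^ n) + refl_diff (scoef y (Suc n)) x * r ^ Suc n
      = (real (Suc n) * scoef y (Suc n) x + refl_diff (scoef y (Suc n)) x) * r ^ Suc n"
      by (simp only: power_Suc ring_distribs mult_ac)
    also have "\<dots> = (cq + real n) * (x \<bullet> y) * scoef y n x * r ^ Suc n" unfolding scoef_rec ..
    finally show ?thesis by (simp add: algebra_simps)
  qed
  with L Rh have "r * S' + refl_diff (Sser y r) x = (r * (x \<bullet> y)) * (cq * Sser y r x + r * S')"
    by (simp add: sums_unique2)
  then have "r * (1 - r * (x \<bullet> y)) * S' = cq * r * (x \<bullet> y) * Sser y r x - refl_diff (Sser y r) x"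
    by (simp add: algebra_simps)
  with d show ?thesis by blast
qed

text \<open>The difference \<open>F\<close> solves a homogeneous equation in which the derivative
  carries the factor \<open>w\<close>, depending on the point of the orbit. Dividing by it would
  spoil the pairing with A. The energy is therefore weighted by \<open>w\<close>, so that
  \<open>F\<close> meets the product of \<open>w\<close> and the derivative, and positivity of A
  applies.\<close>

lemma Sser_eq_Sclosed:
  assumes x: "cmod x = 1" and y: "cmod y = 1" and t: "0 \<le> t" "t \<le> 1/13"
  shows "Sser y (rr t) x = Sclosed y t x"
proof -
  define F where "F t p = Sser y (rr t) p - Sclosed y t p" for t p
  define w where "w t p = 1 - rr t * (p \<bullet> y)" for t p
  \<comment> \<open>For \<open>\<bar>t\<bar> < 1/12\<close> the value \<open>rr t\<close> lies
    within the radius 1/6. The bound 1/13 of the claim leaves room for two-sided derivatives at its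
    endpoint.\<close>
  have dF: "\<exists>F'. ((\<lambda>t. F t p) has_real_derivative F') (at t) \<and>
      t * (1 + t\<^sup>2) * (w t p * F') = (1 - t\<^sup>2) * (cq * rr t * (p \<bullet> y) * F t p - refl_diff (F t) p)"
    if p: "cmod p = 1" and t: "\<bar>t\<bar> < 1/12" for t p
  proof -
    have rrt: "\<bar>rr t\<bar> < 1/6" using rr_bound[of t] t by linarith
    obtain S' where S': "((\<lambda>r. Sser y r p) has_real_derivative S') (at (rr t))"
      and eS: "rr t * (1 - rr t * (p \<bullet> y)) * S' = cq * rr t * (p \<bullet> y) * Sser y (rr t) p - refl_diff (Sser y (rr t)) p"
      using Sser_deriv[OF p y rrt] by blast
    obtain X' where X': "((\<lambda>t. Sclosed y t p) has_real_derivative X') (at t)"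
      and eX: "t * (1 + t\<^sup>2) * (1 - rr t * (p \<bullet> y)) * X'
        = (1 - t\<^sup>2) * (cq * rr t * (p \<bullet> y) * Sclosed y t p - refl_diff (Sclosed y t) p)"
      using Sclosed_deriv[OF p y, of t] t by auto
    define r' where "r' = 2 * (1 - t\<^sup>2) / (1 + t\<^sup>2)\<^sup>2"
    have "((\<lambda>t. F t p) has_real_derivative S' * r' - X') (at t)"
      unfolding F_def r'_def by (intro DERIV_diff X' DERIV_chain2[where f = "\<lambda>r. Sser y r p" and g = rr] S' rr_deriv)
    moreover have "t * (1 + t\<^sup>2) * (w t p * (S' * r' - X'))
        = (1 - t\<^sup>2) * (cq * rr t * (p \<bullet> y) * F t p - refl_diff (F t) p)"
    proof -
      have "1 + t\<^sup>2 > 0" by (simp add: add_pos_nonneg)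
      moreover have "t * D * (2 * z / D\<^sup>2) = z * (2 * t / D)" if "D > 0" for D z
        using that by (simp add: power2_eq_square)
      ultimately have tr: "t * (1 + t\<^sup>2) * r' = (1 - t\<^sup>2) * rr t" unfolding r'_def rr_def by blast
      have AF: "refl_diff (F t) p = refl_diff (Sser y (rr t)) p - refl_diff (Sclosed y t) p"
        unfolding refl_diff_def F_def by (simp add: sum_subtractf[symmetric] algebra_simps)
      have "t * (1 + t\<^sup>2) * (w t p * (S' * r' - X'))
          = (t * (1 + t\<^sup>2) * r') * (w t p * S') - t * (1 + t\<^sup>2) * w t p * X'"
        by (simp only: algebra_simps)
      also have "\<dots> = (1 - t\<^sup>2) * (rr t * w t p * S') - t * (1 + t\<^sup>2) * w t p * X'"
        unfolding tr by (simp only: mult_ac)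
      also have "\<dots> = (1 - t\<^sup>2) * (cq * rr t * (p \<bullet> y) * F t p - refl_diff (F t) p)"
        unfolding w_def eS eX AF unfolding F_def by (simp add: algebra_simps)
      finally show ?thesis .
    qed
    ultimately show ?thesis by blast
  qed
  define F' where "F' t p = (SOME D. ((\<lambda>t. F t p) has_real_derivative D) (at t) \<and>
      t * (1 + t\<^sup>2) * (w t p * D) = (1 - t\<^sup>2) * (cq * rr t * (p \<bullet> y) * F t p - refl_diff (F t) p))" for t p
  have F': "((\<lambda>t. F t p) has_real_derivative F' t p) (at t)"
    "t * (1 + t\<^sup>2) * (w t p * F' t p) = (1 - t\<^sup>2) * (cq * rr t * (p \<bullet> y) * F t p - refl_diff (F t) p)"
    if p: "cmod p = 1" and t: "\<bar>t\<bar> < 1/12" for t p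
    using someI_ex[OF dF[OF p t]] unfolding F'_def by blast+
  define r' where "r' t = 2 * (1 - t\<^sup>2) / (1 + t\<^sup>2)\<^sup>2" for t :: real
  define V where "V t = orbit_sum (\<lambda>p. w t p * (F t p)\<^sup>2) x" for t
  define V' where "V' t = orbit_sum (\<lambda>p. - (r' t * (p \<bullet> y)) * (F t p)\<^sup>2 + 2 * (F t p * (w t p * F' t p))) x" for t
  have dV: "(V has_real_derivative V' t) (at t)" if t: "\<bar>t\<bar> < 1/12" for t
  proof -
    have "((\<lambda>t. w t p * (F t p)\<^sup>2) has_real_derivative
        - (r' t * (p \<bullet> y)) * (F t p)\<^sup>2 + 2 * (F t p * (w t p * F' t p))) (at t)" if p: "cmod p = 1" for p
    proof -
      have "((\<lambda>t. w t p) has_real_derivative - (r' t * (p \<bullet> y))) (at t)"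
        unfolding w_def r'_def by (auto intro!: derivative_eq_intros rr_deriv)
      moreover have "((\<lambda>t. (F t p)\<^sup>2) has_real_derivative 2 * F t p * F' t p) (at t)"
        using DERIV_power[OF F'(1)[OF p t], of 2] by (simp add: mult_ac)
      ultimately have "((\<lambda>t. w t p * (F t p)\<^sup>2) has_real_derivative
          - (r' t * (p \<bullet> y)) * (F t p)\<^sup>2 + 2 * F t p * F' t p * w t p) (at t)"
        by (rule DERIV_mult)
      then show ?thesis by (simp only: mult_ac)
    qed
    then show ?thesis unfolding V_def V'_def orbit_sum_def using x by (intro DERIV_sum DERIV_add) auto
  qed
  have w_low: "w t p \<ge> 1/2" if p: "cmod p = 1" and t: "\<bar>t\<bar> \<le> 1/13" for t p
  proof -
    have "\<bar>p \<bullet> y\<bar> \<le> 1" using Cauchy_Schwarz_ineq2[of p y] p y by simp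
    then have "\<bar>rr t * (p \<bullet> y)\<bar> \<le> (2 * \<bar>t\<bar>) * 1"
      unfolding abs_mult using rr_bound[of t] by (intro mult_mono) auto
    then show ?thesis unfolding w_def using t by linarith
  qed
  have V_low: "V t \<ge> 1/2 * orbit_sum (\<lambda>p. (F t p)\<^sup>2) x" if "\<bar>t\<bar> \<le> 1/13" for t
    unfolding V_def orbit_sum_cmult[symmetric] unfolding orbit_sum_def
    using w_low[OF _ that] x by (intro sum_mono add_mono mult_right_mono) auto
  have V_zero: "V t = 0" if "0 \<le> t" "t \<le> 1/13" for t
  \<comment> \<open>The coefficient of the squared difference in \<open>V'\<close> is at most
    \<open>2 + 4 * cq\<close>, and \<open>V\<close> is at least half of the unweighted
    energy.\<close>
  proof (rule gronwall_zero[where V = V and V' = V' and d = "1/13" and C = "2 * (2 + 4 * cq)"])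
    show "continuous_on {0..1/13} V"
    proof (rule DERIV_continuous_on)
      show "(V has_real_derivative V' t) (at t within {0..1/13})" if "t \<in> {0..1/13}" for t
        using that by (intro has_field_derivative_at_within[OF dV]) (simp add: abs_of_nonneg)
    qed
    have "F 0 p = 0" if p: "cmod p = 1" for p
    proof -
      have "(\<lambda>n. scoef y n p * 0 ^ n) sums Sser y 0 p" by (rule Sser_sums[OF p y]) simp
      then have "Sser y 0 p = scoef y 0 p"
        using powser_sums_zero by (rule sums_unique2)
      then show ?thesis by (simp add: F_def rr_def Sclosed_0[OF p y] scoef_def)
    qed
    then show "V 0 = 0" using x by (simp add: V_def orbit_sum_def)
    show "0 \<le> V t" if "0 \<le> t" "t \<le> 1/13" for t
      using V_low[of t] orbit_sum_sq_nonneg[of "F t" x] that by simp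
    show "(V has_real_derivative V' t) (at t)" if "0 < t" "t < 1/13" for t
      using that by (intro dV) auto
    show "V' t \<le> 2 * (2 + 4 * cq) * V t" if t: "0 < t" "t < 1/13" for t
    proof -
      \<comment> \<open>\<open>e\<close> is singular at 0, but it multiplies only the A term, whose
        sign is favourable, and \<open>rr t\<close>, where the product is at most 2.\<close>
      define e where "e = (1 - t\<^sup>2) / (t * (1 + t\<^sup>2))"
      have D: "1 + t\<^sup>2 > 0" "1 + t\<^sup>2 \<ge> 1" by (auto simp: add_pos_nonneg)
      have t2: "0 \<le> t\<^sup>2" "t\<^sup>2 \<le> 1" using t by (auto simp: abs_square_le_1)
      have e0: "e \<ge> 0" unfolding e_def using t t2 D by (intro divide_nonneg_nonneg mult_nonneg_nonneg) auto
      have e_rr: "e * rr t = 2 * (1 - t\<^sup>2) / (1 + t\<^sup>2)\<^sup>2"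
        unfolding e_def rr_def using t D by (simp add: power2_eq_square)
      have le2: "2 * (1 - t\<^sup>2) / (1 + t\<^sup>2)\<^sup>2 \<le> 2" "0 \<le> 2 * (1 - t\<^sup>2) / (1 + t\<^sup>2)\<^sup>2"
      proof -
        have "(1 + t\<^sup>2)\<^sup>2 \<ge> 1" using D(2) by (rule one_le_power)
        then have "2 * (1 - t\<^sup>2) / (1 + t\<^sup>2)\<^sup>2 \<le> 2 / 1" using t2 by (intro frac_le) auto
        then show "2 * (1 - t\<^sup>2) / (1 + t\<^sup>2)\<^sup>2 \<le> 2" by simp
      qed (use t2 in auto)
      have tt: "\<bar>t\<bar> < 1/12" using t by auto
      have wF: "w t p * F' t p = e * (cq * rr t * (p \<bullet> y) * F t p - refl_diff (F t) p)" if p: "cmod p = 1" for p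
      proof -
        have "t * (1 + t\<^sup>2) \<noteq> 0" using mult_pos_pos[OF t(1) D(1)] by linarith
        with F'(2)[OF p tt] show ?thesis unfolding e_def by (simp add: field_simps)
      qed
      have "V' t = orbit_sum (\<lambda>p. - (r' t * (p \<bullet> y)) * (F t p)\<^sup>2
          + 2 * (F t p * (e * (cq * rr t * (p \<bullet> y) * F t p - refl_diff (F t) p)))) x"
        unfolding V'_def orbit_sum_def using x by (simp add: wF)
      also have "\<dots> = orbit_sum (\<lambda>p. ((2 * cq * (e * rr t) - r' t) * (p \<bullet> y)) * (F t p)\<^sup>2) x
          - 2 * e * orbit_sum (\<lambda>p. F t p * refl_diff (F t) p) x"
        unfolding orbit_sum_cmult[symmetric] orbit_sum_diff[symmetric]
        by (intro arg_cong2[where f = orbit_sum] refl ext) (simp add: algebra_simps power2_eq_square)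
      also have "\<dots> \<le> orbit_sum (\<lambda>p. ((2 * cq * (e * rr t) - r' t) * (p \<bullet> y)) * (F t p)\<^sup>2) x"
        using e0 orbit_sum_refl_diff_nonneg[of "F t" x] by simp
      also have "\<dots> \<le> orbit_sum (\<lambda>p. (2 + 4 * cq) * (F t p)\<^sup>2) x"
      proof -
        have "\<bar>2 * cq * (e * rr t) - r' t\<bar> \<le> 2 + 4 * cq"
        proof -
          have q: "0 \<le> e * rr t" "e * rr t \<le> 2" using le2 unfolding e_rr by auto
          have "0 \<le> 2 * cq * (e * rr t)" "2 * cq * (e * rr t) \<le> 2 * cq * 2"
            using cq_pos by (intro mult_nonneg_nonneg mult_left_mono q; simp)+
          moreover have "0 \<le> r' t" "r' t \<le> 2" using le2 unfolding r'_def by auto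
          ultimately show ?thesis unfolding abs_le_iff by auto
        qed
        moreover have "\<bar>p \<bullet> y\<bar> \<le> 1" if "cmod p = 1" for p
          using Cauchy_Schwarz_ineq2[of p y] that y by simp
        ultimately have "\<bar>(2 * cq * (e * rr t) - r' t) * (p \<bullet> y)\<bar> \<le> (2 + 4 * cq) * 1" if "cmod p = 1" for p
          unfolding abs_mult using that cq_pos by (intro mult_mono) auto
        then have "(2 * cq * (e * rr t) - r' t) * (p \<bullet> y) \<le> 2 + 4 * cq" if "cmod p = 1" for p
          using that by (metis abs_le_D1 mult.right_neutral)
        then show ?thesis unfolding orbit_sum_def using x by (intro sum_mono add_mono mult_right_mono) auto
      qed
      also have "\<dots> = (2 + 4 * cq) * orbit_sum (\<lambda>p. (F t p)\<^sup>2) x" by (rule orbit_sum_cmult)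
      also have "\<dots> \<le> (2 + 4 * cq) * (2 * V t)"
        using V_low[of t] t cq_pos by (intro mult_left_mono) auto
      finally show ?thesis by (simp only: mult_ac)
    qed
  qed (use that in auto)
  have "1/2 * orbit_sum (\<lambda>p. (F t p)\<^sup>2) x \<le> 0" using V_low[of t] V_zero[OF t] t by simp
  then have "F t (rot 0 x) = 0" by (intro orbit_sum_sq_zero) simp
  then show ?thesis by (simp add: F_def)
qed

end

section \<open>Integrals over the simplex\<close>

text \<open>The Jacobian \<open>r ^ card I\<close> is collected one coordinate at a time.\<close>

lemma nn_integral_PiM_scale:
  fixes f :: "('i \<Rightarrow> real) \<Rightarrow> ennreal"
  assumes "finite I" "r > 0" "f \<in> borel_measurable (PiM I (\<lambda>_. lborel))"
  shows "(\<integral>\<^sup>+x. f x \<partial>PiM I (\<lambda>_. lborel))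
    = ennreal (r ^ card I) * (\<integral>\<^sup>+x. f (\<lambda>i\<in>I. r * x i) \<partial>PiM I (\<lambda>_. lborel))"
  using assms(1,3)
proof (induction I arbitrary: f rule: finite_induct)
  case empty
  interpret product_sigma_finite "\<lambda>_. lborel :: real measure" by standard
  have "emeasure (PiM {} (\<lambda>_ :: 'i. lborel :: real measure)) (space (PiM {} (\<lambda>_ :: 'i. lborel))) = 1"
    using nn_integral_empty[of "\<lambda>_. 1"] by simp
  then show ?case by (simp add: nn_integral_empty restrict_def)
next
  case (insert i I)
  interpret product_sigma_finite "\<lambda>_. lborel :: real measure" by standard
  have [measurable]: "f \<in> borel_measurable (PiM (insert i I) (\<lambda>_. lborel))" by fact
  have upd: "(\<lambda>(x, y). x(i := y)) \<in> PiM I (\<lambda>_. lborel) \<Otimes>\<^sub>M lborel \<rightarrow>\<^sub>M PiM (insert i I) (\<lambda>_. lborel :: real measure)"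
    by (rule measurable_add_dim)
  have m2: "(\<lambda>(x, y). f (x(i := y))) \<in> borel_measurable (PiM I (\<lambda>_. lborel) \<Otimes>\<^sub>M lborel)"
    using measurable_compose[OF upd insert.prems] by (simp add: case_prod_beta')
  then have m: "(\<lambda>x. \<integral>\<^sup>+y. f (x(i := y)) \<partial>lborel) \<in> borel_measurable (PiM I (\<lambda>_. lborel))"
    by (rule lborel.borel_measurable_nn_integral)
  have "(\<integral>\<^sup>+x. f x \<partial>PiM (insert i I) (\<lambda>_. lborel))
      = (\<integral>\<^sup>+x. \<integral>\<^sup>+y. f (x(i := y)) \<partial>lborel \<partial>PiM I (\<lambda>_. lborel))"
    by (rule product_nn_integral_insert[OF insert.hyps insert.prems])
  also have "\<dots> = ennreal (r ^ card I) * (\<integral>\<^sup>+x. \<integral>\<^sup>+y. f ((\<lambda>j\<in>I. r * x j)(i := y)) \<partial>lborel \<partial>PiM I (\<lambda>_. lborel))"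
    by (rule insert.IH[OF m])
  also have "(\<integral>\<^sup>+x. \<integral>\<^sup>+y. f ((\<lambda>j\<in>I. r * x j)(i := y)) \<partial>lborel \<partial>PiM I (\<lambda>_. lborel))
      = (\<integral>\<^sup>+x. ennreal r * (\<integral>\<^sup>+y. f (\<lambda>j\<in>insert i I. r * (x(i := y)) j) \<partial>lborel) \<partial>PiM I (\<lambda>_. lborel))"
  proof (rule nn_integral_cong)
    fix x assume "x \<in> space (PiM I (\<lambda>_. lborel :: real measure))"
    have mz: "(\<lambda>y. f (z(i := y))) \<in> borel_measurable borel" if "z \<in> space (PiM I (\<lambda>_. lborel :: real measure))" for z
      using measurable_Pair2[OF m2 that] by simp
    have "(\<lambda>j\<in>I. r * x j) \<in> space (PiM I (\<lambda>_. lborel :: real measure))" by (simp add: space_PiM)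
    from nn_integral_real_affine[OF mz[OF this], of r 0]
    have "(\<integral>\<^sup>+y. f ((\<lambda>j\<in>I. r * x j)(i := y)) \<partial>lborel)
        = ennreal r * (\<integral>\<^sup>+y. f ((\<lambda>j\<in>I. r * x j)(i := r * y)) \<partial>lborel)"
      using \<open>r > 0\<close> by simp
    also have "(\<integral>\<^sup>+y. f ((\<lambda>j\<in>I. r * x j)(i := r * y)) \<partial>lborel)
        = (\<integral>\<^sup>+y. f (\<lambda>j\<in>insert i I. r * (x(i := y)) j) \<partial>lborel)"
    proof (intro nn_integral_cong arg_cong[where f = f])
      show "(\<lambda>j\<in>I. r * x j)(i := r * y) = (\<lambda>j\<in>insert i I. r * (x(i := y)) j)" for y
        using insert.hyps by (auto simp: fun_eq_iff)
    qed
    finally show "(\<integral>\<^sup>+y. f ((\<lambda>j\<in>I. r * x j)(i := y)) \<partial>lborel)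
        = ennreal r * (\<integral>\<^sup>+y. f (\<lambda>j\<in>insert i I. r * (x(i := y)) j) \<partial>lborel)" .
  qed
  also have "\<dots> = ennreal r * (\<integral>\<^sup>+x. \<integral>\<^sup>+y. f (\<lambda>j\<in>insert i I. r * (x(i := y)) j) \<partial>lborel \<partial>PiM I (\<lambda>_. lborel))"
  proof (rule nn_integral_cmult)
    have "(\<lambda>x. \<lambda>j\<in>insert i I. r * x j) \<in> PiM (insert i I) (\<lambda>_. lborel) \<rightarrow>\<^sub>M PiM (insert i I) (\<lambda>_. lborel :: real measure)"
      by measurable
    from measurable_compose[OF upd measurable_compose[OF this insert.prems]]
    have "(\<lambda>(x, y). f (\<lambda>j\<in>insert i I. r * (x(i := y)) j)) \<in> borel_measurable (PiM I (\<lambda>_. lborel) \<Otimes>\<^sub>M lborel)"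
      by (simp only: case_prod_beta')
    then show "(\<lambda>x. \<integral>\<^sup>+y. f (\<lambda>j\<in>insert i I. r * (x(i := y)) j) \<partial>lborel) \<in> borel_measurable (PiM I (\<lambda>_. lborel))"
      by (rule lborel.borel_measurable_nn_integral)
  qed
  also have "(\<integral>\<^sup>+x. \<integral>\<^sup>+y. f (\<lambda>j\<in>insert i I. r * (x(i := y)) j) \<partial>lborel \<partial>PiM I (\<lambda>_. lborel))
      = (\<integral>\<^sup>+x. f (\<lambda>j\<in>insert i I. r * x j) \<partial>PiM (insert i I) (\<lambda>_. lborel))"
  proof (rule product_nn_integral_insert[OF insert.hyps, symmetric])
    have "(\<lambda>x. \<lambda>j\<in>insert i I. r * x j) \<in> PiM (insert i I) (\<lambda>_. lborel) \<rightarrow>\<^sub>M PiM (insert i I) (\<lambda>_. lborel :: real measure)"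
      by measurable
    from measurable_compose[OF this insert.prems]
    show "(\<lambda>x. f (\<lambda>j\<in>insert i I. r * x j)) \<in> borel_measurable (PiM (insert i I) (\<lambda>_. lborel))" .
  qed
  moreover have "ennreal (r ^ card (insert i I)) = ennreal r * ennreal (r ^ card I)"
    using insert.hyps \<open>r > 0\<close> by (simp add: ennreal_mult')
  ultimately show ?case by (simp only: mult_ac)
qed

lemma nn_integral_gamma_scaled:
  assumes al: "al > 0" and c: "(c :: real) > 0"
  shows "(\<integral>\<^sup>+y. ennreal (indicator {0<..} y * (y powr (al - 1) * exp (- (c * y)))) \<partial>lborel) = ennreal (Gamma al * c powr (- al))"
proof -
  have "(\<integral>\<^sup>+y. ennreal (indicator {0<..} y * (y powr (al - 1) * exp (- (c * y)))) \<partial>lborel)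
      = ennreal (1 / c) * (\<integral>\<^sup>+y. ennreal (indicator {0<..} (y / c) * ((y / c) powr (al - 1) * exp (- y))) \<partial>lborel)"
    using c by (subst nn_integral_real_affine[where c = "1 / c" and t = 0]) (auto simp: abs_divide)
  also have "(\<integral>\<^sup>+y. ennreal (indicator {0<..} (y / c) * ((y / c) powr (al - 1) * exp (- y))) \<partial>lborel)
      = (\<integral>\<^sup>+y. ennreal (c powr (1 - al)) * ennreal (indicator {0..} y * (y powr (al - 1) / exp y)) \<partial>lborel)"
    using c
    by (intro nn_integral_cong)
      (auto simp: indicator_def powr_divide powr_diff exp_minus field_simps zero_less_divide_iff ennreal_mult'[symmetric])
  also have "\<dots> = ennreal (c powr (1 - al)) * ennreal (Gamma al)"
    using nn_integral_has_integral_lebesgue[OF _ Gamma_integral_real[OF al]]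
    by (subst nn_integral_cmult) (auto simp: mult_ac)
  also have "ennreal (1 / c) * (ennreal (c powr (1 - al)) * ennreal (Gamma al)) = ennreal (Gamma al * c powr (- al))"
    using c al by (simp add: ennreal_mult[symmetric] powr_diff powr_minus field_simps)
  finally show ?thesis .
qed

lemma simplex_ext_measurable [measurable]:
  "(\<lambda>t. simplex_ext n t j) \<in> borel_measurable (PiM {1..n} (\<lambda>_. lborel))" if "j \<le> n"
proof (cases "j = 0")
  case False
  then have "j \<in> {1..n}" using that by auto
  then show ?thesis using False by (simp add: simplex_ext_def)
qed (simp add: simplex_ext_def)

lemma unit_simplex_measurable [measurable]: "unit_simplex n \<in> sets (PiM {1..n} (\<lambda>_. lborel))"
proof -
  have "unit_simplex n = {t \<in> space (PiM {1..n} (\<lambda>_. lborel :: real measure)).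
      (\<forall>j\<in>{1..n}. 0 < t j) \<and> (\<Sum>j=1..n. t j) < 1}"
    by (auto simp: unit_simplex_def space_PiM)
  then show ?thesis by simp
qed

lemma simplex_ext_sum: "(\<Sum>j<Suc n. simplex_ext n t j) = 1"
proof -
  have "(\<Sum>j<Suc n. simplex_ext n t j) = simplex_ext n t 0 + (\<Sum>j=1..n. simplex_ext n t j)"
    by (simp add: sum.atLeast1_atMost_eq sum.lessThan_Suc_shift del: sum.lessThan_Suc)
  also have "(\<Sum>j=1..n. simplex_ext n t j) = (\<Sum>j=1..n. t j)"
    by (intro sum.cong) (auto simp: simplex_ext_def)
  finally show ?thesis by (simp add: simplex_ext_def)
qed

lemma simplex_ext_pos: "t \<in> unit_simplex n \<Longrightarrow> j \<le> n \<Longrightarrow> 0 < simplex_ext n t j"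
  by (auto simp: unit_simplex_def simplex_ext_def)

text \<open>Polar coordinates $x = \tau t$ on the orthant, with $\tau$ the sum of the coordinates, turn a
  product of Gamma integrals into a Gamma integral over the simplex (Feynman parametrization).\<close>

lemma nn_integral_simplex_feynman:
  fixes al c :: "nat \<Rightarrow> real"
  assumes al: "\<And>j. j \<le> n \<Longrightarrow> al j > 0" and c: "\<And>j. j \<le> n \<Longrightarrow> c j > 0"
  shows "(\<integral>\<^sup>+t. ennreal (indicator (unit_simplex n) t * ((\<Prod>j<Suc n. simplex_ext n t j powr (al j - 1))
      * (\<Sum>j<Suc n. c j * simplex_ext n t j) powr (- (\<Sum>j<Suc n. al j)))) \<partial>PiM {1..n} (\<lambda>_. lborel))
    = ennreal ((\<Prod>j<Suc n. Gamma (al j) * c j powr (- al j)) / Gamma (\<Sum>j<Suc n. al j))"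
proof -
  interpret product_sigma_finite "\<lambda>_. lborel :: real measure" by standard
  let ?X = "PiM {1..n} (\<lambda>_. lborel :: real measure)"
  interpret X: sigma_finite_measure ?X by (rule sigma_finite) simp
  interpret XL: pair_sigma_finite ?X "lborel :: real measure" by standard
  define A where "A = (\<Sum>j<Suc n. al j)"
  define f where "f j y = indicator {0<..} y * (y powr (al j - 1) * exp (- (c j * y)))" for j and y :: real
  have f0: "f j y \<ge> 0" for j y by (simp add: f_def)
  have fm [measurable]: "f j \<in> borel_measurable borel" for j unfolding f_def[abs_def] by measurable
  have split: "(\<Prod>j<Suc n. g j) = g 0 * (\<Prod>j=1..n. g j)" for g :: "nat \<Rightarrow> 'z::comm_monoid_mult"
    by (simp add: prod.atLeast1_atMost_eq prod.lessThan_Suc_shift del: prod.lessThan_Suc)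
  have split_sum: "(\<Sum>j<Suc n. g j) = g 0 + (\<Sum>j=1..n. g j)" for g :: "nat \<Rightarrow> real"
    by (simp add: sum.atLeast1_atMost_eq sum.lessThan_Suc_shift del: sum.lessThan_Suc)
  have A: "A > 0" unfolding A_def by (intro sum_pos) (use al in auto)
  define S where "S t = (\<Sum>j<Suc n. c j * simplex_ext n t j)" for t
  define W where "W t = indicator (unit_simplex n) t * (\<Prod>j<Suc n. simplex_ext n t j powr (al j - 1))" for t
  have Wm [measurable]: "W \<in> borel_measurable ?X" and Sm [measurable]: "S \<in> borel_measurable ?X"
    unfolding W_def[abs_def] S_def[abs_def] by measurable
  have W0: "W t \<ge> 0" for t unfolding W_def by (simp add: prod_nonneg)
  \<comment> \<open>The substitution x = r t has the Jacobian \<open>r ^ n\<close>, which together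
    with the \<open>n + 1\<close> exponents \<open>al j - 1\<close> makes \<open>A - 1\<close>. Off
    the simplex one of the factors \<open>f\<close> vanishes.\<close>
  have polar: "r ^ n * ((\<Prod>j=1..n. f j (r * t j)) * f 0 (r - (\<Sum>j=1..n. r * t j)))
      = W t * (indicator {0<..} r * (r powr (A - 1) * exp (- (S t * r))))"
    if t: "t \<in> space ?X" and r: "r > 0" for t r
  proof (cases "t \<in> unit_simplex n")
    case True
    note pos = simplex_ext_pos[OF True]
    have "r - (\<Sum>j=1..n. r * t j) = r * simplex_ext n t 0"
      by (simp add: simplex_ext_def algebra_simps sum_distrib_left)
    then have "f 0 (r - (\<Sum>j=1..n. r * t j)) = f 0 (r * simplex_ext n t 0)" by simp
    moreover have "(\<Prod>j=1..n. f j (r * t j)) = (\<Prod>j=1..n. f j (r * simplex_ext n t j))"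
      by (intro prod.cong) (auto simp: simplex_ext_def)
    ultimately have "(\<Prod>j=1..n. f j (r * t j)) * f 0 (r - (\<Sum>j=1..n. r * t j)) = (\<Prod>j<Suc n. f j (r * simplex_ext n t j))"
      by (simp only: split mult.commute)
    also have "\<dots> = (\<Prod>j<Suc n. r powr (al j - 1) * simplex_ext n t j powr (al j - 1) * exp (- (c j * simplex_ext n t j * r)))"
      using pos r by (intro prod.cong) (auto simp: f_def powr_mult mult_ac less_Suc_eq_le)
    also have "\<dots> = (\<Prod>j<Suc n. r powr (al j - 1)) * (\<Prod>j<Suc n. simplex_ext n t j powr (al j - 1))
        * (\<Prod>j<Suc n. exp (- (c j * simplex_ext n t j * r)))"
      by (simp only: prod.distrib)
    also have "(\<Prod>j<Suc n. exp (- (c j * simplex_ext n t j * r))) = exp (- (S t * r))"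
      by (simp only: S_def exp_sum[symmetric] finite_lessThan sum_negf sum_distrib_right)
    also have "(\<Prod>j<Suc n. r powr (al j - 1)) = r powr (\<Sum>j<Suc n. al j - 1)"
      using r by (simp only: powr_sum)
    also have "(\<Sum>j<Suc n. al j - 1) = A - 1 - real n"
      by (simp add: A_def sum_subtractf)
    finally have "r ^ n * ((\<Prod>j=1..n. f j (r * t j)) * f 0 (r - (\<Sum>j=1..n. r * t j)))
      = (r ^ n * r powr (A - 1 - real n)) * ((\<Prod>j<Suc n. simplex_ext n t j powr (al j - 1)) * exp (- (S t * r)))"
      by (simp only: mult_ac)
    also have "r ^ n * r powr (A - 1 - real n) = r powr (A - 1)"
      using r by (simp add: powr_realpow[symmetric] powr_add[symmetric])
    finally show ?thesis using True r by (simp add: W_def mult_ac)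
  next
    case False
    have "(\<Prod>j=1..n. f j (r * t j)) * f 0 (r - (\<Sum>j=1..n. r * t j)) = 0"
    proof (rule ccontr)
      assume nz: "\<not> ?thesis"
      then have "f j (r * t j) \<noteq> 0" if "j \<in> {1..n}" for j using that by auto
      then have "0 < t j" if "j \<in> {1..n}" for j
        using that r by (force simp: f_def indicator_def zero_less_mult_iff split: if_splits)
      moreover have "f 0 (r - (\<Sum>j=1..n. r * t j)) \<noteq> 0" using nz by auto
      then have "r - (\<Sum>j=1..n. r * t j) > 0" by (auto simp: f_def indicator_def split: if_splits)
      then have "r * (\<Sum>j=1..n. t j) < r * 1" by (simp add: sum_distrib_left)
      then have "(\<Sum>j=1..n. t j) < 1" using r by (simp only: mult_less_cancel_left_pos)
      ultimately show False using t False by (auto simp: unit_simplex_def space_PiM)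
    qed
    then show ?thesis using False by (simp add: W_def)
  qed
  \<comment> \<open>For a nonpositive total some factor vanishes, so the outer integral reduces to
    \<open>r > 0\<close>.\<close>
  have neg: "(\<Prod>j=1..n. f j (x j)) * f 0 (r - (\<Sum>j=1..n. x j)) = 0" if "r \<le> 0" for x r
  proof (rule ccontr)
    assume nz: "\<not> ?thesis"
    then have "f j (x j) \<noteq> 0" if "j \<in> {1..n}" for j using that by auto
    then have "0 \<le> x j" if "j \<in> {1..n}" for j
      using that by (force simp: f_def indicator_def split: if_splits)
    then have "0 \<le> (\<Sum>j=1..n. x j)" by (intro sum_nonneg)
    moreover have "f 0 (r - (\<Sum>j=1..n. x j)) \<noteq> 0" using nz by auto
    then have "r - (\<Sum>j=1..n. x j) > 0" by (auto simp: f_def indicator_def split: if_splits)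
    ultimately show False using that by linarith
  qed
  have Gam: "(\<integral>\<^sup>+y. ennreal (f j y) \<partial>lborel) = ennreal (Gamma (al j) * c j powr (- al j))" if "j \<le> n" for j
    unfolding f_def by (rule nn_integral_gamma_scaled[OF al[OF that] c[OF that]])
  have "ennreal (\<Prod>j<Suc n. Gamma (al j) * c j powr (- al j))
      = (\<Prod>j<Suc n. ennreal (Gamma (al j) * c j powr (- al j)))"
    by (rule prod_ennreal[symmetric]) (use al in \<open>auto simp: less_Suc_eq_le intro!: mult_nonneg_nonneg less_imp_le\<close>)
  also have "\<dots> = (\<integral>\<^sup>+y. ennreal (f 0 y) \<partial>lborel) * (\<Prod>j=1..n. \<integral>\<^sup>+y. ennreal (f j y) \<partial>lborel)"
    unfolding split by (simp add: Gam)
  also have "\<dots> = (\<integral>\<^sup>+y. ennreal (f 0 y) \<partial>lborel) * (\<integral>\<^sup>+x. (\<Prod>j=1..n. ennreal (f j (x j))) \<partial>?X)"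
    by (subst product_nn_integral_prod) auto
  also have "\<dots> = (\<integral>\<^sup>+x. (\<integral>\<^sup>+y. (\<Prod>j=1..n. ennreal (f j (x j))) * ennreal (f 0 y) \<partial>lborel) \<partial>?X)"
    by (simp add: nn_integral_cmult nn_integral_multc mult.commute)
  \<comment> \<open>The variable with index 0 is replaced by the total r, which makes it the
    dependent coordinate of the simplex.\<close>
  also have "\<dots> = (\<integral>\<^sup>+x. (\<integral>\<^sup>+r. ennreal ((\<Prod>j=1..n. f j (x j)) * f 0 (r - (\<Sum>j=1..n. x j))) \<partial>lborel) \<partial>?X)"
  proof (rule nn_integral_cong)
    fix x
    have "(\<integral>\<^sup>+y. (\<Prod>j=1..n. ennreal (f j (x j))) * ennreal (f 0 y) \<partial>lborel)
       = (\<integral>\<^sup>+y. ennreal ((\<Prod>j=1..n. f j (x j)) * f 0 y) \<partial>lborel)"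
      by (simp add: prod_ennreal f0 ennreal_mult prod_nonneg)
    also have "\<dots> = (\<integral>\<^sup>+r. ennreal ((\<Prod>j=1..n. f j (x j)) * f 0 (r - (\<Sum>j=1..n. x j))) \<partial>lborel)"
      by (subst nn_integral_real_affine[where c = 1 and t = "- (\<Sum>j=1..n. x j)"]) (auto simp: algebra_simps)
    finally show "(\<integral>\<^sup>+y. (\<Prod>j=1..n. ennreal (f j (x j))) * ennreal (f 0 y) \<partial>lborel)
       = (\<integral>\<^sup>+r. ennreal ((\<Prod>j=1..n. f j (x j)) * f 0 (r - (\<Sum>j=1..n. x j))) \<partial>lborel)" .
  qed
  also have "\<dots> = (\<integral>\<^sup>+r. (\<integral>\<^sup>+x. ennreal ((\<Prod>j=1..n. f j (x j)) * f 0 (r - (\<Sum>j=1..n. x j))) \<partial>?X) \<partial>lborel)"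
    by (rule XL.Fubini'[symmetric]) measurable
  also have "\<dots> = (\<integral>\<^sup>+r. (\<integral>\<^sup>+t. ennreal (W t * (indicator {0<..} r * (r powr (A - 1) * exp (- (S t * r))))) \<partial>?X) \<partial>lborel)"
  proof (rule nn_integral_cong)
    fix r :: real
    show "(\<integral>\<^sup>+x. ennreal ((\<Prod>j=1..n. f j (x j)) * f 0 (r - (\<Sum>j=1..n. x j))) \<partial>?X)
      = (\<integral>\<^sup>+t. ennreal (W t * (indicator {0<..} r * (r powr (A - 1) * exp (- (S t * r))))) \<partial>?X)"
    proof (cases "r > 0")
      case True
      have "(\<integral>\<^sup>+x. ennreal ((\<Prod>j=1..n. f j (x j)) * f 0 (r - (\<Sum>j=1..n. x j))) \<partial>?X)
        = ennreal (r ^ card {1..n}) * (\<integral>\<^sup>+t. ennreal ((\<Prod>j=1..n. f j ((\<lambda>i\<in>{1..n}. r * t i) j))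
            * f 0 (r - (\<Sum>j=1..n. (\<lambda>i\<in>{1..n}. r * t i) j))) \<partial>?X)"
        by (rule nn_integral_PiM_scale) (use True in \<open>simp_all, measurable\<close>)
      also have "\<dots> = ennreal (r ^ n) * (\<integral>\<^sup>+t. ennreal ((\<Prod>j=1..n. f j (r * t j)) * f 0 (r - (\<Sum>j=1..n. r * t j))) \<partial>?X)"
        by simp
      also have "\<dots> = (\<integral>\<^sup>+t. ennreal (r ^ n * ((\<Prod>j=1..n. f j (r * t j)) * f 0 (r - (\<Sum>j=1..n. r * t j)))) \<partial>?X)"
        using True by (subst nn_integral_cmult[symmetric]) (auto simp: ennreal_mult')
      also have "\<dots> = (\<integral>\<^sup>+t. ennreal (W t * (indicator {0<..} r * (r powr (A - 1) * exp (- (S t * r))))) \<partial>?X)"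
        by (intro nn_integral_cong arg_cong[where f = ennreal] polar True)
      finally show ?thesis .
    next
      case False
      then have "(\<Prod>j=1..n. f j (x j)) * f 0 (r - (\<Sum>j=1..n. x j)) = 0" for x
        by (intro neg) simp
      then show ?thesis using False by (simp only: ennreal_0) simp
    qed
  qed
  also have "\<dots> = (\<integral>\<^sup>+t. (\<integral>\<^sup>+r. ennreal (W t * (indicator {0<..} r * (r powr (A - 1) * exp (- (S t * r))))) \<partial>lborel) \<partial>?X)"
    by (rule XL.Fubini') measurable
  also have "\<dots> = (\<integral>\<^sup>+t. ennreal (Gamma A) * ennreal (W t * S t powr (- A)) \<partial>?X)"
  proof (rule nn_integral_cong)
    fix t
    show "(\<integral>\<^sup>+r. ennreal (W t * (indicator {0<..} r * (r powr (A - 1) * exp (- (S t * r))))) \<partial>lborel)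
      = ennreal (Gamma A) * ennreal (W t * S t powr (- A))"
    proof (cases "t \<in> unit_simplex n")
      case True
      have "S t > 0" unfolding S_def
        by (intro sum_pos) (use c simplex_ext_pos[OF True] in \<open>auto simp: less_Suc_eq_le\<close>)
      then have "(\<integral>\<^sup>+r. ennreal (W t * (indicator {0<..} r * (r powr (A - 1) * exp (- (S t * r))))) \<partial>lborel)
          = ennreal (W t) * ennreal (Gamma A * S t powr (- A))"
        using nn_integral_gamma_scaled[OF A] W0[of t]
        by (simp add: ennreal_mult' nn_integral_cmult)
      then show ?thesis using A W0[of t] by (simp add: ennreal_mult[symmetric] mult_ac less_imp_le)
    qed (simp add: W_def)
  qed
  also have "\<dots> = ennreal (Gamma A) * (\<integral>\<^sup>+t. ennreal (W t * S t powr (- A)) \<partial>?X)"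
    by (rule nn_integral_cmult) measurable
  finally have eq: "ennreal (\<Prod>j<Suc n. Gamma (al j) * c j powr (- al j))
      = ennreal (Gamma A) * (\<integral>\<^sup>+t. ennreal (W t * S t powr (- A)) \<partial>?X)" .
  have G: "Gamma A > 0" using A by simp
  have "(\<integral>\<^sup>+t. ennreal (W t * S t powr (- A)) \<partial>?X)
      = ennreal (1 / Gamma A) * (ennreal (Gamma A) * (\<integral>\<^sup>+t. ennreal (W t * S t powr (- A)) \<partial>?X))"
    using G by (simp add: mult.assoc[symmetric] ennreal_mult[symmetric])
  also have "\<dots> = ennreal ((\<Prod>j<Suc n. Gamma (al j) * c j powr (- al j)) / Gamma A)"
    unfolding eq[symmetric] using G by (simp add: ennreal_mult'[symmetric])
  finally show ?thesis
    by (simp only: W_def S_def A_def mult.assoc)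
qed

text \<open>The Dirichlet density with all parameters \<open>l\<close>, left unnormalised so that it
  is literally the weight in the simplex integral.\<close>

definition dirM :: "nat \<Rightarrow> real \<Rightarrow> (nat \<Rightarrow> real) measure" where
  "dirM n l = density (PiM {1..n} (\<lambda>_. lborel))
     (\<lambda>t. ennreal (indicator (unit_simplex n) t * (\<Prod>j<Suc n. simplex_ext n t j powr (l - 1))))"

lemma dir_density_measurable [measurable]:
  "(\<lambda>t. indicator (unit_simplex n) t * (\<Prod>j<Suc n. simplex_ext n t j powr (l - 1)))
    \<in> borel_measurable (PiM {1..n} (\<lambda>_. lborel))"
  by measurable

lemma sets_dirM [measurable_cong, simp]: "sets (dirM n l) = sets (PiM {1..n} (\<lambda>_. lborel))"
  by (simp add: dirM_def)

lemma AE_dirM: "AE t in dirM n l. t \<in> unit_simplex n"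
  unfolding dirM_def
proof (subst AE_density)
  show "AE t in PiM {1..n} (\<lambda>_. lborel).
      0 < ennreal (indicator (unit_simplex n) t * (\<Prod>j<Suc n. simplex_ext n t j powr (l - 1))) \<longrightarrow> t \<in> unit_simplex n"
    by (auto simp: indicator_def)
qed measurable

text \<open>The exponent exceeds the sum of the Dirichlet parameters by 1. Writing 1 as the sum of
  the coordinates raises one parameter to \<open>l + 1\<close> in each summand, after which the
  exponent matches. The Gamma factors then leave \<open>l / K\<close>, which is 1/(n+1).\<close>

lemma nn_integral_dirM_feynman:
  assumes l: "l > 0" and c: "\<And>j. j \<le> n \<Longrightarrow> c j > 0"
  shows "(\<integral>\<^sup>+t. ennreal ((\<Sum>j<Suc n. c j * simplex_ext n t j) powr (- (real (Suc n) * l + 1))) \<partial>dirM n l)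
    = ennreal (Gamma l ^ Suc n / Gamma (real (Suc n) * l) * ((\<Prod>j<Suc n. c j) powr (- l) * ((\<Sum>j<Suc n. 1 / c j) / real (Suc n))))"
proof -
  define K where "K = real (Suc n) * l"
  have K: "K > 0" using l by (simp add: K_def)
  let ?S = "\<lambda>t. \<Sum>j<Suc n. c j * simplex_ext n t j"
  let ?al = "\<lambda>i j. l + (if j = i then 1 else 0)"
  let ?P = "\<lambda>t. \<Prod>j<Suc n. simplex_ext n t j powr (l - 1)"
  have sum_al: "(\<Sum>j<Suc n. ?al i j) = K + 1" if "i < Suc n" for i
    using that by (simp add: sum.distrib K_def del: sum.lessThan_Suc)
  have term_eq: "(\<integral>\<^sup>+t. ennreal (indicator (unit_simplex n) t * (simplex_ext n t i * (?P t * ?S t powr (- (K + 1))))) \<partial>PiM {1..n} (\<lambda>_. lborel))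
     = ennreal (Gamma l ^ Suc n / Gamma K * ((\<Prod>j<Suc n. c j) powr (- l) * ((1 / c i) / real (Suc n))))"
    if i: "i < Suc n" for i
  proof -
    have "(\<integral>\<^sup>+t. ennreal (indicator (unit_simplex n) t * (simplex_ext n t i * (?P t * ?S t powr (- (K + 1))))) \<partial>PiM {1..n} (\<lambda>_. lborel))
      = (\<integral>\<^sup>+t. ennreal (indicator (unit_simplex n) t * ((\<Prod>j<Suc n. simplex_ext n t j powr (?al i j - 1))
          * ?S t powr (- (\<Sum>j<Suc n. ?al i j)))) \<partial>PiM {1..n} (\<lambda>_. lborel))"
    proof (intro nn_integral_cong arg_cong[where f = ennreal])
      fix t
      show "indicator (unit_simplex n) t * (simplex_ext n t i * (?P t * ?S t powr (- (K + 1))))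
        = indicator (unit_simplex n) t * ((\<Prod>j<Suc n. simplex_ext n t j powr (?al i j - 1)) * ?S t powr (- (\<Sum>j<Suc n. ?al i j)))"
      proof (cases "t \<in> unit_simplex n")
        case True
        have "(\<Prod>j<Suc n. simplex_ext n t j powr (?al i j - 1))
            = (\<Prod>j<Suc n. simplex_ext n t j powr (l - 1) * (if j = i then simplex_ext n t j else 1))"
        proof (rule prod.cong, rule refl)
          fix j assume "j \<in> {..<Suc n}"
          then have "simplex_ext n t j > 0" using simplex_ext_pos[OF True] by simp
          then show "simplex_ext n t j powr (?al i j - 1)
              = simplex_ext n t j powr (l - 1) * (if j = i then simplex_ext n t j else 1)"
            by (auto simp: powr_diff powr_add)
        qed
        also have "\<dots> = ?P t * simplex_ext n t i"
          using i by (simp add: prod.distrib prod.delta del: prod.lessThan_Suc)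
        finally show ?thesis unfolding sum_al[OF i] by (simp only: mult_ac)
      qed simp
    qed
    also have "\<dots> = ennreal ((\<Prod>j<Suc n. Gamma (?al i j) * c j powr (- ?al i j)) / Gamma (\<Sum>j<Suc n. ?al i j))"
      by (rule nn_integral_simplex_feynman) (use l c in auto)
    also have "(\<Prod>j<Suc n. Gamma (?al i j) * c j powr (- ?al i j))
        = (\<Prod>j<Suc n. (Gamma l * c j powr (- l)) * (if j = i then l / c j else 1))"
    proof (rule prod.cong, rule refl)
      have G: "Gamma (l + 1) = l * Gamma l" using l by (subst Gamma_plus1) auto
      fix j assume "j \<in> {..<Suc n}"
      then have cj: "c j > 0" using c by simp
      show "Gamma (?al i j) * c j powr (- ?al i j) = (Gamma l * c j powr (- l)) * (if j = i then l / c j else 1)"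
        using cj by (auto simp: G powr_diff)
    qed
    also have "\<dots> = (\<Prod>j<Suc n. Gamma l * c j powr (- l)) * (l / c i)"
      using i by (simp add: prod.distrib prod.delta del: prod.lessThan_Suc)
    also have "(\<Prod>j<Suc n. Gamma l * c j powr (- l)) = Gamma l ^ Suc n * (\<Prod>j<Suc n. c j) powr (- l)"
      by (simp only: prod.distrib prod_constant card_lessThan prod_powr_distrib)
    also have "Gamma (\<Sum>j<Suc n. ?al i j) = K * Gamma K"
      unfolding sum_al[OF i] using K by (subst Gamma_plus1) auto
    also have "Gamma l ^ Suc n * (\<Prod>j<Suc n. c j) powr (- l) * (l / c i) / (K * Gamma K)
        = Gamma l ^ Suc n / Gamma K * ((\<Prod>j<Suc n. c j) powr (- l) * ((1 / c i) / real (Suc n)))"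
      using l by (simp add: K_def mult_ac del: of_nat_Suc prod.lessThan_Suc)
    finally show ?thesis .
  qed
  have "(\<integral>\<^sup>+t. ennreal (?S t powr (- (K + 1))) \<partial>dirM n l)
    = (\<integral>\<^sup>+t. (\<Sum>i<Suc n. ennreal (indicator (unit_simplex n) t * (simplex_ext n t i * (?P t * ?S t powr (- (K + 1)))))) \<partial>PiM {1..n} (\<lambda>_. lborel))"
    unfolding dirM_def
  proof (subst nn_integral_density)
    have "ennreal (indicator (unit_simplex n) t * ?P t) * ennreal (?S t powr (- (K + 1)))
      = (\<Sum>i<Suc n. ennreal (indicator (unit_simplex n) t * (simplex_ext n t i * (?P t * ?S t powr (- (K + 1))))))" for t
    proof (cases "t \<in> unit_simplex n")
      case True
      have P0: "?P t \<ge> 0" by (simp add: prod_nonneg)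
      have "(\<Sum>i<Suc n. ennreal (simplex_ext n t i * (?P t * ?S t powr (- (K + 1)))))
          = ennreal (\<Sum>i<Suc n. simplex_ext n t i * (?P t * ?S t powr (- (K + 1))))"
        using simplex_ext_pos[OF True] P0
        by (intro sum_ennreal mult_nonneg_nonneg) (auto simp: less_Suc_eq_le less_imp_le)
      also have "(\<Sum>i<Suc n. simplex_ext n t i * (?P t * ?S t powr (- (K + 1)))) = ?P t * ?S t powr (- (K + 1))"
        by (simp only: sum_distrib_right[symmetric] simplex_ext_sum mult_1)
      finally show ?thesis using True P0
        by (simp add: ennreal_mult'[symmetric] del: sum.lessThan_Suc prod.lessThan_Suc)
    qed simp
    then show "(\<integral>\<^sup>+t. ennreal (indicator (unit_simplex n) t * ?P t) * ennreal (?S t powr (- (K + 1))) \<partial>PiM {1..n} (\<lambda>_. lborel))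
      = (\<integral>\<^sup>+t. (\<Sum>i<Suc n. ennreal (indicator (unit_simplex n) t * (simplex_ext n t i * (?P t * ?S t powr (- (K + 1)))))) \<partial>PiM {1..n} (\<lambda>_. lborel))"
      by (intro nn_integral_cong)
  qed measurable
  also have "\<dots> = (\<Sum>i<Suc n. ennreal (Gamma l ^ Suc n / Gamma K * ((\<Prod>j<Suc n. c j) powr (- l) * ((1 / c i) / real (Suc n)))))"
  proof (subst nn_integral_sum)
    fix i assume "i \<in> {..<Suc n}"
    then have "i \<le> n" by simp
    note [measurable] = simplex_ext_measurable[OF this]
    show "(\<lambda>t. ennreal (indicator (unit_simplex n) t * (simplex_ext n t i * (?P t * ?S t powr (- (K + 1))))))
        \<in> borel_measurable (PiM {1..n} (\<lambda>_. lborel))"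
      by measurable
  next
    show "(\<Sum>i<Suc n. \<integral>\<^sup>+t. ennreal (indicator (unit_simplex n) t * (simplex_ext n t i * (?P t * ?S t powr (- (K + 1))))) \<partial>PiM {1..n} (\<lambda>_. lborel))
      = (\<Sum>i<Suc n. ennreal (Gamma l ^ Suc n / Gamma K * ((\<Prod>j<Suc n. c j) powr (- l) * ((1 / c i) / real (Suc n)))))"
      by (intro sum.cong refl term_eq) simp
  qed
  also have "\<dots> = ennreal (\<Sum>i<Suc n. Gamma l ^ Suc n / Gamma K * ((\<Prod>j<Suc n. c j) powr (- l) * ((1 / c i) / real (Suc n))))"
    using l K c by (intro sum_ennreal mult_nonneg_nonneg divide_nonneg_nonneg) (auto simp: less_Suc_eq_le less_imp_le)
  also have "(\<Sum>i<Suc n. Gamma l ^ Suc n / Gamma K * ((\<Prod>j<Suc n. c j) powr (- l) * ((1 / c i) / real (Suc n))))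
      = Gamma l ^ Suc n / Gamma K * ((\<Prod>j<Suc n. c j) powr (- l) * ((\<Sum>j<Suc n. 1 / c j) / real (Suc n)))"
    by (simp only: sum_distrib_left sum_divide_distrib)
  finally show ?thesis unfolding K_def .
qed

section \<open>Moments of the integral representation\<close>

text \<open>Outside [-1,1] the defining description has an unsatisfiable predicate, so
  \<open>arccos\<close> is constant there; inside it is continuous.\<close>

lemma borel_measurable_arccos [measurable]: "arccos \<in> borel_measurable borel"
proof -
  define A where "A = {-1..1::real}"
  have "arccos y = (THE x. False)" if "y \<notin> A" for y
  proof -
    have "(\<lambda>x. 0 \<le> x \<and> x \<le> pi \<and> cos x = y) = (\<lambda>x. False)"
      using that by (auto simp: A_def fun_eq_iff)
    then show ?thesis unfolding arccos_def by (rule arg_cong)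
  qed
  then have "arccos = (\<lambda>y. indicator A y *\<^sub>R arccos y + indicator (- A) y * (THE x. False))"
    by (auto simp: fun_eq_iff indicator_def)
  moreover have "\<dots> \<in> borel_measurable borel"
  proof (rule borel_measurable_add)
    show "(\<lambda>y. indicator A y *\<^sub>R arccos y) \<in> borel_measurable borel"
      unfolding A_def by (intro borel_measurable_continuous_on_indicator continuous_on_arccos') auto
    show "(\<lambda>y. indicator (- A) y * (THE x. False) :: real) \<in> borel_measurable borel"
      unfolding A_def by measurable
  qed
  ultimately show ?thesis by simp
qed

lemma LINT_power_series_sums:
  fixes L :: "'x \<Rightarrow> real"
  assumes fin: "finite_measure M" and L [measurable]: "L \<in> borel_measurable M"
    and bnd: "AE w in M. \<bar>L w\<bar> \<le> 1" and summ: "summable (\<lambda>n. \<bar>c n\<bar>)"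
  shows "(\<lambda>n. c n * (LINT w|M. L w ^ n)) sums (LINT w|M. (\<Sum>n. c n * L w ^ n))"
proof -
  interpret finite_measure M by fact
  have AEn: "AE w in M. norm (c n * L w ^ n) \<le> \<bar>c n\<bar>" for n
    using bnd
  proof eventually_elim
    case (elim w)
    then have "\<bar>L w\<bar> ^ n \<le> 1" by (intro power_le_one) auto
    then show ?case by (simp add: abs_mult power_abs mult_left_le)
  qed
  have int: "integrable M (\<lambda>w. c n * L w ^ n)" for n
    by (rule integrable_const_bound[OF AEn]) measurable
  have "(\<lambda>n. LINT w|M. c n * L w ^ n) sums (LINT w|M. (\<Sum>n. c n * L w ^ n))"
  proof (rule sums_integral[OF int])
    show "AE w in M. summable (\<lambda>n. norm (c n * L w ^ n))"
    proof -
      have "AE w in M. \<forall>n. norm (c n * L w ^ n) \<le> \<bar>c n\<bar>"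
        unfolding AE_all_countable using AEn by blast
      then show ?thesis
        by eventually_elim (rule summable_comparison_test[OF _ summ], auto)
    qed
    show "summable (\<lambda>n. LINT w|M. norm (c n * L w ^ n))"
    proof (rule summable_comparison_test[OF _ summable_mult2[OF summ, of "measure M (space M)"]], intro exI allI impI)
      fix n
      have "(LINT w|M. norm (c n * L w ^ n)) \<le> (LINT w|M. \<bar>c n\<bar>)"
        using AEn[of n] int by (intro integral_mono_AE) auto
      then show "norm (LINT w|M. norm (c n * L w ^ n)) \<le> \<bar>c n\<bar> * measure M (space M)"
        by (simp add: mult.commute)
    qed
  qed
  then show ?thesis by simp
qed

text \<open>Zeros of a nonzero power series are isolated. The zeros are taken positive because the
  identity to be exploited is available at the values \<open>rr t\<close> for small nonnegative
  t.\<close>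

lemma power_series_coeffs_eq_0:
  fixes d :: "nat \<Rightarrow> real"
  assumes R: "R > 0" and summ: "\<And>x. \<bar>x\<bar> < R \<Longrightarrow> (\<lambda>n. d n * x ^ n) sums f x"
    and f0: "f 0 = 0" and small: "\<And>e. e > 0 \<Longrightarrow> \<exists>x. 0 < x \<and> x \<le> e \<and> f x = 0"
  shows "d n = 0"
proof (rule ccontr)
  assume nz: "d n \<noteq> 0"
  have "(\<lambda>n. d n * 0 ^ n) sums f 0" using R by (intro summ) simp
  then have "d 0 = 0" using f0 powser_sums_zero[of d] sums_unique2 by metis
  with nz have "n > 0" by (cases n) auto
  from powser_0_nonzero[of R 0 d f n] R summ f0 nz this
  obtain s where s: "s > 0" "\<And>z. z \<in> cball 0 s - {0} \<Longrightarrow> f z \<noteq> 0" by auto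
  from small[OF s(1)] obtain x where "0 < x" "x \<le> s" "f x = 0" by blast
  with s(2)[of x] show False by auto
qed

text \<open>The Feynman formula with all \<open>c j = 1\<close>, where the base of the power is the
  sum 1 of the coordinates.\<close>

lemma finite_measure_dirM:
  assumes l: "l > 0"
  shows "finite_measure (dirM n l)"
proof
  have "emeasure (dirM n l) (space (dirM n l)) = (\<integral>\<^sup>+t. 1 \<partial>dirM n l)" by simp
  also have "\<dots> = (\<integral>\<^sup>+t. ennreal ((\<Sum>j<Suc n. 1 * simplex_ext n t j) powr (- (real (Suc n) * l + 1))) \<partial>dirM n l)"
    by (simp only: mult_1 simplex_ext_sum powr_one_eq_one ennreal_1)
  also have "\<dots> = ennreal (Gamma l ^ Suc n / Gamma (real (Suc n) * l)
      * ((\<Prod>j<Suc n. 1) powr (- l) * ((\<Sum>j<Suc n. 1 / 1) / real (Suc n))))"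
    by (rule nn_integral_dirM_feynman[OF l]) simp
  finally show "emeasure (dirM n l) (space (dirM n l)) \<noteq> \<infinity>" by simp
qed

section \<open>The right-hand side as an integral over one finite measure space\<close>

context dihedral
begin

abbreviation n1 :: nat where "n1 \<equiv> k - 1"

lemma Suc_n1: "Suc n1 = k" using k by simp

text \<open>The exponent of the theorem without the factor \<open>cmod z * cmod w\<close>, for an
  angle \<open>Q\<close> that will be q or pi - q. The argument consists of the pair (u, v) and a
  point of the simplex.\<close>

definition phase :: "(real \<times> real \<Rightarrow> real) \<Rightarrow> (real \<times> real) \<times> (nat \<Rightarrow> real) \<Rightarrow> real" where
  "phase Q X = (\<Sum>j<k. cos ((Q (fst X) - 2 * real j * pi) / real k) * simplex_ext n1 (snd X) j)"

definition fullM :: "((real \<times> real) \<times> (nat \<Rightarrow> real)) measure" where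
  "fullM = nu2 a b \<Otimes>\<^sub>M dirM n1 (a + b)"

lemma lam_pos: "a + b > 0" using a b by simp

lemma sets_fullM [measurable_cong]: "sets fullM = sets ((borel \<Otimes>\<^sub>M borel) \<Otimes>\<^sub>M PiM {1..n1} (\<lambda>_. lborel))"
  unfolding fullM_def by (rule sets_pair_measure_cong) simp_all

lemma phase_measurable:
  assumes [measurable]: "Q \<in> borel_measurable (borel \<Otimes>\<^sub>M borel)"
  shows "phase Q \<in> borel_measurable ((borel \<Otimes>\<^sub>M borel) \<Otimes>\<^sub>M PiM {1..n1} (\<lambda>_. lborel))"
  unfolding phase_def[abs_def]
proof (intro borel_measurable_sum borel_measurable_times)
  fix j assume "j \<in> {..<k}"
  then have "j \<le> n1" by auto
  from measurable_compose[OF measurable_snd simplex_ext_measurable[OF this]]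
  show "(\<lambda>X. simplex_ext n1 (snd X) j) \<in> borel_measurable ((borel \<Otimes>\<^sub>M borel) \<Otimes>\<^sub>M PiM {1..n1} (\<lambda>_. lborel))" .
qed measurable

end

text \<open>\<open>x\<close> and \<open>y\<close> are the directions of the two arguments; the
  lengths return by homogeneity in \<open>gen_bessel_series\<close>.\<close>

locale dihedral_pair = dihedral +
  fixes x y :: complex
  assumes x: "cmod x = 1" and y: "cmod y = 1"
begin

sublocale G: gegenbauer_kernel a b "pp x y" "ss x y" by (rule pp_ss_kernel[OF x y])

sublocale N2: finite_measure "nu2 a b" by (rule G.finite_nu2)
sublocale DM: finite_measure "dirM n1 (a + b)" by (rule finite_measure_dirM[OF lam_pos])
sublocale N3: pair_sigma_finite "nu2 a b" "dirM n1 (a + b)" ..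

lemma finite_fullM: "finite_measure fullM"
proof
  have "emeasure fullM (space (nu2 a b) \<times> space (dirM n1 (a + b)))
      = emeasure (nu2 a b) (space (nu2 a b)) * emeasure (dirM n1 (a + b)) (space (dirM n1 (a + b)))"
    unfolding fullM_def by (rule DM.emeasure_pair_measure_Times[OF sets.top sets.top])
  then show "emeasure fullM (space fullM) \<noteq> \<infinity>"
    by (simp add: fullM_def space_pair_measure ennreal_mult_eq_top_iff DM.emeasure_finite N2.emeasure_finite
      del: One_nat_def)
qed

lemma AE_fullM: "AE X in fullM. fst X \<in> G.box \<and> snd X \<in> unit_simplex n1"
  unfolding fullM_def
proof (rule N3.AE_pair_measure)
  have "G.box \<in> sets (borel \<Otimes>\<^sub>M borel)" unfolding G.box_def by (intro pair_measureI) auto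
  then show "{X \<in> space (nu2 a b \<Otimes>\<^sub>M dirM n1 (a + b)). fst X \<in> G.box \<and> snd X \<in> unit_simplex n1}
      \<in> sets (nu2 a b \<Otimes>\<^sub>M dirM n1 (a + b))"
    by measurable
  show "AE x in nu2 a b. AE y in dirM n1 (a + b). fst (x, y) \<in> G.box \<and> snd (x, y) \<in> unit_simplex n1"
    using G.AE_box by eventually_elim (use AE_dirM[of n1 "a + b"] in \<open>eventually_elim, auto\<close>)
qed

lemma phase_bound:
  assumes "t \<in> unit_simplex n1"
  shows "\<bar>phase Q (q, t)\<bar> \<le> 1"
proof -
  have pos: "simplex_ext n1 t j \<ge> 0" if "j < k" for j
  proof -
    have "j \<le> n1" using that by linarith
    from simplex_ext_pos[OF assms this] show ?thesis by (rule less_imp_le)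
  qed
  have "\<bar>phase Q (q, t)\<bar> \<le> (\<Sum>j<k. \<bar>cos ((Q q - 2 * real j * pi) / real k) * simplex_ext n1 t j\<bar>)"
    unfolding phase_def by (simp add: sum_abs)
  also have "\<dots> \<le> (\<Sum>j<k. simplex_ext n1 t j)"
    using pos by (intro sum_mono) (auto simp: abs_mult mult_left_le_one_le)
  also have "\<dots> = 1" using simplex_ext_sum[of n1 t] unfolding Suc_n1 .
  finally show ?thesis .
qed

lemma AE_phase: "AE X in fullM. \<bar>phase Q X\<bar> \<le> 1"
  using AE_fullM
proof eventually_elim
  case (elim X)
  then show ?case using phase_bound[of "snd X" Q "fst X"] by simp
qed

text \<open>Both the sum over the $k$ points and their product are given by the Poisson kernel at the
  $k$-th power, so the Feynman formula collapses to a single power.\<close>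

lemma LINT_fullM_kernel:
  assumes Q [measurable]: "Q \<in> borel_measurable (borel \<Otimes>\<^sub>M borel)"
    and ps: "\<bar>p\<bar> + \<bar>s\<bar> \<le> 1"
    and cosQ: "\<And>q. q \<in> G.box \<Longrightarrow> cos (Q q) = snd q * p + fst q * s"
    and t: "\<bar>t\<bar> < 1"
  shows "(LINT X|fullM. (1 - rr t * phase Q X) powr (- cq))
    = Gamma (a + b) ^ k / Gamma (real k * (a + b)) * (Ck t / real k * gegenbauer_kernel.Ik a b p s (\<lambda>_. 1) (t ^ k))"
proof -
  interpret H: gegenbauer_kernel a b p s by unfold_locales (use a b ps in auto)
  define K where "K = Gamma (a + b) ^ k / Gamma (real k * (a + b))"
  have K0: "K \<ge> 0" unfolding K_def using lam_pos by (intro divide_nonneg_nonneg) auto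
  have rr1: "\<bar>rr t\<bar> < 1"
  proof -
    have pos: "1 + t\<^sup>2 > 0" by (simp add: add_pos_nonneg)
    have "(1 - \<bar>t\<bar>)\<^sup>2 > 0" using t by simp
    then have "2 * \<bar>t\<bar> < 1 + t\<^sup>2" by (simp add: power2_eq_square algebra_simps)
    then show ?thesis unfolding rr_def abs_divide abs_mult using pos by (simp add: divide_less_eq)
  qed
  have Lm: "phase Q \<in> borel_measurable fullM"
    using phase_measurable[OF Q] by (simp cong: measurable_cong_sets add: sets_fullM)
  note [measurable] = Lm
  have bnd: "\<bar>(1 - rr t * l) powr (- cq)\<bar> \<le> (1 - \<bar>rr t\<bar>) powr (- cq)" if "\<bar>l\<bar> \<le> 1" for l
  proof -
    have "rr t * l \<le> \<bar>rr t\<bar> * \<bar>l\<bar>" by (simp add: abs_mult[symmetric])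
    also have "\<dots> \<le> \<bar>rr t\<bar> * 1" using that by (intro mult_left_mono) auto
    finally have "rr t * l \<le> \<bar>rr t\<bar>" by simp
    then show ?thesis using rr1 cq_pos by (simp add: powr_mono2')
  qed
  interpret F3: finite_measure fullM by (rule finite_fullM)
  have int: "integrable fullM (\<lambda>X. (1 - rr t * phase Q X) powr (- cq))"
  proof (rule F3.integrable_const_bound)
    show "AE X in fullM. norm ((1 - rr t * phase Q X) powr (- cq)) \<le> (1 - \<bar>rr t\<bar>) powr (- cq)"
      using AE_phase[of Q] by eventually_elim (use bnd in auto)
  qed measurable
  have inner: "(LINT u|dirM n1 (a + b). (1 - rr t * phase Q (q, u)) powr (- cq))
      = K * (Ck t / real k) * (1 * gen p s (t ^ k) q powr (- (a + b) - 1))" if q: "q \<in> G.box" for q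
  proof -
    \<comment> \<open>As the barycentric coordinates add up to 1, the base of the power is the
      linear form with these coefficients, which are positive as the Feynman formula
      demands.\<close>
    define cj where "cj j = 1 - rr t * cos ((Q q - 2 * real j * pi) / real k)" for j :: nat
    \<comment> \<open>With this sign the cosines are the real parts of \<open>v\<close> times the
      k-th roots of unity in standard order, and \<open>v ^ k\<close> has real part
      \<open>cos (Q q)\<close>.\<close>
    define v where "v = cis (- (Q q / real k))"
    have v1: "cmod v = 1" by (simp add: v_def)
    have cos_eq: "cos ((Q q - 2 * real j * pi) / real k) = Re (v * cis (2 * pi * real j / real k))" for j
    proof -
      have "v * cis (2 * pi * real j / real k) = cis (- ((Q q - 2 * real j * pi) / real k))"
        by (simp add: v_def cis_mult diff_divide_distrib mult_ac)
      then show ?thesis by simp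
    qed
    have vk: "Re (v ^ k) = snd q * p + fst q * s"
      using cosQ[OF q] by (simp add: v_def Complex.DeMoivre)
    define D where "D = gen p s (t ^ k) q"
    have D: "1 - 2 * t ^ k * Re (v ^ k) + (t ^ k)\<^sup>2 = D" by (simp add: D_def gen_def vk)
    have Dpos: "D > 0" unfolding D_def
      using q pow_lt_1[OF t] by (intro H.gen_pos) (auto simp: H.box_def G.box_def)
    have cpos: "cj j > 0" for j
    proof -
      have "rr t * cos ((Q q - 2 * real j * pi) / real k) \<le> \<bar>rr t\<bar> * \<bar>cos ((Q q - 2 * real j * pi) / real k)\<bar>"
        by (simp add: abs_mult[symmetric])
      also have "\<dots> \<le> \<bar>rr t\<bar> * 1" by (intro mult_left_mono) auto
      finally have "rr t * cos ((Q q - 2 * real j * pi) / real k) \<le> \<bar>rr t\<bar>" by simp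
      then show ?thesis unfolding cj_def using rr1 by linarith
    qed
    have prodc: "(\<Prod>j<k. cj j) = D / (1 + t\<^sup>2) ^ k"
      unfolding cj_def cos_eq rr_def prod_poisson[OF k_pos(1) v1 t] D ..
    have sumc: "(\<Sum>j<k. 1 / cj j) = real k * (1 + t\<^sup>2) * (1 - (t ^ k)\<^sup>2) / ((1 - t\<^sup>2) * D)"
      unfolding cj_def cos_eq rr_def sum_poisson[OF k_pos(1) v1 t] D ..
    have lin: "1 - rr t * phase Q (q, u) = (\<Sum>j<k. cj j * simplex_ext n1 u j)" for u
    proof -
      have "(\<Sum>j<k. cj j * simplex_ext n1 u j) = (\<Sum>j<k. simplex_ext n1 u j) - rr t * phase Q (q, u)"
        by (simp only: cj_def phase_def fst_conv snd_conv left_diff_distrib mult_1 sum_subtractf sum_distrib_left mult.assoc)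
      then show ?thesis using simplex_ext_sum[of n1 u] unfolding Suc_n1 by simp
    qed
    have "(\<integral>\<^sup>+u. ennreal ((1 - rr t * phase Q (q, u)) powr (- cq)) \<partial>dirM n1 (a + b))
        = ennreal (K * ((\<Prod>j<k. cj j) powr (- (a + b)) * ((\<Sum>j<k. 1 / cj j) / real k)))"
      unfolding lin K_def using nn_integral_dirM_feynman[OF lam_pos, of n1 cj] cpos unfolding Suc_n1 by simp
    moreover have "(\<lambda>u. (1 - rr t * phase Q (q, u)) powr (- cq)) \<in> borel_measurable (dirM n1 (a + b))"
    proof -
      have "(\<lambda>u. \<Sum>j<k. cj j * simplex_ext n1 u j) \<in> borel_measurable (PiM {1..n1} (\<lambda>_. lborel))"
        by (intro borel_measurable_sum borel_measurable_times borel_measurable_const simplex_ext_measurable) auto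
      then have "(\<lambda>u. \<Sum>j<k. cj j * simplex_ext n1 u j) \<in> borel_measurable (dirM n1 (a + b))"
        by (simp cong: measurable_cong_sets)
      then show ?thesis unfolding lin by measurable
    qed
    moreover have "0 \<le> K * ((\<Prod>j<k. cj j) powr (- (a + b)) * ((\<Sum>j<k. 1 / cj j) / real k))"
      using K0 cpos by (intro mult_nonneg_nonneg divide_nonneg_nonneg sum_nonneg) (auto simp: less_imp_le)
    ultimately have "(LINT u|dirM n1 (a + b). (1 - rr t * phase Q (q, u)) powr (- cq))
        = K * ((\<Prod>j<k. cj j) powr (- (a + b)) * ((\<Sum>j<k. 1 / cj j) / real k))"
      by (subst integral_eq_nn_integral) auto
    \<comment> \<open>The product of the coefficients supplies the exponent \<open>- (a + b)\<close>
      of \<open>D\<close>; the sum of their reciprocals supplies one further power.\<close>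
    also have "(\<Prod>j<k. cj j) powr (- (a + b)) = D powr (- (a + b)) * (1 + t\<^sup>2) powr (real k * (a + b))"
    proof -
      have pos: "1 + t\<^sup>2 > 0" by (simp add: add_pos_nonneg)
      have "((1 + t\<^sup>2) ^ k) powr (- (a + b)) = (1 + t\<^sup>2) powr (- (real k * (a + b)))"
        using pos by (simp add: powr_realpow[symmetric] powr_powr algebra_simps)
      then have E: "((1 + t\<^sup>2) ^ k) powr (- (a + b)) = inverse ((1 + t\<^sup>2) powr (real k * (a + b)))"
        by (simp only: powr_minus)
      have "(D / (1 + t\<^sup>2) ^ k) powr (- (a + b)) = D powr (- (a + b)) / ((1 + t\<^sup>2) ^ k) powr (- (a + b))"
        by (rule powr_divide)
      then show ?thesis unfolding prodc E by (simp only: divide_inverse inverse_inverse_eq)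
    qed
    also have "D powr (- (a + b)) * (1 + t\<^sup>2) powr (real k * (a + b)) * ((\<Sum>j<k. 1 / cj j) / real k)
        = Ck t / real k * D powr (- (a + b) - 1)"
      unfolding sumc Ck_def using Dpos by (simp add: powr_diff mult_ac)
    finally show ?thesis unfolding D_def by (simp only: mult.assoc mult_1)
  qed
  have int': "integrable (nu2 a b \<Otimes>\<^sub>M dirM n1 (a + b)) (\<lambda>(q, u). (1 - rr t * phase Q (q, u)) powr (- cq))"
    using int by (simp add: fullM_def case_prod_beta')
  have "(LINT X|fullM. (1 - rr t * phase Q X) powr (- cq))
      = (LINT q|nu2 a b. LINT u|dirM n1 (a + b). (1 - rr t * phase Q (q, u)) powr (- cq))"
    using N3.integral_fst[OF int'] by (simp add: fullM_def case_prod_beta')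
  also have "\<dots> = (LINT q|nu2 a b. K * (Ck t / real k) * (1 * gen p s (t ^ k) q powr (- (a + b) - 1)))"
  proof (rule integral_cong_AE)
    show "AE q in nu2 a b. (LINT u|dirM n1 (a + b). (1 - rr t * phase Q (q, u)) powr (- cq))
        = K * (Ck t / real k) * (1 * gen p s (t ^ k) q powr (- (a + b) - 1))"
      using G.AE_box by eventually_elim (rule inner)
    show "(\<lambda>q. LINT u|dirM n1 (a + b). (1 - rr t * phase Q (q, u)) powr (- cq)) \<in> borel_measurable (nu2 a b)"
      using int' by (intro DM.borel_measurable_lebesgue_integral) auto
  qed measurable
  also have "\<dots> = K * (Ck t / real k) * H.Ik (\<lambda>_. 1) (t ^ k)"
    unfolding H.Ik_def by (rule integral_mult_right_zero)
  finally show ?thesis unfolding K_def by (simp only: mult.assoc)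
qed

section \<open>Taylor coefficients of the two sides\<close>

definition bessel_coeff :: "nat \<Rightarrow> real" where
  "bessel_coeff n = (\<Sum>j<2*k. Ecomp (rot (int j) y) n x + Ecomp (rfl (int j) y) n x) / (4 * real k)"

lemma bessel_coeff_sums:
  assumes r: "\<bar>r\<bar> < 1/6"
  shows "(\<lambda>n. pochhammer cq n * bessel_coeff n * r ^ n) sums
    ((\<Sum>j<2*k. Sser (rot (int j) y) r x + Sser (rfl (int j) y) r x) / (4 * real k))"
proof -
  have "(\<lambda>n. (\<Sum>j<2*k. scoef (rot (int j) y) n x * r ^ n + scoef (rfl (int j) y) n x * r ^ n) / (4 * real k)) sums
    ((\<Sum>j<2*k. Sser (rot (int j) y) r x + Sser (rfl (int j) y) r x) / (4 * real k))"
    using x y r by (intro sums_divide sums_sum sums_add Sser_sums) auto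
  moreover have "(\<Sum>j<2*k. scoef (rot (int j) y) n x * r ^ n + scoef (rfl (int j) y) n x * r ^ n) / (4 * real k)
      = pochhammer cq n * bessel_coeff n * r ^ n" for n
  proof -
    have "scoef (rot (int j) y) n x * r ^ n + scoef (rfl (int j) y) n x * r ^ n
        = (pochhammer cq n * r ^ n) * (Ecomp (rot (int j) y) n x + Ecomp (rfl (int j) y) n x)" for j
      by (simp add: scoef_def algebra_simps)
    then show ?thesis by (simp add: sum_distrib_left[symmetric] bessel_coeff_def)
  qed
  ultimately show ?thesis by simp
qed

text \<open>The orbit of \<open>y\<close> splits into four cosets, each handled by
  \<open>sum_Sclosed_coset\<close>. The four weights add up to 4, so averaging over the group
  removes the weight.\<close>

lemma sum_Sclosed_orbit:
  assumes t: "\<bar>t\<bar> < 1"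
  shows "(\<Sum>j<2*k. Sclosed (rot (int j) y) t x + Sclosed (rfl (int j) y) t x) = 4 * (Ck t * G.Ik (\<lambda>_. 1) (t ^ k))"
proof -
  let ?R = "t ^ k"
  have inr: "u \<bullet> v = Re (cnj u * v)" for u v :: complex by (simp add: inner_complex_def)
  have 1: "(\<Sum>i<k. Sclosed (rot (2 * int i) y) t x) = Ck t * gegenbauer_kernel.Ik a b (pp x y) (ss x y) wpp ?R"
  proof (rule sum_Sclosed_coset[OF t, where u = "cnj x * y"])
    show "cmod (cnj x * y) = 1" using x y by (simp add: norm_mult)
    show "x \<bullet> rot (2 * int i) y = Re (cnj x * y * cis (2 * pi * real i / real k))" for i
      unfolding inr rot_def c_even by (simp only: mult_ac)
    show "Re ((cnj x * y) ^ k) = pp x y + ss x y"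
      by (simp add: power_mult_distrib pp_def ss_def flip: complex_cnj_power)
  qed (auto simp: pp_def ss_def rot_power)
  have 2: "(\<Sum>i<k. Sclosed (rot (2 * int i + 1) y) t x) = Ck t * gegenbauer_kernel.Ik a b (- pp x y) (- ss x y) wpp ?R"
  proof (rule sum_Sclosed_coset[OF t, where u = "cnj x * y * c 1"])
    show "cmod (cnj x * y * c 1) = 1" using x y by (simp add: norm_mult)
    show "x \<bullet> rot (2 * int i + 1) y = Re (cnj x * y * c 1 * cis (2 * pi * real i / real k))" for i
      unfolding inr rot_def c_add c_even by (simp only: mult_ac)
    show "Re ((cnj x * y * c 1) ^ k) = - pp x y + - ss x y"
      by (simp add: power_mult_distrib pp_def ss_def c_power flip: complex_cnj_power)
  qed (auto simp: pp_def ss_def rot_power)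
  have 3: "(\<Sum>i<k. Sclosed (rfl (2 * int i) y) t x) = Ck t * gegenbauer_kernel.Ik a b (pp x y) (- ss x y) wpp ?R"
  proof (rule sum_Sclosed_coset[OF t, where u = "cnj x * cnj y"])
    show "cmod (cnj x * cnj y) = 1" using x y by (simp add: norm_mult)
    show "x \<bullet> rfl (2 * int i) y = Re (cnj x * cnj y * cis (2 * pi * real i / real k))" for i
      unfolding inr rfl_def c_even by (simp only: mult_ac)
    show "Re ((cnj x * cnj y) ^ k) = pp x y + - ss x y"
      by (simp add: power_mult_distrib pp_def ss_def flip: complex_cnj_power)
  qed (auto simp: pp_def ss_def rfl_power simp del: complex_cnj_power)
  have 4: "(\<Sum>i<k. Sclosed (rfl (2 * int i + 1) y) t x) = Ck t * gegenbauer_kernel.Ik a b (- pp x y) (ss x y) wpp ?R"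
  proof (rule sum_Sclosed_coset[OF t, where u = "cnj x * cnj y * c 1"])
    show "cmod (cnj x * cnj y * c 1) = 1" using x y by (simp add: norm_mult)
    show "x \<bullet> rfl (2 * int i + 1) y = Re (cnj x * cnj y * c 1 * cis (2 * pi * real i / real k))" for i
      unfolding inr rfl_def c_add c_even by (simp only: mult_ac)
    show "Re ((cnj x * cnj y * c 1) ^ k) = - pp x y + ss x y"
      by (simp add: power_mult_distrib pp_def ss_def c_power flip: complex_cnj_power)
  qed (auto simp: pp_def ss_def rfl_power simp del: complex_cnj_power)
  have R: "\<bar>?R\<bar> < 1" by (rule pow_lt_1[OF t])
  have "(\<Sum>j<2*k. Sclosed (rot (int j) y) t x + Sclosed (rfl (int j) y) t x)
      = Ck t * (Jk wpp y x ?R + Jk wmm y x ?R + (Jk wmp y x ?R + Jk wpm y x ?R))"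
    unfolding sum.distrib sum_even_odd[of "\<lambda>j. Sclosed (rot j y) t x"] sum_even_odd[of "\<lambda>j. Sclosed (rfl j y) t x"]
      1 2 3 4 Jk_flips[OF x y R] Jk_def[of wpp, symmetric] by (simp only: distrib_left)
  also have "Jk wpp y x ?R + Jk wmm y x ?R + (Jk wmp y x ?R + Jk wpm y x ?R) = 4 * G.Ik (\<lambda>_. 1) ?R"
  proof -
    have e: "- (a + b) - 1 \<le> 0" using lam_pos by simp
    have "integrable (nu2 a b) (\<lambda>q. wpp q * gen (pp x y) (ss x y) ?R q powr (- (a + b) - 1))"
      "integrable (nu2 a b) (\<lambda>q. wmm q * gen (pp x y) (ss x y) ?R q powr (- (a + b) - 1))"
      "integrable (nu2 a b) (\<lambda>q. wmp q * gen (pp x y) (ss x y) ?R q powr (- (a + b) - 1))"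
      "integrable (nu2 a b) (\<lambda>q. wpm q * gen (pp x y) (ss x y) ?R q powr (- (a + b) - 1))"
      using G.box_prod_bounds by (intro G.integrable_gen R e; measurable)+
    then have "Jk wpp y x ?R + Jk wmm y x ?R + (Jk wmp y x ?R + Jk wpm y x ?R)
      = (LINT q|nu2 a b. wpp q * gen (pp x y) (ss x y) ?R q powr (- (a + b) - 1)
          + wmm q * gen (pp x y) (ss x y) ?R q powr (- (a + b) - 1)
          + (wmp q * gen (pp x y) (ss x y) ?R q powr (- (a + b) - 1)
          + wpm q * gen (pp x y) (ss x y) ?R q powr (- (a + b) - 1)))"
      unfolding Jk_def G.Ik_def
      by (simp only: Bochner_Integration.integral_add Bochner_Integration.integrable_add)
    also have "\<dots> = (LINT q|nu2 a b. 4 * (1 * gen (pp x y) (ss x y) ?R q powr (- (a + b) - 1)))"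
      by (rule Bochner_Integration.integral_cong) (simp_all add: algebra_simps)
    also have "\<dots> = 4 * G.Ik (\<lambda>_. 1) ?R"
      unfolding G.Ik_def by (rule integral_mult_right_zero)
    finally show ?thesis .
  qed
  finally show ?thesis by simp
qed

lemma bessel_coeff_sums_rr:
  assumes t: "0 \<le> t" "t \<le> 1/13"
  shows "(\<lambda>n. pochhammer cq n * bessel_coeff n * rr t ^ n) sums (Ck t / real k * G.Ik (\<lambda>_. 1) (t ^ k))"
proof -
  have r: "\<bar>rr t\<bar> < 1/6" using rr_bound[of t] t by simp
  have "(\<Sum>j<2*k. Sser (rot (int j) y) (rr t) x + Sser (rfl (int j) y) (rr t) x)
      = 4 * (Ck t * G.Ik (\<lambda>_. 1) (t ^ k))"
    using sum_Sclosed_orbit[of t] t x y by (simp add: Sser_eq_Sclosed)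
  then have "(\<Sum>j<2*k. Sser (rot (int j) y) (rr t) x + Sser (rfl (int j) y) (rr t) x) / (4 * real k)
      = Ck t / real k * G.Ik (\<lambda>_. 1) (t ^ k)" by simp
  with bessel_coeff_sums[OF r] show ?thesis by simp
qed

definition angle0 :: "real \<times> real \<Rightarrow> real" where
  "angle0 q = arccos (snd q * pp x y + fst q * ss x y)"

lemma angle0_measurable [measurable]: "angle0 \<in> borel_measurable (borel \<Otimes>\<^sub>M borel)"
  unfolding angle0_def[abs_def] by measurable

definition Kd :: real where "Kd = Gamma (real k * (a + b)) / (2 * Gamma (a + b) ^ k)"

definition moment_coeff :: "nat \<Rightarrow> real" where
  "moment_coeff n = Kd * ((LINT X|fullM. phase angle0 X ^ n) + (LINT X|fullM. phase (\<lambda>q. pi - angle0 q) X ^ n)) / fact n"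

lemma phase_meas3:
  "Q \<in> borel_measurable (borel \<Otimes>\<^sub>M borel) \<Longrightarrow> phase Q \<in> borel_measurable fullM"
  using phase_measurable by (simp cong: measurable_cong_sets add: sets_fullM)

text \<open>The pochhammer weight turns the exponential series of the moments into a binomial
  series, just as it turns the components of the kernel into \<open>Sser\<close>.\<close>

lemma LINT_phase_binomial_sums:
  assumes [measurable]: "Q \<in> borel_measurable (borel \<Otimes>\<^sub>M borel)" and r: "\<bar>r\<bar> < 1"
  shows "(\<lambda>n. pochhammer cq n / fact n * r ^ n * (LINT X|fullM. phase Q X ^ n)) sums
    (LINT X|fullM. (1 - r * phase Q X) powr (- cq))"
proof -
  note [measurable] = phase_meas3[OF assms(1)]
  have "summable (\<lambda>n. \<bar>pochhammer cq n / fact n * r ^ n\<bar>)"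
  proof -
    have "(\<lambda>n. \<bar>pochhammer cq n / fact n * r ^ n\<bar>) = (\<lambda>n. pochhammer cq n / fact n * \<bar>r\<bar> ^ n)"
      using cq_pos by (simp add: abs_mult power_abs pochhammer_nonneg)
    then show ?thesis using pochhammer_binomial_sums[of "\<bar>r\<bar>" cq] r by (simp add: sums_iff)
  qed
  from LINT_power_series_sums[OF finite_fullM _ AE_phase this, of Q]
  have "(\<lambda>n. pochhammer cq n / fact n * r ^ n * (LINT X|fullM. phase Q X ^ n)) sums
      (LINT X|fullM. (\<Sum>n. pochhammer cq n / fact n * r ^ n * phase Q X ^ n))" by simp
  also have "(LINT X|fullM. (\<Sum>n. pochhammer cq n / fact n * r ^ n * phase Q X ^ n))
      = (LINT X|fullM. (1 - r * phase Q X) powr (- cq))"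
  proof (rule integral_cong_AE)
    show "AE X in fullM. (\<Sum>n. pochhammer cq n / fact n * r ^ n * phase Q X ^ n) = (1 - r * phase Q X) powr (- cq)"
      using AE_phase[of Q]
    proof eventually_elim
      case (elim X)
      have "\<bar>r * phase Q X\<bar> \<le> \<bar>r\<bar> * 1" unfolding abs_mult using elim by (intro mult_left_mono) auto
      then have "\<bar>r * phase Q X\<bar> < 1" using r by simp
      from pochhammer_binomial_sums[OF this, of cq] show ?case
        by (simp add: sums_iff power_mult_distrib mult.assoc)
    qed
  qed measurable
  finally show ?thesis .
qed

lemma LINT_phase_exp_sums:
  assumes [measurable]: "Q \<in> borel_measurable (borel \<Otimes>\<^sub>M borel)"
  shows "(\<lambda>n. r ^ n / fact n * (LINT X|fullM. phase Q X ^ n)) sums (LINT X|fullM. exp (r * phase Q X))"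
proof -
  note [measurable] = phase_meas3[OF assms(1)]
  have "summable (\<lambda>n. \<bar>r ^ n / fact n\<bar>)"
    using summable_exp[of "\<bar>r\<bar>"] by (simp add: abs_mult power_abs divide_inverse mult.commute)
  from LINT_power_series_sums[OF finite_fullM _ AE_phase this, of Q]
  have "(\<lambda>n. r ^ n / fact n * (LINT X|fullM. phase Q X ^ n)) sums (LINT X|fullM. (\<Sum>n. r ^ n / fact n * phase Q X ^ n))"
    by simp
  moreover have "(\<Sum>n. r ^ n / fact n * phase Q X ^ n) = exp (r * phase Q X)" for X
    by (simp add: exp_def power_mult_distrib divide_inverse mult_ac)
  ultimately show ?thesis by simp
qed

lemma moment_coeff_sums:
  assumes r: "\<bar>r\<bar> < 1"
  shows "(\<lambda>n. pochhammer cq n * moment_coeff n * r ^ n) sums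
    (Kd * ((LINT X|fullM. (1 - r * phase angle0 X) powr (- cq)) + (LINT X|fullM. (1 - r * phase (\<lambda>q. pi - angle0 q) X) powr (- cq))))"
proof -
  have "(\<lambda>n. Kd * (pochhammer cq n / fact n * r ^ n * (LINT X|fullM. phase angle0 X ^ n)
      + pochhammer cq n / fact n * r ^ n * (LINT X|fullM. phase (\<lambda>q. pi - angle0 q) X ^ n))) sums
    (Kd * ((LINT X|fullM. (1 - r * phase angle0 X) powr (- cq)) + (LINT X|fullM. (1 - r * phase (\<lambda>q. pi - angle0 q) X) powr (- cq))))"
    by (intro sums_mult sums_add LINT_phase_binomial_sums r) measurable
  moreover have "Kd * (P / fact n * R * A + P / fact n * R * B) = P * (Kd * (A + B) / fact n) * R"
    for P R A B :: real and n by (simp add: algebra_simps add_divide_distrib)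
  ultimately show ?thesis unfolding moment_coeff_def by (simp only:)
qed

text \<open>Replacing q by pi - q changes the signs of both \<open>pp\<close> and \<open>ss\<close>,
  which the evenness of the measures undoes, so the two angles contribute equally. This accounts for
  the 2 in \<open>Kd\<close>; its Gamma quotient cancels the mass of the Dirichlet measure.\<close>

lemma moment_coeff_sums_rr:
  assumes t: "0 \<le> t" "t \<le> 1/13"
  shows "(\<lambda>n. pochhammer cq n * moment_coeff n * rr t ^ n) sums (Ck t / real k * G.Ik (\<lambda>_. 1) (t ^ k))"
proof -
  have t1: "\<bar>t\<bar> < 1" using t by simp
  have r: "\<bar>rr t\<bar> < 1" using rr_bound[of t] t by simp
  have R: "\<bar>t ^ k\<bar> < 1" by (rule pow_lt_1[OF t1])
  let ?g = "Gamma (a + b) ^ k / Gamma (real k * (a + b))"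
  have bound: "\<bar>snd q * pp x y + fst q * ss x y\<bar> \<le> 1" if "q \<in> G.box" for q by (rule G.xi_bound[OF that])
  have "(LINT X|fullM. (1 - rr t * phase angle0 X) powr (- cq)) = ?g * (Ck t / real k * G.Ik (\<lambda>_. 1) (t ^ k))"
  proof (rule LINT_fullM_kernel[OF _ G.ps _ t1])
    show "cos (angle0 q) = snd q * pp x y + fst q * ss x y" if "q \<in> G.box" for q
      using bound[OF that] unfolding angle0_def by (intro cos_arccos) auto
  qed measurable
  moreover have "(LINT X|fullM. (1 - rr t * phase (\<lambda>q. pi - angle0 q) X) powr (- cq)) = ?g * (Ck t / real k * G.Ik (\<lambda>_. 1) (t ^ k))"
  proof -
    interpret g': gegenbauer_kernel a b "pp x y" "- ss x y"
      by unfold_locales (use a b G.ps in auto)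
    have "(LINT X|fullM. (1 - rr t * phase (\<lambda>q. pi - angle0 q) X) powr (- cq))
        = ?g * (Ck t / real k * gegenbauer_kernel.Ik a b (- pp x y) (- ss x y) (\<lambda>_. 1) (t ^ k))"
    proof (rule LINT_fullM_kernel[OF _ _ _ t1])
      show "cos (pi - angle0 q) = snd q * - pp x y + fst q * - ss x y" if "q \<in> G.box" for q
        using bound[OF that] cos_arccos[of "snd q * pp x y + fst q * ss x y"] unfolding angle0_def by auto
    qed (use G.ps in auto)
    also have "gegenbauer_kernel.Ik a b (- pp x y) (- ss x y) (\<lambda>_. 1) (t ^ k) = g'.Ik (\<lambda>_. 1) (t ^ k)"
      using g'.Ik_flip_snd[OF R, of "\<lambda>_. 1" 1] by simp
    also have "\<dots> = G.Ik (\<lambda>_. 1) (t ^ k)"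
      using G.Ik_flip_fst[OF R, of "\<lambda>_. 1" 1] by simp
    finally show ?thesis .
  qed
  moreover have "Kd * (?g * V + ?g * V) = V" for V
  proof -
    have "Gamma (a + b) > 0" "Gamma (real k * (a + b)) > 0" using lam_pos by auto
    then show ?thesis by (simp add: Kd_def)
  qed
  ultimately show ?thesis using moment_coeff_sums[OF r] by (simp only:)
qed

text \<open>Both weighted series have the same sum at every \<open>rr t\<close> with t in [0, 1/13],
  and these values accumulate at 0. The weights are positive and can be cancelled.\<close>

lemma bessel_coeff_eq_moment_coeff: "bessel_coeff n = moment_coeff n"
proof -
  define d where "d n = pochhammer cq n * bessel_coeff n - pochhammer cq n * moment_coeff n" for n
  define f where "f r = (\<Sum>n. d n * r ^ n)" for r
  have "d n = 0"
  proof (rule power_series_coeffs_eq_0[where R = "1/6" and f = f])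
    show "(\<lambda>n. d n * r ^ n) sums f r" if "\<bar>r\<bar> < 1/6" for r
    proof -
      have "(\<lambda>n. pochhammer cq n * bessel_coeff n * r ^ n - pochhammer cq n * moment_coeff n * r ^ n) sums
        ((\<Sum>j<2*k. Sser (rot (int j) y) r x + Sser (rfl (int j) y) r x) / (4 * real k)
          - Kd * ((LINT X|fullM. (1 - r * phase angle0 X) powr (- cq)) + (LINT X|fullM. (1 - r * phase (\<lambda>q. pi - angle0 q) X) powr (- cq))))"
        using that by (intro sums_diff bessel_coeff_sums moment_coeff_sums) auto
      then show ?thesis unfolding f_def d_def left_diff_distrib by (intro summable_sums sums_summable)
    qed
    have fr: "f (rr t) = 0" if "0 \<le> t" "t \<le> 1/13" for t
    proof -
      have "(\<lambda>n. d n * rr t ^ n) sums 0"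
        using sums_diff[OF bessel_coeff_sums_rr[OF that] moment_coeff_sums_rr[OF that]]
        by (simp add: d_def left_diff_distrib)
      then show ?thesis unfolding f_def by (simp add: sums_iff)
    qed
    from fr[of 0] show "f 0 = 0" by (simp add: rr_def)
    show "\<exists>r. 0 < r \<and> r \<le> e \<and> f r = 0" if "e > 0" for e
    proof (intro exI conjI)
      define t where "t = min (1/13) (e / 2)"
      have t: "0 < t" "t \<le> 1/13" "2 * t \<le> e" using that by (auto simp: t_def min_def)
      show "f (rr t) = 0" using t by (intro fr) auto
      show "rr t \<le> e" using rr_bound[of t] t by simp
      show "0 < rr t" unfolding rr_def using t by (intro divide_pos_pos) (auto simp: add_pos_nonneg)
    qed
  qed simp
  moreover have "pochhammer cq n > 0" using cq_pos by (rule pochhammer_pos)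
  ultimately show ?thesis by (simp add: d_def)
qed

end

section \<open>The generalized Bessel function\<close>

context dihedral_pair
begin

text \<open>Fubini back to the iterated form, where the two exponentials stand under a single
  integral sign; integrability holds because \<open>phase\<close> is bounded by 1 almost
  everywhere.\<close>

lemma LINT_fullM_iterated:
  assumes Q [measurable]: "Q \<in> borel_measurable (borel \<Otimes>\<^sub>M borel)"
    and Q' [measurable]: "Q' \<in> borel_measurable (borel \<Otimes>\<^sub>M borel)"
  shows "(LINT X|fullM. exp (r * phase Q X)) + (LINT X|fullM. exp (r * phase Q' X)) =
    (LINT u:{-1..1}|lborel. LINT v:{-1..1}|lborel. nu_density a u * nu_density b v *
       (LINT t:unit_simplex n1|PiM {1..n1} (\<lambda>_. lborel).
          (exp (r * phase Q ((u, v), t)) + exp (r * phase Q' ((u, v), t)))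
            * (\<Prod>j<k. simplex_ext n1 t j powr (a + b - 1))))"
proof -
  interpret F3: finite_measure fullM by (rule finite_fullM)
  let ?D = "dirM n1 (a + b)"
  note [measurable] = phase_meas3[OF Q] phase_meas3[OF Q']
  define h where "h X = exp (r * phase Q X) + exp (r * phase Q' X)" for X
  have bnd: "norm (exp (r * l)) \<le> exp \<bar>r\<bar>" if "\<bar>l\<bar> \<le> 1" for l
  proof -
    have "r * l \<le> \<bar>r\<bar> * \<bar>l\<bar>" by (simp add: abs_mult[symmetric])
    also have "\<dots> \<le> \<bar>r\<bar> * 1" using that by (intro mult_left_mono) auto
    finally show ?thesis by simp
  qed
  have int1: "integrable fullM (\<lambda>X. exp (r * phase Q X))"
  proof (rule F3.integrable_const_bound)
    show "AE X in fullM. norm (exp (r * phase Q X)) \<le> exp \<bar>r\<bar>"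
      using AE_phase[of Q] by (rule eventually_mono) (rule bnd)
  qed measurable
  have int2: "integrable fullM (\<lambda>X. exp (r * phase Q' X))"
  proof (rule F3.integrable_const_bound)
    show "AE X in fullM. norm (exp (r * phase Q' X)) \<le> exp \<bar>r\<bar>"
      using AE_phase[of Q'] by (rule eventually_mono) (rule bnd)
  qed measurable
  have inth: "integrable (nu2 a b \<Otimes>\<^sub>M ?D) (\<lambda>(q, t). h (q, t))"
    using Bochner_Integration.integrable_add[OF int1 int2] by (simp add: h_def[abs_def] fullM_def case_prod_beta')
  have hm: "h \<in> borel_measurable ((borel \<Otimes>\<^sub>M borel) \<Otimes>\<^sub>M PiM {1..n1} (\<lambda>_. lborel))"
    unfolding h_def[abs_def] using phase_measurable[OF Q] phase_measurable[OF Q'] by measurable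
  define H where "H q = (LINT t|?D. h (q, t))" for q
  have Hm: "H \<in> borel_measurable (borel \<Otimes>\<^sub>M borel)"
  proof -
    have "(\<lambda>(q, t). h (q, t)) \<in> borel_measurable ((borel \<Otimes>\<^sub>M borel) \<Otimes>\<^sub>M ?D)"
      using hm by (simp add: case_prod_eta cong: measurable_cong_sets sets_pair_measure_cong)
    then show ?thesis unfolding H_def by (rule DM.borel_measurable_lebesgue_integral)
  qed
  note [measurable] = Hm
  have inner: "(LINT t:unit_simplex n1|PiM {1..n1} (\<lambda>_. lborel).
      (exp (r * phase Q (q, t)) + exp (r * phase Q' (q, t))) * (\<Prod>j<k. simplex_ext n1 t j powr (a + b - 1))) = H q" for q
  proof -
    have m: "(\<lambda>t. h (q, t)) \<in> borel_measurable (PiM {1..n1} (\<lambda>_. lborel))"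
      using measurable_Pair2[OF hm, of q] by (simp add: space_pair_measure)
    have "H q = (LINT t|PiM {1..n1} (\<lambda>_. lborel).
        (indicator (unit_simplex n1) t * (\<Prod>j<Suc n1. simplex_ext n1 t j powr (a + b - 1))) *\<^sub>R h (q, t))"
      unfolding H_def dirM_def
      by (rule integral_density[OF m dir_density_measurable]) (simp add: prod_nonneg)
    then show ?thesis
      unfolding set_lebesgue_integral_def h_def Suc_n1 by (simp add: mult_ac)
  qed
  have intH: "integrable (nuM a \<Otimes>\<^sub>M nuM b) (\<lambda>(u, v). H (u, v))"
  proof -
    have "integrable (nu2 a b) H" using N3.integrable_fst[OF inth] unfolding H_def[abs_def] by simp
    then show ?thesis by (simp add: nu2_def case_prod_eta)
  qed
  have "(LINT X|fullM. exp (r * phase Q X)) + (LINT X|fullM. exp (r * phase Q' X)) = (LINT X|fullM. h X)"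
    unfolding h_def by (rule Bochner_Integration.integral_add[OF int1 int2, symmetric])
  also have "\<dots> = (LINT q|nu2 a b. H q)"
    using N3.integral_fst[OF inth] by (simp add: fullM_def H_def case_prod_eta)
  also have "\<dots> = (LINT u|nuM a. LINT v|nuM b. H (u, v))"
    using G.P.integral_fst[OF intH] by (simp add: nu2_def case_prod_eta)
  also have "\<dots> = (LINT u:{-1..1}|lborel. nu_density a u * (LINT v|nuM b. H (u, v)))"
  proof (rule LINT_nuM[OF a])
    have "(\<lambda>(u, v). H (u, v)) \<in> borel_measurable (borel \<Otimes>\<^sub>M nuM b)"
      using Hm by (simp add: case_prod_eta cong: measurable_cong_sets sets_pair_measure_cong)
    then show "(\<lambda>u. LINT v|nuM b. H (u, v)) \<in> borel_measurable borel"
      by (rule G.B.borel_measurable_lebesgue_integral)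
  qed
  also have "\<dots> = (LINT u:{-1..1}|lborel. LINT v:{-1..1}|lborel. nu_density a u * nu_density b v * H (u, v))"
  proof -
    have "nu_density a u * (LINT v|nuM b. H (u, v)) = (LINT v:{-1..1}|lborel. nu_density a u * nu_density b v * H (u, v))" for u
    proof -
      have "(LINT v|nuM b. H (u, v)) = (LINT v:{-1..1}|lborel. nu_density b v * H (u, v))"
        by (rule LINT_nuM[OF b]) measurable
      then show ?thesis by (simp add: mult.assoc)
    qed
    then show ?thesis by (simp only:)
  qed
  finally show ?thesis unfolding inner .
qed

lemma exp_series:
  "(\<lambda>n. moment_coeff n * r ^ n) sums (Kd * ((LINT X|fullM. exp (r * phase angle0 X)) + (LINT X|fullM. exp (r * phase (\<lambda>q. pi - angle0 q) X))))"
proof -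
  have "(\<lambda>n. Kd * (r ^ n / fact n * (LINT X|fullM. phase angle0 X ^ n) + r ^ n / fact n * (LINT X|fullM. phase (\<lambda>q. pi - angle0 q) X ^ n)))
    sums (Kd * ((LINT X|fullM. exp (r * phase angle0 X)) + (LINT X|fullM. exp (r * phase (\<lambda>q. pi - angle0 q) X))))"
    by (intro sums_mult sums_add LINT_phase_exp_sums) measurable
  moreover have "Kd * (R / fact n * A + R / fact n * B) = Kd * (A + B) / fact n * R"
    for R A B :: real and n by (simp add: algebra_simps add_divide_distrib)
  ultimately show ?thesis unfolding moment_coeff_def by (simp only:)
qed

text \<open>Each component is homogeneous of degree \<open>n\<close> in both arguments, so the
  lengths enter only through \<open>(s * t) ^ n\<close>.\<close>

lemma gen_bessel_series:
  assumes z: "z = s *\<^sub>R x" and w: "w = t *\<^sub>R y"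
  shows "(\<lambda>n. bessel_coeff n * (s * t) ^ n) sums gen_bessel k a b z w"
proof -
  have "(\<lambda>n. (\<Sum>j<2*k. Ecomp (rot (int j) w) n z + Ecomp (rfl (int j) w) n z) / (4 * real k)) sums gen_bessel k a b z w"
    unfolding gen_bessel_def dunkl_kernel_eq_Eser dih_rot_eq dih_refl_eq
    by (intro sums_divide sums_sum sums_add Eser_sums)
  moreover have "(\<Sum>j<2*k. Ecomp (rot (int j) w) n z + Ecomp (rfl (int j) w) n z) / (4 * real k) = bessel_coeff n * (s * t) ^ n" for n
  proof -
    have "rot i w = t *\<^sub>R rot i y" "rfl i w = t *\<^sub>R rfl i y" for i
      by (simp_all add: w rot_def rfl_def)
    then have "Ecomp (rot (int j) w) n z + Ecomp (rfl (int j) w) n z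
        = (Ecomp (rot (int j) y) n x + Ecomp (rfl (int j) y) n x) * (s * t) ^ n" for j
      unfolding z by (simp add: Ecomp_scale Ecomp_scale_snd power_mult_distrib algebra_simps)
    then show ?thesis by (simp add: sum_distrib_right[symmetric] bessel_coeff_def)
  qed
  ultimately show ?thesis by simp
qed

lemma gen_bessel_eq:
  assumes "z = s *\<^sub>R x" "w = t *\<^sub>R y"
  shows "gen_bessel k a b z w = Kd * ((LINT X|fullM. exp (s * t * phase angle0 X)) + (LINT X|fullM. exp (s * t * phase (\<lambda>q. pi - angle0 q) X)))"
proof -
  have "(\<lambda>n. bessel_coeff n * (s * t) ^ n) sums gen_bessel k a b z w"
    by (rule gen_bessel_series[OF assms])
  moreover have "(\<lambda>n. bessel_coeff n * (s * t) ^ n) sums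
      (Kd * ((LINT X|fullM. exp (s * t * phase angle0 X)) + (LINT X|fullM. exp (s * t * phase (\<lambda>q. pi - angle0 q) X))))"
    using exp_series[of "s * t"] unfolding bessel_coeff_eq_moment_coeff .
  ultimately show ?thesis by (rule sums_unique2)
qed

end

theorem mainTheorem7:
  fixes k :: nat and a b :: real and z w :: complex
  assumes "k \<ge> 2" and "a > 0" and "b > 0"
  shows "gen_bessel k a b z w =
    Gamma (real k * (a + b)) / (2 * Gamma (a + b) ^ k) *
    (LINT u:{-1..1}|lborel. LINT v:{-1..1}|lborel.
       nu_density a u * nu_density b v *
       (LINT t:unit_simplex (k - 1)|PiM {1..k - 1} (\<lambda>_. lborel).
          (let q = q_uv u v (real k * Arg z) (real k * Arg w);
               ap = (\<lambda>j. cmod z * cmod w * cos ((q - 2 * real j * pi) / real k));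
               am = (\<lambda>j. cmod z * cmod w * cos ((pi - q - 2 * real j * pi) / real k));
               s = simplex_ext (k - 1) t
           in (exp (\<Sum>j<k. ap j * s j) + exp (\<Sum>j<k. am j * s j))
              * (\<Prod>j<k. s j powr (a + b - 1)))))"
proof -
  interpret dihedral_pair k a b "cis (Arg z)" "cis (Arg w)"
    by unfold_locales (use assms in auto)
  \<comment> \<open>Valid also when an argument is 0: \<open>Arg\<close> takes a default value
    there, and the modulus is 0.\<close>
  have z: "z = cmod z *\<^sub>R cis (Arg z)" and w: "w = cmod w *\<^sub>R cis (Arg w)"
    using rcis_cmod_Arg[of z] rcis_cmod_Arg[of w] by (simp_all add: rcis_def scaleR_conv_of_real)
  \<comment> \<open>By de Moivre the k-th powers of the two directions supply the cosines and sines
    of the multiplied angles.\<close>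
  have q: "q_uv u v (real k * Arg z) (real k * Arg w) = angle0 (u, v)" for u v
    by (simp add: q_uv_def xi_uv_def angle0_def pp_def ss_def Complex.DeMoivre mult.assoc)
  have LLr: "r * phase Q ((u, v), t) = (\<Sum>j<k. r * cos ((Q (u, v) - 2 * real j * pi) / real k) * simplex_ext (k - 1) t j)"
    for r Q u v t
    unfolding phase_def fst_conv snd_conv by (simp only: sum_distrib_left mult.assoc)
  have "gen_bessel k a b z w = Kd * ((LINT X|fullM. exp (cmod z * cmod w * phase angle0 X))
      + (LINT X|fullM. exp (cmod z * cmod w * phase (\<lambda>q. pi - angle0 q) X)))"
    by (rule gen_bessel_eq[OF z w])
  also have "(LINT X|fullM. exp (cmod z * cmod w * phase angle0 X)) + (LINT X|fullM. exp (cmod z * cmod w * phase (\<lambda>q. pi - angle0 q) X))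
    = (LINT u:{-1..1}|lborel. LINT v:{-1..1}|lborel. nu_density a u * nu_density b v *
       (LINT t:unit_simplex (k - 1)|PiM {1..k - 1} (\<lambda>_. lborel).
          (exp (cmod z * cmod w * phase angle0 ((u, v), t)) + exp (cmod z * cmod w * phase (\<lambda>q. pi - angle0 q) ((u, v), t)))
            * (\<Prod>j<k. simplex_ext (k - 1) t j powr (a + b - 1))))"
    by (rule LINT_fullM_iterated) measurable
  finally show ?thesis
    unfolding Kd_def Let_def q LLr .
qed

end
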